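(* Let $r>1$ and $s,t\ge 1$ be integers, let $n=(r-1)s+t$ and $d=\gcd(s,t)$. Up to isomorphism there is a unique tree with passport $[s^{r-1},t;\,r,1^{(r-1)(s-1)+(t-1)}]$; it has $n$ edges, and its monodromy group $G$ satisfies: (i) if $s=t$, then $G\cong \mathbb{Z}_r\wr\mathbb{Z}_s$; (ii) if $s\ne t$, $\gcd(d,\frac{n}{d})=1$ and $r$ is even, then $G\cong S_{n/d}\wr\mathbb{Z}_d$; (iii) if $s\ne t$, $\gcd(d,\frac{n}{d})=1$, $r$ is odd and $\frac{t}{d}$ is even, then $G\cong\widetilde{R}_d$; (iv) if $s\ne t$, $\gcd(d,\frac{n}{d})=1$, $r$ is odd and $\frac{t}{d}$ is odd, then $G\cong A_{n/d}\wr\mathbb{Z}_d$.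
   Context: A dessin is a connected bicolored (black/white, every edge joining a black and a white vertex) graph with a cyclic (counterclockwise) ordering of the edges around each vertex; here all dessins are finite trees, and an isomorphism is a graph isomorphism preserving colors and cyclic orderings. The passport of a dessin is the pair of lists $[b_1,\dots,b_k;w_1,\dots,w_\ell]$ of degrees of the black vertices and of the white vertices (multisets); within a list, $a^m$ denotes $m$ vertices of degree $a$. Label the edges of a dessin $1,\dots,n$. Let $\sigma_0\in S_n$ (resp. $\sigma_1\in S_n$) be the product of the cycles given by the cyclic orders of the edges around the black (resp. white) vertices. The monodromy group of the dessin is $\langle\sigma_0,\sigma_1\rangle\le S_n$ (independent of the labeling up to conjugacy). For a group $H$ and a subgroup $K\le S_d$, the wreath product $H\wr K$ is the semidirect product $H^d\rtimes K$, where $\sigma\in K$ acts on $H^d$ by $\sigma\cdot(h_1,\dots,h_d)=(h_{\sigma(1)},\dots,h_{\sigma(d)})$. Here $\mathbb{Z}_d$ is the cyclic group of order $d$, viewed as the subgroup of $S_d$ generated by a $d$-cycle. $S_m$ and $A_m$ are the symmetric and alternating groups. $\widetilde{R}_d$ denotes the subgroup (of index $2^{d-1}$) of $S_{n/d}\wr\mathbb{Z}_d$ consisting of all $(\tau_1,\dots,\tau_d,g)$ with $\operatorname{sgn}(\tau_1)=\operatorname{sgn}(\tau_2)=\cdots=\operatorname{sgn}(\tau_d)$. *)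

theory Defs
  imports "HOL-Algebra.Algebra" "HOL-Combinatorics.Combinatorics" "HOL-Library.Multiset"
begin

section \<open>Dessins\<close>

text \<open>Vertices and edges are abstract objects, so parallel edges are possible in a dessin.
  The function \<open>rotation D v\<close> sends an edge at \<open>v\<close> to the next one in the counterclockwise
  order around \<open>v\<close>.\<close>

record ('v, 'e) dessin =
  black_vertices :: "'v set"
  white_vertices :: "'v set"
  edges :: "'e set"
  black_end :: "'e \<Rightarrow> 'v"
  white_end :: "'e \<Rightarrow> 'v"
  rotation :: "'v \<Rightarrow> 'e \<Rightarrow> 'e"

definition vertices :: "('v, 'e) dessin \<Rightarrow> 'v set" where
  "vertices D = black_vertices D \<union> white_vertices D"

definition incident_edges :: "('v, 'e) dessin \<Rightarrow> 'v \<Rightarrow> 'e set" where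
  "incident_edges D v = {e \<in> edges D. black_end D e = v \<or> white_end D e = v}"

definition degree :: "('v, 'e) dessin \<Rightarrow> 'v \<Rightarrow> nat" where
  "degree D v = card (incident_edges D v)"

definition joins :: "('v, 'e) dessin \<Rightarrow> 'e \<Rightarrow> 'v \<Rightarrow> 'v \<Rightarrow> bool" where
  "joins D e u v \<longleftrightarrow> e \<in> edges D \<and> {black_end D e, white_end D e} = {u, v}"

definition connected_graph :: "('v, 'e) dessin \<Rightarrow> bool" where
  "connected_graph D \<longleftrightarrow> vertices D \<noteq> {} \<and>
     (\<forall>u \<in> vertices D. \<forall>v \<in> vertices D. (u, v) \<in> {(x, y). \<exists>e. joins D e x y}\<^sup>*)"

text \<open>A permutation of a finite set \<open>S\<close> is a cyclic ordering of \<open>S\<close> iff it acts transitively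
  on \<open>S\<close>; the empty set is allowed here (a vertex without edges), unlike in \<^const>\<open>cyclic_on\<close>.\<close>

definition cyclic_ordering :: "('e \<Rightarrow> 'e) \<Rightarrow> 'e set \<Rightarrow> bool" where
  "cyclic_ordering p S \<longleftrightarrow> p permutes S \<and> (\<forall>e \<in> S. orbit p e = S)"

definition is_dessin :: "('v, 'e) dessin \<Rightarrow> bool" where
  "is_dessin D \<longleftrightarrow>
     finite (vertices D) \<and> finite (edges D) \<and>
     black_vertices D \<inter> white_vertices D = {} \<and>
     (\<forall>e \<in> edges D. black_end D e \<in> black_vertices D \<and> white_end D e \<in> white_vertices D) \<and>
     connected_graph D \<and>
     (\<forall>v \<in> vertices D. cyclic_ordering (rotation D v) (incident_edges D v))"

text \<open>The edge \<open>es ! i\<close> joins \<open>vs ! i\<close> to its cyclic successor in \<open>vs\<close>. A pair of parallel edges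
  is a cycle of length 2; loops cannot occur in a bicolored graph.\<close>

definition graph_cycle :: "('v, 'e) dessin \<Rightarrow> 'v list \<Rightarrow> 'e list \<Rightarrow> bool" where
  "graph_cycle D vs es \<longleftrightarrow>
     length vs = length es \<and> 2 \<le> length es \<and> distinct vs \<and> distinct es \<and>
     (\<forall>i < length es. joins D (es ! i) (vs ! i) (vs ! (Suc i mod length es)))"

definition is_tree :: "('v, 'e) dessin \<Rightarrow> bool" where
  "is_tree D \<longleftrightarrow> is_dessin D \<and> (\<nexists>vs es. graph_cycle D vs es)"

definition passport :: "('v, 'e) dessin \<Rightarrow> nat multiset \<times> nat multiset" where
  "passport D = (image_mset (degree D) (mset_set (black_vertices D)),
                 image_mset (degree D) (mset_set (white_vertices D)))"

definition dessin_isomorphic :: "('v, 'e) dessin \<Rightarrow> ('w, 'f) dessin \<Rightarrow> bool" where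
  "dessin_isomorphic D D' \<longleftrightarrow> (\<exists>\<phi> \<psi>.
     bij_betw \<phi> (vertices D) (vertices D') \<and>
     \<phi> ` black_vertices D = black_vertices D' \<and>
     \<phi> ` white_vertices D = white_vertices D' \<and>
     bij_betw \<psi> (edges D) (edges D') \<and>
     (\<forall>e \<in> edges D. black_end D' (\<psi> e) = \<phi> (black_end D e) \<and>
                    white_end D' (\<psi> e) = \<phi> (white_end D e)) \<and>
     (\<forall>v \<in> vertices D. \<forall>e \<in> incident_edges D v.
        \<psi> (rotation D v e) = rotation D' (\<phi> v) (\<psi> e)))"


section \<open>Monodromy\<close>

definition labeling :: "('v, 'e) dessin \<Rightarrow> ('e \<Rightarrow> nat) \<Rightarrow> bool" where
  "labeling D l \<longleftrightarrow> bij_betw l (edges D) {1..card (edges D)}"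

text \<open>An edge lies in exactly one of the disjoint cycles around the black (white) vertices,
  namely the one at its black (white) end, so their product acts on it as the rotation there.\<close>

definition on_labels :: "('v, 'e) dessin \<Rightarrow> ('e \<Rightarrow> nat) \<Rightarrow> ('e \<Rightarrow> 'e) \<Rightarrow> nat \<Rightarrow> nat" where
  "on_labels D l p i =
     (if i \<in> {1..card (edges D)} then l (p (the_inv_into (edges D) l i)) else i)"

definition sigma0 :: "('v, 'e) dessin \<Rightarrow> ('e \<Rightarrow> nat) \<Rightarrow> nat \<Rightarrow> nat" where
  "sigma0 D l = on_labels D l (\<lambda>e. rotation D (black_end D e) e)"

definition sigma1 :: "('v, 'e) dessin \<Rightarrow> ('e \<Rightarrow> nat) \<Rightarrow> nat \<Rightarrow> nat" where
  "sigma1 D l = on_labels D l (\<lambda>e. rotation D (white_end D e) e)"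

definition monodromy_group :: "('v, 'e) dessin \<Rightarrow> ('e \<Rightarrow> nat) \<Rightarrow> (nat \<Rightarrow> nat) monoid" where
  "monodromy_group D l =
     subgroup_generated (sym_group (card (edges D))) {sigma0 D l, sigma1 D l}"

text \<open>\<^const>\<open>subgroup_generated\<close> silently drops generators outside the group; none are dropped here.\<close>

lemma on_labels_permutes:
  assumes l: "labeling D l" and p: "bij_betw p (edges D) (edges D)"
  shows "on_labels D l p permutes {1..card (edges D)}"
proof (rule bij_imp_permutes)
  have l': "bij_betw l (edges D) {1..card (edges D)}"
    using l by (simp add: labeling_def)
  have "bij_betw (l \<circ> (p \<circ> the_inv_into (edges D) l)) {1..card (edges D)} {1..card (edges D)}"
    by (intro bij_betw_trans[OF bij_betw_trans[OF bij_betw_the_inv_into[OF l'] p] l'])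
  then show "bij_betw (on_labels D l p) {1..card (edges D)} {1..card (edges D)}"
    by (rule bij_betw_cong[THEN iffD1, rotated]) (simp add: on_labels_def)
qed (auto simp: on_labels_def)

lemma rotation_at_end_bij:
  assumes D: "is_dessin D" and c: "c = black_end D \<or> c = white_end D"
  shows "bij_betw (\<lambda>e. rotation D (c e) e) (edges D) (edges D)"
proof -
  have fin: "finite (edges D)" using D by (simp add: is_dessin_def)
  have V: "c e \<in> vertices D" if "e \<in> edges D" for e
    using D c that by (auto simp: is_dessin_def vertices_def)
  have P: "rotation D (c e) permutes incident_edges D (c e)" if "e \<in> edges D" for e
    using D V[OF that] by (auto simp: is_dessin_def cyclic_ordering_def)
  have I: "e \<in> incident_edges D (c e)" if "e \<in> edges D" for e
    using c that by (auto simp: incident_edges_def)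
  have R: "rotation D (c e) e \<in> incident_edges D (c e)" if "e \<in> edges D" for e
    using permutes_in_image[OF P[OF that]] I[OF that] by blast
  have E: "rotation D (c e) e \<in> edges D" if "e \<in> edges D" for e
    using R[OF that] by (simp add: incident_edges_def)
  have C: "c (rotation D (c e) e) = c e" if e: "e \<in> edges D" for e
  proof -
    have "black_end D (rotation D (c e) e) = c e \<or> white_end D (rotation D (c e) e) = c e"
      using R[OF e] by (auto simp: incident_edges_def)
    moreover have "black_vertices D \<inter> white_vertices D = {}"
      "\<forall>e \<in> edges D. black_end D e \<in> black_vertices D \<and> white_end D e \<in> white_vertices D"
      using D by (auto simp: is_dessin_def)
    ultimately show ?thesis using c E[OF e] e by (metis disjoint_iff)
  qed
  have "inj_on (\<lambda>e. rotation D (c e) e) (edges D)"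
  proof (rule inj_onI)
    fix e f assume ef: "e \<in> edges D" "f \<in> edges D"
      and eq: "rotation D (c e) e = rotation D (c f) f"
    have "c e = c f" using C ef eq by metis
    then show "e = f" using eq permutes_inj[OF P[OF ef(1)]] by (metis injD)
  qed
  moreover have "(\<lambda>e. rotation D (c e) e) ` edges D \<subseteq> edges D"
    using E by blast
  ultimately show ?thesis
    using endo_inj_surj[OF fin] by (simp add: bij_betw_def)
qed

lemma sigma_in_sym_group:
  assumes "is_dessin D" "labeling D l"
  shows "sigma0 D l \<in> carrier (sym_group (card (edges D)))"
    and "sigma1 D l \<in> carrier (sym_group (card (edges D)))"
  using on_labels_permutes[OF assms(2) rotation_at_end_bij[OF assms(1)]]
  by (simp_all add: sym_group_def sigma0_def sigma1_def)


section \<open>Wreath products\<close>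

text \<open>A permutation \<open>\<sigma>\<close> acts on \<open>H\<^sup>d\<close> by \<open>(h\<^sub>1, \<dots>, h\<^sub>d) \<mapsto> (h\<^bsub>\<sigma>(1)\<^esub>, \<dots>, h\<^bsub>\<sigma>(d)\<^esub>)\<close>. This is a left action
  when permutations are multiplied from left to right, so the product of \<open>\<sigma>\<close> and \<open>\<tau>\<close> in the
  wreath product is \<open>\<tau> \<circ> \<sigma>\<close>. For the abelian \<open>K\<close> used below, the order is immaterial.\<close>

definition wreath :: "('a, 'm) monoid_scheme \<Rightarrow> nat \<Rightarrow> (nat \<Rightarrow> nat) set
    \<Rightarrow> ((nat \<Rightarrow> 'a) \<times> (nat \<Rightarrow> nat)) monoid" where
  "wreath H d K =
     \<lparr> carrier = ({1..d} \<rightarrow>\<^sub>E carrier H) \<times> K,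
       monoid.mult = (\<lambda>(h, \<sigma>) (k, \<tau>). (\<lambda>i\<in>{1..d}. h i \<otimes>\<^bsub>H\<^esub> k (\<sigma> i), \<tau> \<circ> \<sigma>)),
       one = (\<lambda>i\<in>{1..d}. \<one>\<^bsub>H\<^esub>, id) \<rparr>"

lemma group_wreath:
  assumes H: "group H" and K: "subgroup K (sym_group d)"
  shows "group (wreath H d K)"
proof -
  interpret H: group H by (rule H)
  have K1: "\<sigma> permutes {1..d}" if "\<sigma> \<in> K" for \<sigma>
    using subgroup.subset[OF K] that by (auto simp: sym_group_def)
  have Kc: "\<sigma> \<circ> \<tau> \<in> K" if "\<sigma> \<in> K" "\<tau> \<in> K" for \<sigma> \<tau>
    using subgroup.m_closed[OF K that] by (simp add: sym_group_def)
  have Kid: "id \<in> K"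
    using subgroup.one_closed[OF K] by (simp add: sym_group_def)
  have Kinv: "inv' \<sigma> \<in> K" if "\<sigma> \<in> K" and "inv' = inv_into UNIV" for \<sigma> inv'
    using subgroup.m_inv_closed[OF K that(1)] sym_group_inv_equality[of \<sigma> d] K1[OF that(1)] that(2)
    by (simp add: sym_group_def)
  have Kin: "\<sigma> i \<in> {1..d} \<longleftrightarrow> i \<in> {1..d}" if "\<sigma> \<in> K" for \<sigma> i
    using permutes_in_image[OF K1[OF that]] .
  show ?thesis
  proof (rule groupI)
    fix x y assume "x \<in> carrier (wreath H d K)" "y \<in> carrier (wreath H d K)"
    then show "x \<otimes>\<^bsub>wreath H d K\<^esub> y \<in> carrier (wreath H d K)"
      using Kin by (auto simp: wreath_def Kc PiE_iff simp del: atLeastAtMost_iff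
          split: prod.splits intro!: H.m_closed)
  next
    show "\<one>\<^bsub>wreath H d K\<^esub> \<in> carrier (wreath H d K)"
      by (auto simp: wreath_def Kid)
  next
    fix x y z assume "x \<in> carrier (wreath H d K)" "y \<in> carrier (wreath H d K)"
      "z \<in> carrier (wreath H d K)"
    then show "x \<otimes>\<^bsub>wreath H d K\<^esub> y \<otimes>\<^bsub>wreath H d K\<^esub> z
        = x \<otimes>\<^bsub>wreath H d K\<^esub> (y \<otimes>\<^bsub>wreath H d K\<^esub> z)"
      using Kin by (auto simp: wreath_def PiE_iff fun_eq_iff restrict_def H.m_assoc
          simp del: atLeastAtMost_iff)
  next
    fix x assume "x \<in> carrier (wreath H d K)"
    then show "\<one>\<^bsub>wreath H d K\<^esub> \<otimes>\<^bsub>wreath H d K\<^esub> x = x"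
      by (auto simp: wreath_def PiE_iff fun_eq_iff restrict_def extensional_def
          simp del: atLeastAtMost_iff)
  next
    fix x assume "x \<in> carrier (wreath H d K)"
    then obtain h \<sigma> where x: "x = (h, \<sigma>)" and h: "h \<in> {1..d} \<rightarrow>\<^sub>E carrier H" and s: "\<sigma> \<in> K"
      by (auto simp: wreath_def)
    define \<tau> where "\<tau> = inv_into UNIV \<sigma>"
    have t: "\<tau> \<in> K" using Kinv[OF s] by (simp add: \<tau>_def)
    have st: "\<sigma> \<circ> \<tau> = id" using permutes_inv_o(1)[OF K1[OF s]] by (simp add: \<tau>_def)
    define k where "k = (\<lambda>i\<in>{1..d}. inv\<^bsub>H\<^esub> (h (\<tau> i)))"
    have "(k, \<tau>) \<in> carrier (wreath H d K)"
      using h t Kin by (auto simp: wreath_def k_def PiE_iff simp del: atLeastAtMost_iff)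
    moreover have "(k, \<tau>) \<otimes>\<^bsub>wreath H d K\<^esub> x = \<one>\<^bsub>wreath H d K\<^esub>"
      using h t Kin by (auto simp: wreath_def x k_def st PiE_iff fun_eq_iff restrict_def
          simp del: atLeastAtMost_iff)
    ultimately show "\<exists>y \<in> carrier (wreath H d K). y \<otimes>\<^bsub>wreath H d K\<^esub> x = \<one>\<^bsub>wreath H d K\<^esub>"
      by blast
  qed
qed

text \<open>The cyclic group of order \<open>d\<close> inside the symmetric group, generated by \<open>(1 2 \<dots> d)\<close>.\<close>

definition cyclic_perms :: "nat \<Rightarrow> (nat \<Rightarrow> nat) set" where
  "cyclic_perms d = generate (sym_group d) {cycle_of_list [1..<Suc d]}"

lemma subgroup_cyclic_perms: "subgroup (cyclic_perms d) (sym_group d)"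
  unfolding cyclic_perms_def
proof (rule group.generate_is_subgroup[OF sym_group_is_group])
  have "set [1..<Suc d] = {1..d}" by auto
  then show "{cycle_of_list [1..<Suc d]} \<subseteq> carrier (sym_group d)"
    using cycle_permutes[of "[1..<Suc d]"] by (simp only: sym_group_def) simp
qed

definition R_tilde :: "nat \<Rightarrow> nat \<Rightarrow> ((nat \<Rightarrow> nat \<Rightarrow> nat) \<times> (nat \<Rightarrow> nat)) monoid" where
  "R_tilde m d =
     (wreath (sym_group m) d (cyclic_perms d))
       \<lparr> carrier := {(\<tau>, g) \<in> carrier (wreath (sym_group m) d (cyclic_perms d)).
           \<forall>i \<in> {1..d}. \<forall>j \<in> {1..d}. sign (\<tau> i) = sign (\<tau> j)} \<rparr>"

end

theory Submission
  imports Defs "HOL-Number_Theory.Cong"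
begin

text \<open>
  A tree with this passport has exactly one white vertex of degree \<open>r > 1\<close>, the hub, and its other
  white vertices are leaves. It has \<open>r\<close> black vertices and no two parallel edges, so every black
  vertex is joined to the hub by exactly one edge. Hence the edges can be numbered \<open>(j, i)\<close>, where
  \<open>j < r\<close> runs through the black vertices in their order around the hub, starting with the one of
  degree \<open>t\<close>, and \<open>i\<close> runs through the edges around the \<open>j\<close>-th black vertex, starting with the one
  that leads to the hub. In this numbering \<open>a = \<sigma>\<^sub>0\<close> sends \<open>(j, i)\<close> to \<open>(j, i + 1)\<close> and \<open>b = \<sigma>\<^sub>1\<close> is the
  \<open>r\<close>-cycle \<open>(j, 0) \<mapsto> (j + 1, 0)\<close> (lemma \<open>tree_star_coordinates\<close>). A dessin without isolated vertices
  is determined by the two permutations (\<open>conjugate_imp_isomorphic\<close>), so the tree is unique.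

  Let \<open>d = gcd s t\<close>. The residue of \<open>i\<close> modulo \<open>d\<close> gives \<open>d\<close> blocks, which \<open>a\<close> permutes cyclically, and
  \<open>b\<close> acts within the block of residue 0. Identifying the blocks along \<open>a\<close> embeds the group
  \<open>G = \<langle>a, b\<rangle>\<close> into a wreath product with \<open>\<int>\<^sub>d\<close>, and it remains to find the image. If \<open>s = t\<close>,
  then \<open>a\<^sup>d = 1\<close> and \<open>b\<close> is an \<open>r\<close>-cycle on a block of size \<open>r\<close>, which gives the
  wreath product of \<open>\<int>\<^sub>r\<close> with \<open>\<int>\<^sub>s\<close>.

  If \<open>s \<noteq> t\<close>, then \<open>G\<close> contains a three-cycle: a suitable power of \<open>a\<close> fixes some arms of the star
  pointwise and moves the hub edges of the others, so \<open>b\<close> and its conjugate by this power differ by a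
  three-cycle or have a three-cycle as commutator (\<open>linked_hub_not_dvd\<close>, \<open>linked_hub_dvd\<close>).
  Call two points linked if they are equal or lie on a common three-cycle in \<open>G\<close>. This is a
  \<open>G\<close>-invariant equivalence relation, \<open>G\<close> contains every three-cycle on three linked points, and
  by \<open>block_linked\<close> the blocks are linked. So \<open>G\<close> contains the product of the alternating groups of
  the blocks, and only signs remain to be compared. The sign of \<open>b\<close> is \<open>(-1)\<^bsup>r-1\<^esup>\<close>; for even \<open>r\<close> this
  yields the full symmetric groups. For odd \<open>r\<close> the permutation \<open>a\<^sup>d\<close> has on each block the sign
  \<open>(-1)\<^bsup>t/d-1\<^esup>\<close>. If \<open>t/d\<close> is odd, all elements of \<open>G\<close> have even coordinates. If \<open>t/d\<close> is even, then
  the block size \<open>n/d\<close> is even and \<open>d\<close> is odd by coprimality; identifying consecutive blocks along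
  \<open>a\<close> composed with a transposition makes all coordinates of \<open>a\<close> odd, and \<open>G\<close> becomes the group of
  all elements whose coordinates have equal signs.
\<close>

section \<open>Cycles and signs\<close>

lemma cycle_of_list_nth:
  assumes "distinct cs" "i < length cs"
  shows "cycle_of_list cs (cs ! i) = cs ! (Suc i mod length cs)"
proof -
  have "map (cycle_of_list cs) cs ! i = rotate1 cs ! i"
    using cyclic_rotation[OF assms(1), of 1] by simp
  then show ?thesis using assms(2) by (simp add: nth_rotate1)
qed

lemma three_cycle_apply:
  assumes "distinct [x, y, z]"
  shows "cycle_of_list [x, y, z] v = (if v = x then y else if v = y then z else if v = z then x else v)"
  using assms by (auto simp: transpose_def)

lemma three_cycle_rotate:
  assumes "distinct [x, y, z]" shows "cycle_of_list [x, y, z] = cycle_of_list [y, z, x]"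
  using assms by (auto simp: fun_eq_iff transpose_def)

lemma three_cycle_square:
  assumes "distinct [x, y, z]"
  shows "cycle_of_list [x, y, z] \<circ> cycle_of_list [x, y, z] = cycle_of_list [y, x, z]"
  using assms by (auto simp: fun_eq_iff transpose_def)

lemma sign_cycle_of_list:
  assumes "distinct cs"
  shows "sign (cycle_of_list cs) = (- 1) ^ (length cs - 1)"
proof -
  have "swapidseq (length cs - 1) (cycle_of_list cs)"
    using swapidseq_ext_imp_swapidseq[OF swapidseq_ext_of_cycles[OF assms]] .
  then have "evenperm (cycle_of_list cs) \<longleftrightarrow> even (length cs - 1)"
    by (intro evenperm_unique[where n = "length cs - 1"]) auto
  then show ?thesis by (simp add: sign_def)
qed

lemma sign_comp_perms:
  assumes "finite A" "x permutes A" "y permutes A" shows "sign (x \<circ> y) = sign x * sign y"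
  using assms by (intro sign_compose) (auto simp: permutation_permutes)

text \<open>The sign of a permutation whose cycles are \<open>(q j 0 \<dots> q j (L j - 1))\<close> for \<open>j < r\<close>, together with
  fixed points.\<close>

lemma sign_cycles:
  fixes q :: "nat \<Rightarrow> nat \<Rightarrow> 'a"
  assumes "inj_on (\<lambda>(j, i). q j i) (SIGMA j:{..<r}. {..<L j})"
    and "\<And>j. j < r \<Longrightarrow> 0 < L j"
    and "\<And>j i. j < r \<Longrightarrow> i < L j \<Longrightarrow> \<pi> (q j i) = q j (Suc i mod L j)"
    and "\<And>x. (\<And>j i. j < r \<Longrightarrow> i < L j \<Longrightarrow> x \<noteq> q j i) \<Longrightarrow> \<pi> x = x"
  shows "permutation \<pi> \<and> sign \<pi> = (\<Prod>j<r. (- 1) ^ (L j - 1))"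
  using assms
proof (induction r arbitrary: \<pi>)
  case 0
  then have "\<pi> = id" by auto
  then show ?case by simp
next
  case (Suc r)
  let ?cs = "map (q r) [0..<L r]"
  define \<pi>' where "\<pi>' = (\<lambda>x. if x \<in> set ?cs then x else \<pi> x)"
  have inj: "q j i = q j' i' \<longleftrightarrow> j = j' \<and> i = i'"
    if "j < Suc r" "i < L j" "j' < Suc r" "i' < L j'" for j i j' i'
    using inj_onD[OF Suc.prems(1), of "(j, i)" "(j', i')"] that by auto
  have dist: "distinct ?cs"
    by (auto simp: distinct_map inj_on_def inj)
  have set: "x \<in> set ?cs \<longleftrightarrow> (\<exists>i < L r. x = q r i)" for x by auto
  have IH: "permutation \<pi>' \<and> sign \<pi>' = (\<Prod>j<r. (- 1) ^ (L j - 1))"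
  proof (rule Suc.IH)
    show "inj_on (\<lambda>(j, i). q j i) (SIGMA j:{..<r}. {..<L j})"
      by (rule inj_on_subset[OF Suc.prems(1)]) auto
    show "0 < L j" if "j < r" for j using Suc.prems(2) that by simp
    show "\<pi>' (q j i) = q j (Suc i mod L j)" if "j < r" "i < L j" for j i
    proof -
      have "q j i \<notin> set ?cs" using that by (auto simp: inj)
      then show ?thesis using that Suc.prems(3)[of j i] unfolding \<pi>'_def by simp
    qed
    show "\<pi>' x = x" if x: "\<And>j i. j < r \<Longrightarrow> i < L j \<Longrightarrow> x \<noteq> q j i" for x
    proof (cases "x \<in> set ?cs")
      case False
      then have "\<pi> x = x"
        using x by (intro Suc.prems(4)) (metis less_antisym set)
      then show ?thesis by (simp add: \<pi>'_def)
    qed (simp add: \<pi>'_def)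
  qed
  have "\<pi> = cycle_of_list ?cs \<circ> \<pi>'"
  proof
    fix x
    show "\<pi> x = (cycle_of_list ?cs \<circ> \<pi>') x"
    proof (cases "x \<in> set ?cs")
      case True
      then obtain i where i: "i < L r" "x = q r i" using set by blast
      have "cycle_of_list ?cs (?cs ! i) = ?cs ! (Suc i mod length ?cs)"
        by (rule cycle_of_list_nth) (use dist i in auto)
      then show ?thesis using i True Suc.prems(3)[of r i] by (simp add: \<pi>'_def)
    next
      case False
      have "\<pi> x \<notin> set ?cs"
      proof (cases "\<exists>j<r. \<exists>i<L j. x = q j i")
        case True
        then obtain j i where ji: "j < r" "i < L j" "x = q j i" by blast
        then have "\<pi> x = q j (Suc i mod L j)" using Suc.prems(3) by simp
        moreover have "Suc i mod L j < L j" using ji by simp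
        ultimately show ?thesis using ji set inj[of j "Suc i mod L j" r] by auto
      next
        case nex: False
        have "\<pi> x = x"
          by (rule Suc.prems(4)) (metis False less_antisym nex set)
        then show ?thesis using False by simp
      qed
      then show ?thesis using False by (simp add: \<pi>'_def id_outside_supp del: set_map set_upt)
    qed
  qed
  then show ?case
    using IH sign_compose[OF permutation_of_cycle[of ?cs], of \<pi>']
      permutation_compose[OF permutation_of_cycle[of ?cs], of \<pi>'] sign_cycle_of_list[OF dist]
    by (simp add: o_def mult.commute)
qed

section \<open>Three-cycles in a permutation group\<close>

text \<open>A group \<open>G\<close> of permutations of \<open>{1..n}\<close>, given by its set of elements.\<close>

locale perm_group =
  fixes n :: nat and G :: "(nat \<Rightarrow> nat) set"
  assumes G: "subgroup G (sym_group n)"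
begin

lemma permutes: "g \<in> G \<Longrightarrow> g permutes {1..n}"
  using subgroup.subset[OF G] by (auto simp: sym_group_carrier)

lemma bij: "g \<in> G \<Longrightarrow> bij g"
  using permutes permutes_bij by blast

lemma id_mem: "id \<in> G"
  using subgroup.one_closed[OF G] by (simp add: sym_group_one)

lemma comp_mem: "g \<in> G \<Longrightarrow> h \<in> G \<Longrightarrow> g \<circ> h \<in> G"
  using subgroup.m_closed[OF G] by (simp add: sym_group_mult)

lemma inv_mem: "g \<in> G \<Longrightarrow> inv' g \<in> G"
  using subgroup.m_inv_closed[OF G, of g] subgroup.mem_carrier[OF G, of g] by simp

lemma funpow_mem: "g \<in> G \<Longrightarrow> g ^^ k \<in> G"
  by (induction k) (auto simp: comp_mem id_mem[unfolded id_def] id_mem)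

lemma comp_mem_cancel:
  assumes "g \<in> G" "x \<circ> g = h" "h \<in> G"
  shows "x \<in> G"
proof -
  have "x = h \<circ> inv' g"
    using assms(2) surj_iff[THEN iffD1, OF bij_is_surj[OF bij[OF assms(1)]]]
    by (metis comp_assoc comp_id)
  then show ?thesis using comp_mem[OF assms(3) inv_mem[OF assms(1)]] by simp
qed

lemma conj_cycle_mem:
  assumes "g \<in> G" "cycle_of_list cs \<in> G" "distinct cs"
  shows "cycle_of_list (map g cs) \<in> G"
  using conjugation_of_cycle[OF assms(3) bij[OF assms(1)]]
    comp_mem[OF comp_mem[OF assms(1,2)] inv_mem[OF assms(1)]] by simp

text \<open>Two points are linked if they are equal or \<open>G\<close> contains a three-cycle that moves the first to
  the second. This is a \<open>G\<close>-invariant equivalence relation.\<close>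

definition linked :: "nat \<Rightarrow> nat \<Rightarrow> bool" where
  "linked x y \<longleftrightarrow> x = y \<or> (\<exists>z. distinct [x, y, z] \<and> cycle_of_list [x, y, z] \<in> G)"

lemma linkedI: "distinct [x, y, z] \<Longrightarrow> cycle_of_list [x, y, z] \<in> G \<Longrightarrow> linked x y"
  by (auto simp: linked_def)

lemma linked_refl: "linked x x"
  by (simp add: linked_def)

lemma rotate_mem:
  "distinct [x, y, z] \<Longrightarrow> cycle_of_list [x, y, z] \<in> G \<Longrightarrow> cycle_of_list [y, z, x] \<in> G"
  using three_cycle_rotate by metis

lemma swap_mem:
  "distinct [x, y, z] \<Longrightarrow> cycle_of_list [x, y, z] \<in> G \<Longrightarrow> cycle_of_list [y, x, z] \<in> G"
  using three_cycle_square[of x y z] comp_mem by metis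

lemma linked_sym: "linked x y \<Longrightarrow> linked y x"
  unfolding linked_def using swap_mem by (metis distinct_length_2_or_more)

lemma linked_image:
  assumes "g \<in> G" "linked x y" shows "linked (g x) (g y)"
proof (cases "x = y")
  case False
  then obtain z where z: "distinct [x, y, z]" "cycle_of_list [x, y, z] \<in> G"
    using assms(2) by (auto simp: linked_def)
  have "distinct (map g [x, y, z])"
    using z(1) bij_is_inj[OF bij[OF assms(1)]] by (simp only: distinct_map) (auto simp: inj_def inj_on_def)
  then show ?thesis using linkedI[of "g x" "g y" "g z"] conj_cycle_mem[OF assms(1) z(2) z(1)] by simp
qed (simp add: linked_refl)

lemma linked_trans:
  assumes "linked x y" "linked y w" shows "linked x w"
proof (cases "x = y \<or> y = w \<or> x = w")
  case False
  \<comment> \<open>unless it moves \<open>x\<close>, the three-cycle \<open>(y w u)\<close> carries the linked pair \<open>x, y\<close> to \<open>x, w\<close>\<close>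
  then obtain z u where z: "distinct [x, y, z]" "cycle_of_list [x, y, z] \<in> G"
    and u: "distinct [y, w, u]" "cycle_of_list [y, w, u] \<in> G"
    using assms by (auto simp: linked_def)
  show ?thesis
  proof (cases "u = x")
    case True
    then have "distinct [w, x, y]" "cycle_of_list [w, x, y] \<in> G" using u rotate_mem by auto
    then show ?thesis using linkedI linked_sym by blast
  next
    case False
    then have "cycle_of_list [y, w, u] x = x" "cycle_of_list [y, w, u] y = w"
      using three_cycle_apply[OF u(1)] z \<open>\<not> (x = y \<or> y = w \<or> x = w)\<close> by auto
    then show ?thesis using linked_image[OF u(2) assms(1)] by simp
  qed
qed (use assms linked_refl in auto)

text \<open>Three-cycles through single pairs of points of a class give all three-cycles on the class, and
  therefore its alternating group.\<close>

lemma linked_three_cycle: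
  assumes d: "distinct [x, y, z]" and xy: "linked x y" and xz: "linked x z"
  shows "cycle_of_list [x, y, z] \<in> G"
proof -
  obtain u where u: "distinct [x, y, u]" "cycle_of_list [x, y, u] \<in> G"
    using xy d by (auto simp: linked_def)
  show ?thesis
  proof (cases "u = z")
    case False
    have "linked u z"
      using linkedI[of u x y] u rotate_mem linked_trans[OF _ xz] 
      by (metis distinct_length_2_or_more)
    then obtain v where v: "distinct [u, z, v]" "cycle_of_list [u, z, v] \<in> G"
      using False by (auto simp: linked_def)
    consider "v = x" | "v = y" | "v \<noteq> x" "v \<noteq> y" by blast
    then show ?thesis
    proof cases
      case 1
      \<comment> \<open>conjugating \<open>(u z x)\<close> by \<open>(x y u)\<close> gives \<open>(x z y)\<close>, the inverse of \<open>(x y z)\<close>\<close>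
      have "cycle_of_list (map (cycle_of_list [x, y, u]) [u, z, x]) \<in> G"
        using conj_cycle_mem[OF u(2) v(2) v(1)] 1 by simp
      then have "cycle_of_list [x, z, y] \<in> G"
        using three_cycle_apply[OF u(1)] d u(1) False by simp
      then show ?thesis
        using swap_mem[of x z y] rotate_mem[of z x y] d by auto
    next
      case 2
      \<comment> \<open>conjugating \<open>(u z y)\<close> by the inverse \<open>(y x u)\<close> of \<open>(x y u)\<close> gives \<open>(y z x) = (x y z)\<close>\<close>
      have i: "cycle_of_list [y, x, u] \<in> G" "distinct [y, x, u]" using u swap_mem by auto
      have "cycle_of_list (map (cycle_of_list [y, x, u]) [u, z, y]) \<in> G"
        using conj_cycle_mem[OF i(1) v(2) v(1)] 2 by simp
      then have "cycle_of_list [y, z, x] \<in> G"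
        using three_cycle_apply[OF i(2)] d u(1) False by simp
      then show ?thesis
        using rotate_mem[of y z x] rotate_mem[of z x y] d by auto
    next
      case 3
      \<comment> \<open>\<open>(u z v)\<close> fixes \<open>x\<close> and \<open>y\<close>, so it conjugates \<open>(x y u)\<close> to \<open>(x y z)\<close>\<close>
      have "cycle_of_list (map (cycle_of_list [u, z, v]) [x, y, u]) \<in> G"
        using conj_cycle_mem[OF v(2) u(2) u(1)] by simp
      then show ?thesis
        using three_cycle_apply[OF v(1)] d u(1) 3 by simp
    qed
  qed (use u in simp)
qed

end

section \<open>The imprimitive action of a wreath product\<close>

text \<open>If \<open>H\<close> acts on \<open>Y\<close> by \<open>act\<close> and \<open>f\<close> identifies \<open>{1..d} \<times> Y\<close> with a set of numbers, then
  \<open>(h, \<sigma>)\<close> acts by \<open>f (\<sigma> i, u) \<mapsto> f (i, h\<^sub>i u)\<close>. It moves the block \<open>\<sigma> i\<close> to the block \<open>i\<close>: with this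
  direction, the multiplication of \<^const>\<open>wreath\<close> corresponds to the composition of functions.\<close>

definition wreath_perm ::
  "(nat \<times> 'y \<Rightarrow> nat) \<Rightarrow> 'y set \<Rightarrow> nat \<Rightarrow> ('a \<Rightarrow> 'y \<Rightarrow> 'y) \<Rightarrow> (nat \<Rightarrow> 'a) \<times> (nat \<Rightarrow> nat) \<Rightarrow> nat \<Rightarrow> nat" where
  "wreath_perm f Y d act w v =
     (if v \<in> f ` ({1..d} \<times> Y)
      then let (j, u) = the_inv_into ({1..d} \<times> Y) f v; i = inv' (snd w) j in f (i, act (fst w i) u)
      else v)"

text \<open>A faithful action of \<open>H\<close> on a nonempty set \<open>Y\<close>. Nothing is assumed about \<open>act x\<close> outside \<open>Y\<close>.\<close>

locale faithful_action = group H for H :: "('a, 'm) monoid_scheme" (structure) +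
  fixes act :: "'a \<Rightarrow> 'y \<Rightarrow> 'y" and Y :: "'y set"
  assumes act_closed: "x \<in> carrier H \<Longrightarrow> u \<in> Y \<Longrightarrow> act x u \<in> Y"
    and act_mult: "x \<in> carrier H \<Longrightarrow> y \<in> carrier H \<Longrightarrow> u \<in> Y \<Longrightarrow> act (x \<otimes> y) u = act x (act y u)"
    and act_one: "u \<in> Y \<Longrightarrow> act \<one> u = u"
    and faithful: "x \<in> carrier H \<Longrightarrow> y \<in> carrier H \<Longrightarrow> (\<And>u. u \<in> Y \<Longrightarrow> act x u = act y u) \<Longrightarrow> x = y"
    and Y_ne: "Y \<noteq> {}"

text \<open>The induced action of the wreath product on the \<open>d\<close> blocks \<open>f (i, _)\<close>, which partition
  \<open>{1..n}\<close>.\<close>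

locale wreath_action = faithful_action H act Y
  for H :: "('a, 'm) monoid_scheme" (structure) and act :: "'a \<Rightarrow> 'y \<Rightarrow> 'y" and Y :: "'y set" +
  fixes f :: "nat \<times> 'y \<Rightarrow> nat" and d n :: nat and K :: "(nat \<Rightarrow> nat) set"
  assumes f_bij: "bij_betw f ({1..d} \<times> Y) {1..n}"
    and K: "subgroup K (sym_group d)"
begin

abbreviation W :: "((nat \<Rightarrow> 'a) \<times> (nat \<Rightarrow> nat)) monoid" where
  "W \<equiv> wreath H d K"

abbreviation \<Phi> :: "(nat \<Rightarrow> 'a) \<times> (nat \<Rightarrow> nat) \<Rightarrow> nat \<Rightarrow> nat" where
  "\<Phi> \<equiv> wreath_perm f Y d act"

lemma group_W: "group W"
  using group_wreath[OF is_group K] .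

lemma carrier_W: "(h, \<sigma>) \<in> carrier W \<longleftrightarrow> h \<in> {1..d} \<rightarrow>\<^sub>E carrier H \<and> \<sigma> \<in> K"
  by (simp add: wreath_def)

lemma mult_W: "(h, \<sigma>) \<otimes>\<^bsub>W\<^esub> (k, \<tau>) = (\<lambda>i\<in>{1..d}. h i \<otimes> k (\<sigma> i), \<tau> \<circ> \<sigma>)"
  by (simp add: wreath_def)

lemma one_W: "\<one>\<^bsub>W\<^esub> = (\<lambda>i\<in>{1..d}. \<one>, id)"
  by (simp add: wreath_def)

lemma id_K: "id \<in> K"
  using subgroup.one_closed[OF K] by (simp add: sym_group_one)

lemma K_permutes: "\<sigma> \<in> K \<Longrightarrow> \<sigma> permutes {1..d}"
  using subgroup.subset[OF K] by (auto simp: sym_group_carrier)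

lemma K_in: "\<sigma> \<in> K \<Longrightarrow> \<sigma> i \<in> {1..d} \<longleftrightarrow> i \<in> {1..d}"
  using permutes_in_image[OF K_permutes] .

lemma f_inj: "i \<in> {1..d} \<Longrightarrow> u \<in> Y \<Longrightarrow> j \<in> {1..d} \<Longrightarrow> v \<in> Y \<Longrightarrow> f (i, u) = f (j, v) \<longleftrightarrow> i = j \<and> u = v"
  using inj_on_eq_iff[OF bij_betw_imp_inj_on[OF f_bij], of "(i, u)" "(j, v)"] by simp

lemma f_in: "i \<in> {1..d} \<Longrightarrow> u \<in> Y \<Longrightarrow> f (i, u) \<in> {1..n}"
  using bij_betwE[OF f_bij] by auto

lemma f_cases:
  assumes "v \<in> {1..n}" obtains i u where "i \<in> {1..d}" "u \<in> Y" "v = f (i, u)"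
proof -
  obtain x where "x \<in> {1..d} \<times> Y" "v = f x"
    using assms bij_betw_imp_surj_on[OF f_bij] by blast
  then show thesis using that by (cases x) blast
qed

lemma \<Phi>_apply:
  assumes "\<sigma> \<in> K" "i \<in> {1..d}" "u \<in> Y"
  shows "\<Phi> (h, \<sigma>) (f (\<sigma> i, u)) = f (i, act (h i) u)"
proof -
  have m: "(\<sigma> i, u) \<in> {1..d} \<times> Y" using K_in[OF assms(1)] assms by blast
  have "the_inv_into ({1..d} \<times> Y) f (f (\<sigma> i, u)) = (\<sigma> i, u)"
    using the_inv_into_f_f[OF bij_betw_imp_inj_on[OF f_bij] m] .
  moreover have "inv' \<sigma> (\<sigma> i) = i"
    using permutes_inverses(2)[OF K_permutes[OF assms(1)]] .
  ultimately show ?thesis using m by (auto simp: wreath_perm_def)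
qed

lemma \<Phi>_apply_id:
  assumes "i \<in> {1..d}" "u \<in> Y" shows "\<Phi> (h, id) (f (i, u)) = f (i, act (h i) u)"
  using \<Phi>_apply[OF id_K assms] by simp

lemma \<Phi>_off: "v \<notin> {1..n} \<Longrightarrow> \<Phi> w v = v"
  unfolding wreath_perm_def bij_betw_imp_surj_on[OF f_bij] by (rule if_not_P)

text \<open>A permutation is recognized as \<open>\<Phi> (h, \<sigma>)\<close> by its values on the points \<open>f (\<sigma> i, u)\<close>.\<close>

lemma \<Phi>_eqI:
  assumes "\<sigma> \<in> K"
    and "\<And>i u. i \<in> {1..d} \<Longrightarrow> u \<in> Y \<Longrightarrow> p (f (\<sigma> i, u)) = f (i, act (h i) u)"
    and "\<And>v. v \<notin> {1..n} \<Longrightarrow> p v = v"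
  shows "\<Phi> (h, \<sigma>) = p"
proof
  fix v
  show "\<Phi> (h, \<sigma>) v = p v"
  proof (cases "v \<in> {1..n}")
    case True
    then obtain j u where j: "j \<in> {1..d}" "u \<in> Y" "v = f (j, u)" by (rule f_cases)
    obtain i where "i \<in> {1..d}" "j = \<sigma> i"
      using K_in[OF assms(1)] permutes_surj[OF K_permutes[OF assms(1)]] j(1) by (metis surjD)
    then show ?thesis using j assms \<Phi>_apply by simp
  qed (simp add: \<Phi>_off assms(3))
qed

lemma \<Phi>_mult:
  assumes "w \<in> carrier W" "z \<in> carrier W"
  shows "\<Phi> (w \<otimes>\<^bsub>W\<^esub> z) = \<Phi> w \<circ> \<Phi> z"
proof -
  obtain h \<sigma> k \<tau> where w: "w = (h, \<sigma>)" and z: "z = (k, \<tau>)" by fastforce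
  have c: "h \<in> {1..d} \<rightarrow>\<^sub>E carrier H" "\<sigma> \<in> K" "k \<in> {1..d} \<rightarrow>\<^sub>E carrier H" "\<tau> \<in> K"
    using assms by (auto simp: w z carrier_W simp del: atLeastAtMost_iff)
  have "\<tau> \<circ> \<sigma> \<in> K" using subgroup.m_closed[OF K c(4,2)] by (simp add: sym_group_mult)
  then show ?thesis unfolding w z mult_W
  proof (rule \<Phi>_eqI)
    fix i u assume i: "i \<in> {1..d}" "u \<in> Y"
    then have si: "\<sigma> i \<in> {1..d}" using K_in c(2) by blast
    have hk: "h i \<in> carrier H" "k (\<sigma> i) \<in> carrier H" using c i si by auto
    show "(\<Phi> (h, \<sigma>) \<circ> \<Phi> (k, \<tau>)) (f ((\<tau> \<circ> \<sigma>) i, u)) = f (i, act ((\<lambda>i\<in>{1..d}. h i \<otimes> k (\<sigma> i)) i) u)"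
      using i si hk c by (simp add: \<Phi>_apply act_mult act_closed del: atLeastAtMost_iff)
  qed (simp add: \<Phi>_off)
qed

lemma \<Phi>_one: "\<Phi> \<one>\<^bsub>W\<^esub> = id"
  unfolding one_W by (rule \<Phi>_eqI) (auto simp: id_K act_one)

lemma \<Phi>_carrier:
  assumes w: "w \<in> carrier W" shows "\<Phi> w \<in> carrier (sym_group n)"
proof -
  interpret W: group W by (rule group_W)
  have "\<Phi> w \<circ> \<Phi> (inv\<^bsub>W\<^esub> w) = id" "\<Phi> (inv\<^bsub>W\<^esub> w) \<circ> \<Phi> w = id"
    using w by (simp_all add: \<Phi>_mult[symmetric] \<Phi>_one)
  then have "bij (\<Phi> w)" by (metis o_bij)
  then show ?thesis
    unfolding sym_group_carrier permutes_def using \<Phi>_off by (metis bij_pointE)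
qed

lemma \<Phi>_hom: "\<Phi> \<in> hom W (sym_group n)"
  by (auto simp: hom_def \<Phi>_carrier \<Phi>_mult sym_group_mult)

lemma \<Phi>_group_hom: "group_hom W (sym_group n) \<Phi>"
  by (simp add: group_hom_def group_hom_axioms_def group_W sym_group_is_group \<Phi>_hom)

lemma \<Phi>_inv: "w \<in> carrier W \<Longrightarrow> \<Phi> (inv\<^bsub>W\<^esub> w) = inv' (\<Phi> w)"
  using group_hom.hom_inv[OF \<Phi>_group_hom] \<Phi>_carrier by simp

lemma \<Phi>_inj: "inj_on \<Phi> (carrier W)"
proof (rule inj_onI)
  fix w z assume wz: "w \<in> carrier W" "z \<in> carrier W" and eq: "\<Phi> w = \<Phi> z"
  obtain h \<sigma> k \<tau> where w: "w = (h, \<sigma>)" and z: "z = (k, \<tau>)" by fastforce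
  have c: "h \<in> {1..d} \<rightarrow>\<^sub>E carrier H" "\<sigma> \<in> K" "k \<in> {1..d} \<rightarrow>\<^sub>E carrier H" "\<tau> \<in> K"
    using wz by (auto simp: w z carrier_W simp del: atLeastAtMost_iff)
  have key: "\<tau> i = \<sigma> i \<and> (\<forall>u \<in> Y. act (h i) u = act (k i) u)" if i: "i \<in> {1..d}" for i
  proof -
    obtain j where j: "j \<in> {1..d}" "\<sigma> i = \<tau> j"
      using K_in[OF c(2)] K_in[OF c(4)] permutes_surj[OF K_permutes[OF c(4)]] i by (metis surjD)
    have e: "f (i, act (h i) u) = f (j, act (k j) u)" if "u \<in> Y" for u
      using eq \<Phi>_apply[OF c(2) i that, of h] \<Phi>_apply[OF c(4) j(1) that, of k] j(2) w z by simp
    have "i = j \<and> act (h i) u = act (k j) u" if "u \<in> Y" for u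
      using e[OF that] f_inj[OF i _ j(1)] that act_closed c i j(1) by (metis PiE_mem)
    moreover have "i = j" using calculation Y_ne by auto
    ultimately show ?thesis using j(2) by simp
  qed
  have "h = k"
  proof (rule PiE_ext[OF c(1,3)])
    fix i assume "i \<in> {1..d}"
    then show "h i = k i" using key faithful c by (meson PiE_mem)
  qed
  moreover have "\<sigma> = \<tau>"
    using key K_permutes[OF c(2)] K_permutes[OF c(4)] by (metis permutes_not_in ext)
  ultimately show "w = z" by (simp add: w z)
qed

lemma iso_of_image:
  assumes "subgroup W' W" "\<Phi> ` W' = G"
  shows "(sym_group n)\<lparr>carrier := G\<rparr> \<cong> W\<lparr>carrier := W'\<rparr>"
proof -
  have "bij_betw \<Phi> W' G"
    using assms \<Phi>_inj subgroup.subset[OF assms(1)] by (auto simp: bij_betw_def intro: inj_on_subset)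
  then have "\<Phi> \<in> iso (W\<lparr>carrier := W'\<rparr>) ((sym_group n)\<lparr>carrier := G\<rparr>)"
    using assms subgroup.mem_carrier[OF assms(1)]
    by (auto simp: iso_def hom_def \<Phi>_mult sym_group_mult)
  moreover have "group (W\<lparr>carrier := W'\<rparr>)"
    using subgroup.subgroup_is_group[OF assms(1) group_W] .
  ultimately show ?thesis
    using group.iso_sym unfolding is_iso_def by blast
qed

text \<open>The element of the base group with \<open>k\<close>-th coordinate \<open>x\<close> and all other coordinates trivial.\<close>

definition coord :: "nat \<Rightarrow> 'a \<Rightarrow> (nat \<Rightarrow> 'a) \<times> (nat \<Rightarrow> nat)" where
  "coord k x = (\<lambda>i\<in>{1..d}. if i = k then x else \<one>, id)"

lemma coord_carrier: "x \<in> carrier H \<Longrightarrow> coord k x \<in> carrier W"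
  by (auto simp: coord_def carrier_W id_K)

lemma coord_mult: "x \<in> carrier H \<Longrightarrow> y \<in> carrier H \<Longrightarrow> coord k (x \<otimes> y) = coord k x \<otimes>\<^bsub>W\<^esub> coord k y"
  by (auto simp: coord_def mult_W fun_eq_iff)

lemma \<Phi>_coord:
  assumes "i \<in> {1..d}" "u \<in> Y"
  shows "\<Phi> (coord k x) (f (i, u)) = (if i = k then f (i, act x u) else f (i, u))"
  using assms by (simp add: coord_def \<Phi>_apply_id act_one del: atLeastAtMost_iff)

context
  fixes G assumes G: "subgroup G (sym_group n)"
begin

interpretation perm_group n G by (rule perm_group.intro) (rule G)

lemma coord_subgroup: "subgroup {x \<in> carrier H. \<Phi> (coord k x) \<in> G} H"
proof (rule subgroupI)
  have "coord k \<one> = \<one>\<^bsub>W\<^esub>" by (auto simp: coord_def one_W)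
  then have "\<one> \<in> {x \<in> carrier H. \<Phi> (coord k x) \<in> G}" using id_mem \<Phi>_one by simp
  then show "{x \<in> carrier H. \<Phi> (coord k x) \<in> G} \<noteq> {}" by blast
  fix x assume x: "x \<in> {x \<in> carrier H. \<Phi> (coord k x) \<in> G}"
  {
    interpret W: group W by (rule group_W)
    have "coord k x \<otimes>\<^bsub>W\<^esub> coord k (inv x) = \<one>\<^bsub>W\<^esub>"
      using x \<open>coord k \<one> = \<one>\<^bsub>W\<^esub>\<close> by (simp add: coord_mult[symmetric])
    then have "inv\<^bsub>W\<^esub> (coord k x) = coord k (inv x)"
      using x coord_carrier by (metis (mono_tags, lifting) W.inv_equality W.inv_comm inv_closed mem_Collect_eq)
  }
  then have "\<Phi> (coord k (inv x)) = inv' (\<Phi> (coord k x))"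
    using x \<Phi>_inv[OF coord_carrier] by (metis (mono_tags, lifting) mem_Collect_eq)
  then show "inv x \<in> {x \<in> carrier H. \<Phi> (coord k x) \<in> G}" using x inv_mem by auto
  fix y assume y: "y \<in> {x \<in> carrier H. \<Phi> (coord k x) \<in> G}"
  then show "x \<otimes> y \<in> {x \<in> carrier H. \<Phi> (coord k x) \<in> G}"
    using x coord_mult \<Phi>_mult coord_carrier comp_mem by auto
qed auto

lemma base_mem:
  assumes h: "h \<in> {1..d} \<rightarrow>\<^sub>E carrier H" and c: "\<And>k. k \<in> {1..d} \<Longrightarrow> \<Phi> (coord k (h k)) \<in> G"
  shows "\<Phi> (h, id) \<in> G"
proof -
  define e where "e m = (\<lambda>i\<in>{1..d}. if i \<le> m then h i else \<one>)" for m
  have hc: "Suc 0 \<le> i \<Longrightarrow> i \<le> d \<Longrightarrow> h i \<in> carrier H" for i using h by auto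
  have "m \<le> d \<Longrightarrow> \<Phi> (e m, id) \<in> G" for m
  proof (induction m)
    case 0
    have "(e 0, id) = \<one>\<^bsub>W\<^esub>" by (auto simp: e_def one_W fun_eq_iff)
    then show ?case using \<Phi>_one id_mem by metis
  next
    case (Suc m)
    have "e (Suc m) i = (\<lambda>i\<in>{1..d}. e m i \<otimes> (if i = Suc m then h (Suc m) else \<one>)) i" for i
      using Suc.prems hc[of i] hc[of "Suc m"] by (auto simp: e_def restrict_def le_Suc_eq)
    then have "(e (Suc m), id) = (e m, id) \<otimes>\<^bsub>W\<^esub> coord (Suc m) (h (Suc m))"
      by (auto simp: mult_W coord_def fun_eq_iff)
    moreover have "(e m, id) \<in> carrier W" using hc by (auto simp: e_def carrier_W id_K)
    moreover have "h (Suc m) \<in> carrier H" "\<Phi> (coord (Suc m) (h (Suc m))) \<in> G"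
      using Suc.prems hc c by auto
    moreover have "\<Phi> (e m, id) \<in> G" using Suc.IH[OF Suc_leD[OF Suc.prems]] .
    ultimately show ?case
      using \<Phi>_mult coord_carrier comp_mem by metis
  qed
  moreover have "e d = h" using h by (auto simp: e_def fun_eq_iff PiE_def extensional_def)
  ultimately show ?thesis by (metis order_refl)
qed

end

text \<open>A group generated by two elements \<open>a\<close> and \<open>b\<close> is the image of a subgroup \<open>W'\<close> of the wreath
  product if the generators come from \<open>W'\<close>, the block permutation of \<open>a\<close> generates \<open>K\<close>, and the
  elements of \<open>W'\<close> that fix all blocks have their images in the group.\<close>

lemma image_eq_generate:
  assumes W': "subgroup W' W"
    and gen: "G = generate (sym_group n) {a, b}"
    and wa: "wa \<in> W'" "\<Phi> wa = a" and wb: "wb \<in> W'" "\<Phi> wb = b"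
    and Kgen: "K = generate (sym_group d) {snd wa}"
    and base: "\<And>h. (h, id) \<in> W' \<Longrightarrow> \<Phi> (h, id) \<in> G"
  shows "\<Phi> ` W' = G"
proof
  interpret W: group W by (rule group_W)
  interpret S: group "sym_group n" by (rule sym_group_is_group)
  interpret gh: group_hom W "sym_group n" \<Phi> by (rule \<Phi>_group_hom)
  have ab: "{a, b} \<subseteq> carrier (sym_group n)"
    using wa wb W.subgroup_self subgroup.subset[OF W'] \<Phi>_carrier by blast
  have G_sub: "subgroup G (sym_group n)" unfolding gen using S.generate_is_subgroup[OF ab] .
  interpret perm_group n G by (rule perm_group.intro) (rule G_sub)
  note W'_in = subgroup.mem_carrier[OF W']
  show "G \<subseteq> \<Phi> ` W'"
    unfolding gen by (rule S.generate_subgroup_incl) (use wa wb gh.subgroup_img_is_subgroup[OF W'] in auto)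
  \<comment> \<open>every block permutation is realized by an element of \<open>W'\<close> whose image is in \<open>G\<close>\<close>
  have lift: "\<exists>v \<in> W'. \<Phi> v \<in> G \<and> snd v = \<sigma>" if "\<sigma> \<in> generate (sym_group d) {snd wa}" for \<sigma>
    using that
  proof (induction rule: generate.induct)
    case one
    have "snd \<one>\<^bsub>W\<^esub> = \<one>\<^bsub>sym_group d\<^esub>" by (simp add: one_W sym_group_one)
    then show ?case using subgroup.one_closed[OF W'] \<Phi>_one id_mem by metis
  next
    case (incl h)
    then show ?case using wa gen by (auto intro!: bexI[of _ wa] generate.incl)
  next
    case (inv h)
    have wac: "wa \<in> carrier W" using wa W'_in by blast
    then have sK: "snd wa \<in> K" using carrier_W by (metis prod.collapse)
    have sm: "snd (x \<otimes>\<^bsub>W\<^esub> y) = snd y \<circ> snd x" for x y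
      by (cases x; cases y) (simp add: mult_W)
    have "snd (inv\<^bsub>W\<^esub> wa) \<circ> snd wa = id" "snd wa \<circ> snd (inv\<^bsub>W\<^esub> wa) = id"
      using W.l_inv[OF wac] W.r_inv[OF wac] sm[of wa "inv\<^bsub>W\<^esub> wa"] sm[of "inv\<^bsub>W\<^esub> wa" wa]
      by (simp_all add: one_W)
    then have "snd (inv\<^bsub>W\<^esub> wa) = inv' (snd wa)"
      by (metis inv_unique_comp)
    moreover have "\<Phi> (inv\<^bsub>W\<^esub> wa) \<in> G"
      using wa \<Phi>_inv[OF wac] inv_mem[of a] generate.incl[of a "{a, b}" "sym_group n"]
      unfolding gen[symmetric] by simp
    moreover have "inv\<^bsub>sym_group d\<^esub> h = inv' (snd wa)"
      using inv sK subgroup.mem_carrier[OF K] by simp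
    ultimately show ?case using subgroup.m_inv_closed[OF W' wa(1)] by metis
  next
    case (eng h1 h2)
    then obtain v1 v2 where v: "v1 \<in> W'" "\<Phi> v1 \<in> G" "snd v1 = h1" "v2 \<in> W'" "\<Phi> v2 \<in> G" "snd v2 = h2"
      by auto
    then have "v2 \<otimes>\<^bsub>W\<^esub> v1 \<in> W'" "\<Phi> (v2 \<otimes>\<^bsub>W\<^esub> v1) \<in> G"
      using subgroup.m_closed[OF W'] \<Phi>_mult W'_in comp_mem by auto
    moreover have "snd (v2 \<otimes>\<^bsub>W\<^esub> v1) = h1 \<otimes>\<^bsub>sym_group d\<^esub> h2"
      using v by (cases v1; cases v2) (simp add: mult_W sym_group_mult)
    ultimately show ?case by blast
  qed
  show "\<Phi> ` W' \<subseteq> G"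
  proof
    fix g assume "g \<in> \<Phi> ` W'"
    then obtain w where w: "w \<in> W'" "g = \<Phi> w" by blast
    then have "snd w \<in> K" using W'_in carrier_W by (metis prod.collapse)
    then obtain v where v: "v \<in> W'" "\<Phi> v \<in> G" "snd v = snd w" using lift Kgen by blast
    let ?x = "w \<otimes>\<^bsub>W\<^esub> inv\<^bsub>W\<^esub> v"
    have x: "?x \<in> W'" using w v W' by (simp add: subgroup.m_closed subgroup.m_inv_closed)
    have eq: "?x \<otimes>\<^bsub>W\<^esub> v = w" using w v W'_in by (simp add: W.m_assoc)
    have "snd (?x \<otimes>\<^bsub>W\<^esub> v) = snd v \<circ> snd ?x"
      by (cases ?x; cases v) (simp add: mult_W)
    then have "snd w = snd v \<circ> snd ?x" using eq by simp
    then have "snd v \<circ> snd ?x = snd v \<circ> id" using v by simp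
    moreover have "snd v \<in> K" using v W'_in carrier_W by (metis prod.collapse)
    ultimately have "snd ?x = id"
      using permutes_inj[OF K_permutes] by (metis fun.inj_map injD)
    then have "\<Phi> ?x \<in> G" using base x by (metis prod.collapse)
    then have "\<Phi> ?x \<circ> \<Phi> v \<in> G" using v comp_mem by blast
    then show "g \<in> G" using eq \<Phi>_mult W'_in x v w by metis
  qed
qed

end

section \<open>The permutations of a star of cycles\<close>

text \<open>The length of the \<open>j\<close>-th cycle of the star: the cycle with index 0 has length \<open>t\<close>, the
  others have length \<open>s\<close>.\<close>

definition arm :: "nat \<Rightarrow> nat \<Rightarrow> nat \<Rightarrow> nat" where
  "arm s t j = (if j = 0 then t else s)"

text \<open>The permutations of \<open>{1..n}\<close> with the cycle structure of the trees in question: the cycles of \<open>a\<close>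
  are the arms \<open>(p j 0 \<dots> p j (arm s t j - 1))\<close>, and \<open>b\<close> is the \<open>r\<close>-cycle through their initial points.\<close>

locale star_perms =
  fixes r s t n :: nat and p :: "nat \<Rightarrow> nat \<Rightarrow> nat" and a b :: "nat \<Rightarrow> nat"
  assumes r: "1 < r" and s: "0 < s" and t: "0 < t"
    and p_bij: "bij_betw (\<lambda>(j, i). p j i) (SIGMA j:{..<r}. {..<arm s t j}) {1..n}"
    and a_permutes: "a permutes {1..n}" and b_permutes: "b permutes {1..n}"
    and a_p: "j < r \<Longrightarrow> i < arm s t j \<Longrightarrow> a (p j i) = p j (Suc i mod arm s t j)"
    and b_p0: "j < r \<Longrightarrow> b (p j 0) = p (Suc j mod r) 0"
    and b_p: "j < r \<Longrightarrow> 0 < i \<Longrightarrow> i < arm s t j \<Longrightarrow> b (p j i) = p j i"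
begin

abbreviation d :: nat where "d \<equiv> gcd s t"
abbreviation len :: "nat \<Rightarrow> nat" where "len \<equiv> arm s t"
abbreviation L :: "nat \<Rightarrow> nat" where "L \<equiv> arm (s div d) (t div d)"

definition G :: "(nat \<Rightarrow> nat) set" where "G = generate (sym_group n) {a, b}"

text \<open>The points whose position on their arm is divisible by \<open>d\<close>. The arm \<open>j\<close> contributes \<open>L j\<close> of
  them. The other blocks of \<open>G\<close> are the images of this one under powers of \<open>a\<close>.\<close>

definition block :: "nat set" where
  "block = (\<lambda>(j, i). p j (d * i)) ` (SIGMA j:{..<r}. {..<L j})"

lemma block_cases:
  assumes "z \<in> block" obtains j i where "j < r" "i < L j" "z = p j (d * i)"
proof -
  obtain x where x: "x \<in> (SIGMA j:{..<r}. {..<L j})" "z = (\<lambda>(j, i). p j (d * i)) x"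
    using assms unfolding block_def by (rule imageE)
  show thesis by (rule that[of "fst x" "snd x"]) (use x in \<open>cases x; simp\<close>)+
qed

lemma d_pos: "0 < d" using s by simp

lemma len_pos: "0 < len j" using s t by (simp add: arm_def)

lemma len_eq: "len j = d * L j" by (simp add: arm_def)

lemma L_pos: "0 < L j"
  using len_pos[of j] len_eq[of j] by (metis mult_0_right neq0_conv)

lemma mult_less_len: "d * i < len j \<longleftrightarrow> i < L j"
  unfolding len_eq using d_pos by simp

lemma p_inj:
  "j < r \<Longrightarrow> i < len j \<Longrightarrow> j' < r \<Longrightarrow> i' < len j' \<Longrightarrow> p j i = p j' i' \<longleftrightarrow> j = j' \<and> i = i'"
  using inj_on_eq_iff[OF bij_betw_imp_inj_on[OF p_bij], of "(j, i)" "(j', i')"] by simp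

lemma p_in: "j < r \<Longrightarrow> i < len j \<Longrightarrow> p j i \<in> {1..n}"
  using bij_betwE[OF p_bij] by force

lemma p_cases:
  assumes "v \<in> {1..n}" obtains j i where "j < r" "i < len j" "v = p j i"
proof -
  obtain x where "x \<in> (SIGMA j:{..<r}. {..<len j})" "v = (\<lambda>(j, i). p j i) x"
    using assms bij_betw_imp_surj_on[OF p_bij] by blast
  then show thesis using that by (cases x) auto
qed

lemma funpow_a_p:
  assumes "j < r" "i < len j" shows "(a ^^ k) (p j i) = p j ((i + k) mod len j)"
proof (induction k)
  case (Suc k)
  then show ?case using a_p[of j "(i + k) mod len j"] assms len_pos[of j] by (simp add: mod_Suc_eq)
qed (use assms in simp)

lemma G_subgroup: "subgroup G (sym_group n)"
  unfolding G_def by (rule group.generate_is_subgroup[OF sym_group_is_group])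
    (use a_permutes b_permutes in \<open>simp add: sym_group_carrier\<close>)

sublocale perm_group n G
  by (rule perm_group.intro) (rule G_subgroup)

lemma a_mem: "a \<in> G" and b_mem: "b \<in> G"
  by (simp_all add: G_def generate.incl)

lemma a_pow_permutes: "a ^^ k permutes {1..n}"
  using permutes funpow_mem[OF a_mem] by blast

text \<open>The hypothesis on \<open>c\<close> says that \<open>c = h g h\<^sup>-\<^sup>1 g\<^sup>-\<^sup>1\<close>, in a form that avoids inverses.\<close>

lemma commutator_mem:
  assumes g: "g \<in> G" and h: "h \<in> G"
    and c: "c permutes {1..n}" and eq: "\<And>v. v \<in> {1..n} \<Longrightarrow> h (g v) = c (g (h v))"
  shows "c \<in> G"
proof -
  have "h \<circ> g = c \<circ> (g \<circ> h)"
  proof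
    fix v show "(h \<circ> g) v = (c \<circ> (g \<circ> h)) v"
      using eq permutes_not_in[OF permutes[OF g], of v] permutes_not_in[OF permutes[OF h], of v]
        permutes_not_in[OF c, of v] by (cases "v \<in> {1..n}") simp_all
  qed
  then show ?thesis
    using comp_mem_cancel[of "g \<circ> h" c "h \<circ> g"] comp_mem g h by metis
qed

lemma three_cycle_permutes:
  "{x, y, z} \<subseteq> {1..n} \<Longrightarrow> cycle_of_list [x, y, z] permutes {1..n}"
  using permutes_subset[OF cycle_permutes[of "[x, y, z]"]] by simp

text \<open>If \<open>t\<close> does not divide \<open>s\<close>, then \<open>g = a\<^sup>s\<close> fixes all arms of length \<open>s\<close> pointwise and moves
  \<open>x = p 0 0\<close> to another point \<open>y\<close> of its arm. So \<open>b\<close> and \<open>g b g\<^sup>-\<^sup>1\<close> are the \<open>r\<close>-cycles \<open>(x 1 \<dots> r-1)\<close> and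
  \<open>(y 1 \<dots> r-1)\<close>, where \<open>j\<close> stands for \<open>p j 0\<close>, and \<open>b (g b g\<^sup>-\<^sup>1)\<^sup>-\<^sup>1\<close> is the three-cycle
  \<open>(x 1 y)\<close>.\<close>

lemma linked_hub_not_dvd:
  assumes nd: "\<not> t dvd s"
  shows "linked (p 0 0) (p 1 0)"
proof -
  let ?g = "a ^^ s" let ?x = "p 0 0" let ?y = "p 0 (s mod t)" let ?z = "p 1 0"
  let ?c = "cycle_of_list [?x, ?z, ?y]"
  have st: "0 < s mod t" "s mod t < t" using nd t by (simp_all add: dvd_eq_mod_eq_0)
  have l0: "len 0 = t" and l1: "j \<noteq> 0 \<Longrightarrow> len j = s" for j by (simp_all add: arm_def)
  have dist: "distinct [?x, ?z, ?y]"
    using p_inj[of 0 0 1 0] p_inj[of 0 0 0 "s mod t"] p_inj[of 1 0 0 "s mod t"] r s t st l0 l1 by simp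
  have c: "?c v = (if v = ?x then ?z else if v = ?z then ?y else if v = ?y then ?x else v)" for v
    by (rule three_cycle_apply[OF dist])
  have g0: "?g (p 0 i) = p 0 ((i + s) mod t)" if "i < t" for i
    using funpow_a_p[of 0 i s] that l0 r by simp
  have g1: "?g (p j i) = p j i" if "j \<noteq> 0" "j < r" "i < s" for j i
    using funpow_a_p[of j i s] that l1[of j] by simp
  have "?c \<in> G"
  proof (rule commutator_mem[OF funpow_mem[OF a_mem] b_mem])
    show "?c permutes {1..n}"
      by (rule three_cycle_permutes) (use p_in r s t st l0 l1 in auto)
    fix v assume "v \<in> {1..n}"
    then obtain j i where v: "j < r" "i < len j" "v = p j i" by (rule p_cases)
    consider "j = 0" "i = 0" | "j = 0" "0 < i" | "j \<noteq> 0" "i = 0" | "j \<noteq> 0" "0 < i" by blast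
    then show "b (?g v) = ?c (?g (b v))"
    proof cases
      case 1
      have "b (?g v) = ?y" using 1 v g0[of 0] t st b_p[of 0 "s mod t"] l0 by simp
      moreover have "?c (?g (b v)) = ?y" 
        using 1 v b_p0[of 0] g1[of 1 0] r s c dist by simp
      ultimately show ?thesis by simp
    next
      case 2
      define k where "k = (i + s) mod t"
      have it: "i < t" and kt: "k < t" using v 2 l0 t by (simp_all add: k_def)
      have gv: "?g v = p 0 k" "b v = v" using g0 it v 2 b_p by (auto simp: k_def)
      have "k \<noteq> s mod t"
      proof
        assume "k = s mod t"
        then have "(i + s) mod t = (0 + s) mod t" by (simp add: k_def)
        then have "[i = 0] (mod t)" using cong_add_rcancel_nat[of i s 0 t] by (simp add: cong_def)
        then have "i mod t = 0" by (simp add: cong_def)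
        then show False using 2 it by simp
      qed
      then have nxy: "p 0 k \<noteq> ?y" "p 0 k \<noteq> ?z" "p 0 k = ?x \<longleftrightarrow> k = 0"
        using p_inj[of 0 k 0 "s mod t"] p_inj[of 0 k 1 0] p_inj[of 0 k 0 0] kt st r s t l0 l1 by auto
      show ?thesis
      proof (cases "k = 0")
        case True
        then show ?thesis using gv c b_p0[of 0] r by simp
      next
        case False
        then show ?thesis using gv c nxy b_p[of 0 k] r kt l0 by simp
      qed
    next
      case 3
      have gv: "?g v = v" using g1 3 v s by simp
      show ?thesis
      proof (cases "Suc j = r")
        case True
        then have "b v = ?x" using b_p0[of j] v 3 by simp
        moreover have "?g ?x = ?y" using g0[of 0] t by simp
        moreover have "?c ?y = ?x" using c dist by auto
        ultimately show ?thesis using gv by simp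
      next
        case False
        then have bv: "b v = p (Suc j) 0" using b_p0[of j] v 3 by simp
        have "?g (p (Suc j) 0) = p (Suc j) 0" using g1[of "Suc j" 0] False v s by simp
        moreover have "?c (p (Suc j) 0) = p (Suc j) 0"
          using c p_inj[of "Suc j" 0] False v 3 s t st r l0 l1 by simp
        ultimately show ?thesis using gv bv by simp
      qed
    next
      case 4
      then have "?g v = v" "b v = v" using g1 v l1 b_p by auto
      moreover have "?c v = v" using c p_inj[of j i] 4 v s t st r l0 l1 by simp
      ultimately show ?thesis by simp
    qed
  qed
  then show ?thesis using linkedI[OF dist] by blast
qed

text \<open>If \<open>t\<close> divides \<open>s\<close>, then \<open>t < s\<close>, and \<open>g = a\<^sup>t\<close> fixes the arm of \<open>x = p 0 0\<close> pointwise and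
  moves the initial points of all other arms to their position \<open>t\<close>. So \<open>b\<close> and \<open>b' = g b g\<^sup>-\<^sup>1\<close> are
  \<open>r\<close>-cycles with the single common point \<open>x\<close>, and their commutator \<open>b b' b\<^sup>-\<^sup>1 b'\<^sup>-\<^sup>1\<close> is the
  three-cycle \<open>(x b(x) b'(x))\<close>.\<close>

lemma linked_hub_dvd:
  assumes dv: "t dvd s" and ne: "s \<noteq> t"
  shows "linked (p 0 0) (p 1 0)"
proof -
  let ?g = "a ^^ t"
  define b' where "b' = ?g \<circ> b \<circ> inv' ?g"
  let ?x = "p 0 0" let ?y = "p 1 t" let ?z = "p 1 0"
  let ?c = "cycle_of_list [?x, ?z, ?y]"
  have ts: "t < s" using dvd_imp_le[OF dv s] ne by simp
  have l0: "len 0 = t" and l1: "j \<noteq> 0 \<Longrightarrow> len j = s" for j by (simp_all add: arm_def)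
  have dist: "distinct [?x, ?z, ?y]"
    using p_inj[of 0 0 1 0] p_inj[of 0 0 1 t] p_inj[of 1 0 1 t] r s t ts l0 l1 by simp
  have c: "?c v = (if v = ?x then ?z else if v = ?z then ?y else if v = ?y then ?x else v)" for v
    by (rule three_cycle_apply[OF dist])
  have g: "?g \<in> G" using funpow_mem[OF a_mem] .
  have g0: "?g (p 0 i) = p 0 i" if "i < t" for i
    using funpow_a_p[of 0 i t] that l0 r by simp
  have g1: "?g (p j i) = p j ((i + t) mod s)" if "j \<noteq> 0" "j < r" "i < s" for j i
    using funpow_a_p[of j i t] that l1[of j] by simp
  have b'g: "b' (?g v) = ?g (b v)" for v
    unfolding b'_def using permutes_inverses(2)[OF permutes[OF g]] by simp
  have b'x: "b' ?x = ?y"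
    using b'g[of ?x] g0[of 0] t b_p0[of 0] r g1[of 1 0] ts by simp
  have b'0: "b' (p 0 i) = p 0 i" if "0 < i" "i < t" for i
    using b'g[of "p 0 i"] g0[of i] that b_p[of 0 i] r l0 by simp
  have b't: "b' (p j t) = (if Suc j = r then ?x else p (Suc j) t)" if "j \<noteq> 0" "j < r" for j
    using b'g[of "p j 0"] g1[of j 0] g1[of "Suc j" 0] g0[of 0] that b_p0[of j] s t ts by simp
  have b'1: "b' (p j i) = p j i" if j: "j \<noteq> 0" "j < r" and i: "i < s" "i \<noteq> t" for j i
  proof -
    define k where "k = (i + (s - t)) mod s"
    have ks: "k < s" using s by (simp add: k_def)
    have "(k + t) mod s = (i + (s - t) + t) mod s" unfolding k_def by (rule mod_add_left_eq)
    then have kt: "(k + t) mod s = i" using ts i by simp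
    then have "k \<noteq> 0" using i ts by (metis add_0 mod_less)
    then show ?thesis
      using b'g[of "p j k"] g1[of j k] j ks kt b_p[of j k] l1 by simp
  qed
  have "?c \<in> G"
  proof (rule commutator_mem[OF _ b_mem])
    show "b' \<in> G" unfolding b'_def by (intro comp_mem inv_mem g b_mem)
    show "?c permutes {1..n}"
      by (rule three_cycle_permutes) (use p_in r s t ts l0 l1 in auto)
    fix v assume "v \<in> {1..n}"
    then obtain j i where v: "j < r" "i < len j" "v = p j i" by (rule p_cases)
    consider "j = 0" "i = 0" | "j = 0" "0 < i" | "j \<noteq> 0" "i = 0" | "j \<noteq> 0" "i = t" | "j \<noteq> 0" "0 < i" "i \<noteq> t"
      by blast
    then show "b (b' v) = ?c (b' (b v))"
    proof cases
      case 1
      have "b ?y = ?y" using b_p[of 1 t] r t ts l1 by simp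
      moreover have "b ?x = ?z" using b_p0[of 0] r by simp
      moreover have "b' ?z = ?z" using b'1[of 1 0] r s t by simp
      moreover have "?c ?z = ?y" using c dist by simp
      ultimately show ?thesis using 1 v b'x by simp
    next
      case 2
      then have "b' v = v" "b v = v" using v b'0 b_p l0 by auto
      moreover have "?c v = v" using c p_inj[of j i] 2 v s t ts r l0 l1 by simp
      ultimately show ?thesis by simp
    next
      case 3
      have b'v: "b' v = v" using b'1[of j 0] 3 v s t by simp
      show ?thesis
      proof (cases "Suc j = r")
        case True
        then have "b v = ?x" using b_p0[of j] v 3 by simp
        moreover have "?c ?y = ?x" using c dist by auto
        ultimately show ?thesis using b'v b'x by simp
      next
        case False
        then have bv: "b v = p (Suc j) 0" using b_p0[of j] v 3 by simp
        have "b' (p (Suc j) 0) = p (Suc j) 0" using b'1[of "Suc j" 0] False v s t by simp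
        moreover have "?c (p (Suc j) 0) = p (Suc j) 0"
          using c p_inj[of "Suc j" 0] False v 3 s t ts r l0 l1 by simp
        ultimately show ?thesis using b'v bv by simp
      qed
    next
      case 4
      have bv: "b v = v" using b_p 4 v t by simp
      show ?thesis
      proof (cases "Suc j = r")
        case True
        then show ?thesis using bv b't[of j] 4 v b_p0[of 0] r c by simp
      next
        case False
        then have b'v: "b' v = p (Suc j) t" using b't[of j] 4 v by simp
        have "b (p (Suc j) t) = p (Suc j) t" using b_p[of "Suc j" t] False v t ts l1 by simp
        moreover have "?c (p (Suc j) t) = p (Suc j) t"
          using c p_inj[of "Suc j" t] False v 4 s t ts r l0 l1 by simp
        ultimately show ?thesis using bv b'v by simp
      qed
    next
      case 5
      then have "b' v = v" "b v = v" using v b'1[of j i] l1 b_p by auto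
      moreover have "?c v = v" using c p_inj[of j i] 5 v s t ts r l0 l1 by simp
      ultimately show ?thesis by simp
    qed
  qed
  then show ?thesis using linkedI[OF dist] by blast
qed

lemma multiple_mod:
  assumes "gcd u v dvd i" "i < v" shows "\<exists>k. (u * k) mod v = (i::nat)"
proof -
  obtain x where "[u * x = gcd u v] (mod v)" using cong_solve_nat by blast
  moreover obtain y where "i = gcd u v * y" using assms(1) by blast
  ultimately have "[u * x * y = i] (mod v)" using cong_scalar_right by blast
  then show ?thesis using assms(2) by (auto simp: cong_def mult.assoc)
qed

text \<open>Powers of \<open>b\<close> link the initial points of all arms. The powers of \<open>a\<^sup>s\<close> fix \<open>p 1 0\<close> and carry
  \<open>p 0 0\<close> to all points of its arm in the block, since these are the multiples of \<open>s\<close> modulo \<open>t\<close>;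
  powers of \<open>a\<^sup>t\<close> do the same for the other arms, with \<open>p 0 0\<close> fixed.\<close>

lemma block_linked:
  assumes "s \<noteq> t" "x \<in> block" "y \<in> block" shows "linked x y"
proof -
  have l0: "len 0 = t" and l1: "j \<noteq> 0 \<Longrightarrow> len j = s" for j by (simp_all add: arm_def)
  have hub: "linked (p 0 0) (p 1 0)"
    using linked_hub_dvd linked_hub_not_dvd assms(1) by blast
  have step: "linked (p j 0) (p (Suc j) 0)" if "Suc j < r" for j
    using that
  proof (induction j)
    case (Suc j)
    then show ?case using linked_image[OF b_mem Suc.IH] b_p0[of j] b_p0[of "Suc j"] by simp
  qed (use hub in simp)
  have heads: "j < r \<Longrightarrow> linked (p 0 0) (p j 0)" for j
  proof (induction j)
    case (Suc j)
    then show ?case using linked_trans[OF _ step[of j]] by simp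
  qed (rule linked_refl)
  have pts: "linked (p 0 0) (p j (d * i))" if ji: "j < r" "i < L j" for j i
  proof (cases "j = 0")
    case True
    have "d * i < t" using mult_less_len[of i 0] True ji l0 by simp
    then obtain k where k: "(s * k) mod t = d * i" using multiple_mod[of s t "d * i"] by auto
    have "linked ((a ^^ (s * k)) (p 1 0)) ((a ^^ (s * k)) (p 0 0))"
      by (rule linked_image[OF funpow_mem[OF a_mem] linked_sym[OF hub]])
    then have "linked (p 1 0) (p 0 (d * i))"
      using funpow_a_p[of 1 0 "s * k"] funpow_a_p[of 0 0 "s * k"] l0 l1[of 1] r s t k by simp
    then show ?thesis using linked_trans[OF hub] True by simp
  next
    case False
    have "d * i < s" using mult_less_len[of i j] False ji l1 by simp
    then obtain k where k: "(t * k) mod s = d * i"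
      using multiple_mod[of t s "d * i"] by (auto simp: gcd.commute)
    have "linked ((a ^^ (t * k)) (p 0 0)) ((a ^^ (t * k)) (p j 0))"
      by (rule linked_image[OF funpow_mem[OF a_mem] heads[OF ji(1)]])
    then show ?thesis
      using funpow_a_p[of j 0 "t * k"] funpow_a_p[of 0 0 "t * k"] l0 l1[of j] r s t k False ji by simp
  qed
  then have "linked (p 0 0) z" if z: "z \<in> block" for z
  proof -
    from z show ?thesis by (rule block_cases) (use pts in simp)
  qed
  from linked_trans[OF linked_sym[OF this[OF assms(2)]] this[OF assms(3)]] show ?thesis .
qed

lemma block_subset: "block \<subseteq> {1..n}"
proof
  fix x assume "x \<in> block"
  then obtain j i where "j < r" "i < L j" "x = p j (d * i)" by (auto simp: block_def)
  then show "x \<in> {1..n}" using p_in mult_less_len by blast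
qed

text \<open>The blocks are the images of \<^const>\<open>block\<close> under \<open>a\<^bsup>k-1\<^esup>\<close> for \<open>k = 1, \<dots>, d\<close>. Each of them is identified
  with the model \<open>Y\<close> of \<^const>\<open>block\<close>, with a twist by powers of a fixed bijection \<open>\<delta>\<close> of \<open>Y\<close>.\<close>

lemma frame_bij:
  assumes \<beta>: "bij_betw \<beta> Y block" and \<delta>: "bij_betw \<delta> Y Y"
  shows "bij_betw (\<lambda>(k, u). (a ^^ (k - 1)) (\<beta> ((\<delta> ^^ (k - 1)) u))) ({1..d} \<times> Y) {1..n}"
    (is "bij_betw ?f _ _")
proof -
  have \<delta>k: "bij_betw (\<delta> ^^ k) Y Y" for k by (rule bij_betw_funpow[OF \<delta>])
  \<comment> \<open>the block with index \<open>k\<close> consists of the positions congruent to \<open>k - 1\<close> modulo \<open>d\<close>\<close>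
  have pos: "\<exists>j i. j < r \<and> i < len j \<and> ?f (k, u) = p j i \<and> i mod d = k - 1"
    if k: "k \<in> {1..d}" and u: "u \<in> Y" for k u
  proof -
    have "\<beta> ((\<delta> ^^ (k - 1)) u) \<in> block" using bij_betwE[OF \<beta>] bij_betwE[OF \<delta>k] u by blast
    then obtain j i where ji: "j < r" "i < L j" "\<beta> ((\<delta> ^^ (k - 1)) u) = p j (d * i)"
      by (auto simp: block_def)
    have "((d * i + (k - 1)) mod len j) mod d = (d * i + (k - 1)) mod d"
      by (rule mod_mod_cancel) (simp add: len_eq)
    also have "\<dots> = (k - 1) mod d" by (rule mod_mult_self4)
    also have "\<dots> = k - 1" using k by (intro mod_less) auto
    finally show ?thesis
      using ji funpow_a_p[of j "d * i" "k - 1"] mult_less_len[of i j] len_pos[of j]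
      by (intro exI[of _ j] exI[of _ "(d * i + (k - 1)) mod len j"]) simp
  qed
  show ?thesis
  proof (rule bij_betwI')
    fix x y assume "x \<in> {1..d} \<times> Y" "y \<in> {1..d} \<times> Y"
    then obtain k u k' u' where x: "x = (k, u)" "k \<in> {1..d}" "u \<in> Y"
      and y: "y = (k', u')" "k' \<in> {1..d}" "u' \<in> Y" by blast
    show "?f x = ?f y \<longleftrightarrow> x = y"
    proof
      assume eq: "?f x = ?f y"
      have "k - 1 = k' - 1" using pos[OF x(2,3)] pos[OF y(2,3)] eq x(1) y(1) p_inj by metis
      then have kk: "k = k'" using x y by auto
      then have "\<beta> ((\<delta> ^^ (k - 1)) u) = \<beta> ((\<delta> ^^ (k - 1)) u')"
        using eq x(1) y(1) permutes_inj[OF a_pow_permutes] by (auto dest: injD)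
      then have "(\<delta> ^^ (k - 1)) u = (\<delta> ^^ (k - 1)) u'"
        using bij_betw_imp_inj_on[OF \<beta>] bij_betwE[OF \<delta>k] x y by (meson inj_onD)
      then have "u = u'" using bij_betw_imp_inj_on[OF \<delta>k] x y by (meson inj_onD)
      then show "x = y" using kk x y by simp
    qed simp
  next
    fix x assume "x \<in> {1..d} \<times> Y"
    then show "?f x \<in> {1..n}" using pos p_in by (cases x) (metis (no_types, lifting) SigmaD1 SigmaD2)
  next
    fix v assume "v \<in> {1..n}"
    then obtain j i where v: "j < r" "i < len j" "v = p j i" by (rule p_cases)
    let ?k = "i mod d"
    have le: "d * (i div d) \<le> i" by simp
    then have "d * (i div d) < len j" using v by linarith
    then have "p j (d * (i div d)) \<in> block"
      using v mult_less_len by (auto simp: block_def)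
    then obtain w where w: "w \<in> Y" "\<beta> w = p j (d * (i div d))"
      using bij_betw_imp_surj_on[OF \<beta>] by (metis imageE)
    obtain u where u: "u \<in> Y" "(\<delta> ^^ ?k) u = w"
      using bij_betw_imp_surj_on[OF \<delta>k[of ?k]] w(1) by (metis imageE)
    have "?f (Suc ?k, u) = v"
      using u w funpow_a_p[OF v(1) \<open>d * (i div d) < len j\<close>, of ?k] v by simp
    moreover have "Suc ?k \<in> {1..d}" using d_pos by (simp add: Suc_le_eq)
    ultimately show "\<exists>x \<in> {1..d} \<times> Y. v = ?f x" using u(1) by (intro bexI[of _ "(Suc ?k, u)"]) auto
  qed
qed

end

section \<open>The cyclic group of order \<open>d\<close>\<close>

lemma upt_set: "set [1..<Suc d] = {1..d}" by auto

lemma cycle_perm_apply: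
  assumes "i \<in> {1..d}"
  shows "cycle_of_list [1..<Suc d] i = (if i = d then 1 else Suc i)"
proof -
  have i: "i - 1 < length [1..<Suc d]" using assms by (cases i) simp_all
  have "cycle_of_list [1..<Suc d] ([1..<Suc d] ! (i - 1))
      = [1..<Suc d] ! (Suc (i - 1) mod length [1..<Suc d])"
    by (rule cycle_of_list_nth[OF distinct_upt i])
  moreover have "[1..<Suc d] ! (i - 1) = i" using assms by (simp del: upt_Suc add: nth_upt)
  moreover have "Suc (i - 1) mod length [1..<Suc d] = (if i = d then 0 else i)" using assms by auto
  moreover have "[1..<Suc d] ! (if i = d then 0 else i) = (if i = d then 1 else Suc i)"
    using assms by (auto simp del: upt_Suc simp: nth_upt)
  ultimately show ?thesis by argo
qed

lemma cycle_perm_permutes: "cycle_of_list [1..<Suc d] permutes {1..d}"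
  using cycle_permutes[of "[1..<Suc d]"] unfolding upt_set .

lemma cycle_perm_inv_apply:
  assumes "i \<in> {1..d}"
  shows "inv' (cycle_of_list [1..<Suc d]) i = (if i = 1 then d else i - 1)"
proof -
  have "cycle_of_list [1..<Suc d] (if i = 1 then d else i - 1) = i"
    using assms by (subst cycle_perm_apply) auto
  then show ?thesis using permutes_inverses(2)[OF cycle_perm_permutes] by metis
qed

lemma cyclic_perms_generate_inv:
  "cyclic_perms d = generate (sym_group d) {inv' (cycle_of_list [1..<Suc d])}"
proof -
  interpret S: group "sym_group d" by (rule sym_group_is_group)
  let ?c = "cycle_of_list [1..<Suc d]"
  have c: "?c \<in> carrier (sym_group d)" unfolding sym_group_carrier by (rule cycle_perm_permutes)
  then have i: "inv\<^bsub>sym_group d\<^esub> ?c = inv' ?c" by simp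
  have *: "generate (sym_group d) {inv\<^bsub>sym_group d\<^esub> x} \<subseteq> generate (sym_group d) {x}"
    if "x \<in> carrier (sym_group d)" for x
    by (rule S.generate_subgroup_incl)
      (use that in \<open>auto intro!: S.generate_is_subgroup generate.inv simp del: sym_group_inv_equality\<close>)
  show ?thesis
    using *[OF c] *[OF S.inv_closed[OF c]] unfolding i S.inv_inv[OF c, unfolded i] cyclic_perms_def by blast
qed

section \<open>The group of a star of cycles as a wreath product\<close>

text \<open>A model of the action on \<^const>\<open>star_perms.block\<close>: the group \<open>H\<close> acts on \<open>Y\<close>, and under the
  bijection \<open>\<beta>\<close> the permutations \<open>a\<^sup>d\<close> and \<open>b\<close> of the block become the elements \<open>\<alpha>\<close> and \<open>\<gamma>\<close> of \<open>H\<close>.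
  The element \<open>\<delta>\<close>, whose square is trivial, is the twist in the identification of consecutive blocks.\<close>

locale star_action = star_perms r s t n p a b + faithful_action H act Y
  for r s t n :: nat and p :: "nat \<Rightarrow> nat \<Rightarrow> nat" and a b :: "nat \<Rightarrow> nat"
    and H :: "('h, 'm) monoid_scheme" (structure) and act :: "'h \<Rightarrow> 'y \<Rightarrow> 'y" and Y :: "'y set" +
  fixes \<beta> :: "'y \<Rightarrow> nat" and \<alpha> \<gamma> \<delta> :: 'h
  assumes \<beta>_bij: "bij_betw \<beta> Y block"
    and \<alpha>_in: "\<alpha> \<in> carrier H" and \<gamma>_in: "\<gamma> \<in> carrier H" and \<delta>_in: "\<delta> \<in> carrier H"
    and \<delta>_sq: "\<delta> \<otimes> \<delta> = \<one>"
    and a_\<beta>: "u \<in> Y \<Longrightarrow> (a ^^ d) (\<beta> u) = \<beta> (act \<alpha> u)"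
    and b_\<beta>: "u \<in> Y \<Longrightarrow> b (\<beta> u) = \<beta> (act \<gamma> u)"
begin

text \<open>The identification of the \<open>d\<close> blocks with \<open>Y\<close>, chosen such that \<open>a\<close> acts as \<open>\<delta>\<close> from each block to
  the next one, except for the step from the last block to the first.\<close>

definition frame :: "nat \<times> 'y \<Rightarrow> nat" where
  "frame = (\<lambda>(k, u). (a ^^ (k - 1)) (\<beta> ((act \<delta> ^^ (k - 1)) u)))"

lemma act_\<delta>_sq: "u \<in> Y \<Longrightarrow> act \<delta> (act \<delta> u) = u"
  using act_mult[OF \<delta>_in \<delta>_in] act_one \<delta>_sq by metis

lemma act_\<delta>_bij: "bij_betw (act \<delta>) Y Y"
  by (rule bij_betw_byWitness[where f' = "act \<delta>"]) (auto simp: act_\<delta>_sq act_closed[OF \<delta>_in])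

lemma act_\<delta>_pow: "u \<in> Y \<Longrightarrow> (act \<delta> ^^ k) u = act (\<delta> [^] k) u"
proof (induction k)
  case (Suc k)
  then show ?case
    using act_mult[OF \<delta>_in nat_pow_closed[OF \<delta>_in, of k]] nat_pow_Suc2[OF \<delta>_in, of k] by simp
qed (simp add: act_one)

sublocale wreath_action H act Y frame d n "cyclic_perms d"
  by unfold_locales
    (use frame_bij[OF \<beta>_bij act_\<delta>_bij] subgroup_cyclic_perms in \<open>simp_all add: frame_def subgroup_def\<close>)

lemma frame_1: "frame (1, u) = \<beta> u"
  by (simp add: frame_def)

lemma a_frame:
  assumes "1 \<le> k" "k < d" "u \<in> Y" shows "a (frame (k, u)) = frame (Suc k, act \<delta> u)"
proof -
  obtain k' where "k = Suc k'" using assms(1) by (cases k) auto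
  then show ?thesis
    using act_\<delta>_sq[OF assms(3)] by (simp add: frame_def funpow_swap1)
qed

lemma a_frame_last:
  assumes "u \<in> Y" shows "a (frame (d, u)) = frame (1, act (\<alpha> \<otimes> \<delta> [^] (d - 1)) u)"
proof -
  obtain d' where d': "d = Suc d'" using d_pos by (cases d) auto
  have "a (frame (d, u)) = (a ^^ d) (\<beta> (act (\<delta> [^] (d - 1)) u))"
    unfolding d' using act_\<delta>_pow[OF assms] by (simp add: frame_def)
  also have "\<dots> = \<beta> (act \<alpha> (act (\<delta> [^] (d - 1)) u))"
    by (rule a_\<beta>) (simp add: act_closed \<delta>_in assms)
  finally show ?thesis unfolding frame_1 using act_mult \<alpha>_in \<delta>_in assms by simp
qed

lemma b_frame:
  assumes k: "k \<in> {1..d}" and u: "u \<in> Y"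
  shows "b (frame (k, u)) = (if k = 1 then frame (k, act \<gamma> u) else frame (k, u))"
proof (cases "k = 1")
  case True
  then show ?thesis using b_\<beta>[OF u] frame_1 by simp
next
  case False
  have "\<beta> ((act \<delta> ^^ (k - 1)) u) \<in> block"
    using bij_betwE[OF \<beta>_bij] bij_betwE[OF bij_betw_funpow[OF act_\<delta>_bij]] u by blast
  then obtain j i where ji: "j < r" "i < L j" "\<beta> ((act \<delta> ^^ (k - 1)) u) = p j (d * i)"
    by (rule block_cases)
  let ?i = "(d * i + (k - 1)) mod len j"
  have e: "frame (k, u) = p j ?i"
    using ji funpow_a_p[of j "d * i" "k - 1"] mult_less_len[of i j] by (simp add: frame_def)
  have "?i mod d = (d * i + (k - 1)) mod d"
    by (rule mod_mod_cancel) (simp add: len_eq)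
  also have "\<dots> = (k - 1) mod d" by (rule mod_mult_self4)
  also have "\<dots> = k - 1" using k by (intro mod_less) auto
  finally have "0 < ?i" using False k by (metis atLeastAtMost_iff diff_is_0_eq le_antisym mod_0 neq0_conv)
  then show ?thesis using e False b_p[OF ji(1), of ?i] len_pos[of j] by simp
qed

text \<open>The element of the wreath product that acts as \<open>a\<close>. Since \<open>a\<close> moves the block \<open>k\<close> to the block
  \<open>k + 1\<close>, its block permutation is the inverse of the cycle \<open>(1 2 \<dots> d)\<close>. The element that acts as
  \<open>b\<close> is \<open>coord 1 \<gamma>\<close>.\<close>

definition wreath_a :: "(nat \<Rightarrow> 'h) \<times> (nat \<Rightarrow> nat)" where
  "wreath_a = (\<lambda>i\<in>{1..d}. if i = 1 then \<alpha> \<otimes> \<delta> [^] (d - 1) else \<delta>, inv' (cycle_of_list [1..<Suc d]))"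

lemma inv_cycle_mem: "inv' (cycle_of_list [1..<Suc d]) \<in> cyclic_perms d"
  unfolding cyclic_perms_generate_inv by (rule generate.incl) simp

lemma \<Phi>_wreath_a: "\<Phi> wreath_a = a"
  unfolding wreath_a_def
proof (rule \<Phi>_eqI[OF inv_cycle_mem])
  fix i u assume i: "i \<in> {1..d}" and u: "u \<in> Y"
  show "a (frame (inv' (cycle_of_list [1..<Suc d]) i, u))
      = frame (i, act ((\<lambda>i\<in>{1..d}. if i = 1 then \<alpha> \<otimes> \<delta> [^] (d - 1) else \<delta>) i) u)"
  proof (cases "i = 1")
    case True
    then show ?thesis using cycle_perm_inv_apply[OF i] a_frame_last[OF u] i by simp
  next
    case False
    then show ?thesis using cycle_perm_inv_apply[OF i] a_frame[of "i - 1" u] i u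
      by (cases i) auto
  qed
qed (use permutes_not_in[OF a_permutes] in simp)

lemma \<Phi>_coord_\<gamma>: "\<Phi> (coord 1 \<gamma>) = b"
proof
  fix v show "\<Phi> (coord 1 \<gamma>) v = b v"
  proof (cases "v \<in> {1..n}")
    case True
    then obtain i u where "i \<in> {1..d}" "u \<in> Y" "v = frame (i, u)" by (rule f_cases)
    then show ?thesis using \<Phi>_coord b_frame by simp
  qed (use \<Phi>_off permutes_not_in[OF b_permutes] in simp)
qed

lemma wreath_a_carrier: "wreath_a \<in> carrier W"
  unfolding wreath_a_def carrier_W using inv_cycle_mem \<alpha>_in \<delta>_in by auto

theorem star_iso:
  assumes "subgroup W' W" "wreath_a \<in> W'" "coord 1 \<gamma> \<in> W'"
    and "\<And>h. (h, id) \<in> W' \<Longrightarrow> \<Phi> (h, id) \<in> G"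
  shows "(sym_group n)\<lparr>carrier := G\<rparr> \<cong> W\<lparr>carrier := W'\<rparr>"
proof (rule iso_of_image[OF assms(1)])
  show "\<Phi> ` W' = G"
    by (rule image_eq_generate[OF assms(1) _ assms(2) \<Phi>_wreath_a assms(3) \<Phi>_coord_\<gamma> _ assms(4)])
      (simp_all only: G_def wreath_a_def snd_conv cyclic_perms_generate_inv)
qed

text \<open>Without twist, conjugation by \<open>a\<close> moves a coordinate from each block to the next one.\<close>

lemma coord_shift:
  assumes \<delta>: "\<delta> = \<one>" and x: "x \<in> carrier H" and m: "\<Phi> (coord 1 x) \<in> G" and k: "k \<in> {1..d}"
  shows "\<Phi> (coord k x) \<in> G"
proof -
  have "1 \<le> k \<Longrightarrow> k \<le> d \<Longrightarrow> \<Phi> (coord k x) \<in> G" for k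
  proof (induction k rule: dec_induct)
    case (step k)
    have "\<Phi> (coord (Suc k) x) \<circ> a = a \<circ> \<Phi> (coord k x)"
    proof
      fix v show "(\<Phi> (coord (Suc k) x) \<circ> a) v = (a \<circ> \<Phi> (coord k x)) v"
      proof (cases "v \<in> {1..n}")
        case True
        then obtain i u where v: "i \<in> {1..d}" "u \<in> Y" "v = frame (i, u)" by (rule f_cases)
        have xu: "act x u \<in> Y" "act \<alpha> u \<in> Y" using act_closed x \<alpha>_in v(2) by auto
        show ?thesis
        proof (cases "i = d")
          case True
          then show ?thesis using v xu step a_frame_last[OF v(2)] \<Phi>_coord \<alpha>_in d_pos by (simp add: \<delta>)
        next
          case False
          then show ?thesis using v xu step a_frame[of i] \<Phi>_coord act_one by (auto simp: \<delta>)
        qed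
      next
        case False
        then show ?thesis using \<Phi>_off permutes_not_in[OF a_permutes] by simp
      qed
    qed
    then show ?case using comp_mem_cancel[OF a_mem] comp_mem[OF a_mem] step by (metis Suc_leD)
  qed (use m in simp)
  then show ?thesis using k by simp
qed

lemma frame_linked:
  assumes "s \<noteq> t" "k \<in> {1..d}" "u \<in> Y" "v \<in> Y" shows "linked (frame (k, u)) (frame (k, v))"
proof -
  have "\<beta> ((act \<delta> ^^ (k - 1)) x) \<in> block" if "x \<in> Y" for x
    using bij_betwE[OF \<beta>_bij] bij_betwE[OF bij_betw_funpow[OF act_\<delta>_bij]] that by blast
  then show ?thesis
    unfolding frame_def using linked_image[OF funpow_mem[OF a_mem] block_linked[OF assms(1)]] assms by simp
qed

lemma coord_three_cycle:
  assumes "s \<noteq> t" and k: "k \<in> {1..d}" and uvw: "distinct [u, v, w]" "{u, v, w} \<subseteq> Y"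
    and x: "\<And>y. y \<in> Y \<Longrightarrow> act x y = cycle_of_list [u, v, w] y"
  shows "\<Phi> (coord k x) \<in> G"
proof -
  let ?f = "\<lambda>y. frame (k, y)"
  have fi: "?f y = ?f z \<longleftrightarrow> y = z" if "y \<in> Y" "z \<in> Y" for y z
    using f_inj[OF k _ k] that by simp
  have dist: "distinct [?f u, ?f v, ?f w]" using uvw fi by simp
  have "\<Phi> (coord k x) = cycle_of_list [?f u, ?f v, ?f w]"
  proof
    fix y show "\<Phi> (coord k x) y = cycle_of_list [?f u, ?f v, ?f w] y"
    proof (cases "y \<in> {1..n}")
      case True
      then obtain i z where y: "i \<in> {1..d}" "z \<in> Y" "y = frame (i, z)" by (rule f_cases)
      have "i \<noteq> k \<Longrightarrow> y \<noteq> ?f u \<and> y \<noteq> ?f v \<and> y \<noteq> ?f w"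
        using y f_inj[OF y(1,2) k] uvw by simp
      then show ?thesis
        using y uvw x fi three_cycle_apply[OF dist] three_cycle_apply[OF uvw(1)] \<Phi>_coord[OF y(1,2)]
        by (auto simp del: cycle_of_list.simps)
    next
      case False
      then have "y \<notin> set [?f u, ?f v, ?f w]" using f_in k uvw by auto
      then show ?thesis using \<Phi>_off[OF False] id_outside_supp by metis
    qed
  qed
  then show ?thesis
    using linked_three_cycle[OF dist] frame_linked[OF assms(1) k] uvw by simp
qed

end

section \<open>The subgroup of equal signs\<close>

lemma carrier_R_tilde:
  "(h, \<sigma>) \<in> carrier (R_tilde m d) \<longleftrightarrow>
     (h, \<sigma>) \<in> carrier (wreath (sym_group m) d (cyclic_perms d)) \<and>
     (\<forall>i \<in> {1..d}. \<forall>j \<in> {1..d}. sign (h i) = sign (h j))"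
  by (simp add: R_tilde_def)

lemma R_tilde_subgroup:
  "subgroup (carrier (R_tilde m d)) (wreath (sym_group m) d (cyclic_perms d))"
proof -
  let ?W = "wreath (sym_group m) d (cyclic_perms d)"
  let ?R = "carrier (R_tilde m d)"
  interpret W: group ?W by (rule group_wreath[OF sym_group_is_group subgroup_cyclic_perms])
  have perm: "h i permutes {1..m}" if "(h, \<sigma>) \<in> carrier ?W" "i \<in> {1..d}" for h \<sigma> i
  proof -
    have "h i \<in> carrier (sym_group m)"
      using that by (auto simp: wreath_def simp del: atLeastAtMost_iff)
    then show ?thesis by (simp only: sym_group_carrier)
  qed
  have K: "\<sigma> permutes {1..d}" if "(h, \<sigma>) \<in> carrier ?W" for h \<sigma>
  proof -
    have "\<sigma> \<in> carrier (sym_group d)"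
      using that subgroup.mem_carrier[OF subgroup_cyclic_perms] by (simp add: wreath_def)
    then show ?thesis by (simp only: sym_group_carrier)
  qed
  have mult: "(h, \<sigma>) \<otimes>\<^bsub>?W\<^esub> (k, \<tau>) = (\<lambda>i\<in>{1..d}. h i \<circ> k (\<sigma> i), \<tau> \<circ> \<sigma>)" for h \<sigma> k \<tau>
    by (simp add: wreath_def sym_group_mult)
  have one: "\<one>\<^bsub>?W\<^esub> = (\<lambda>i\<in>{1..d}. id, id)" by (simp add: wreath_def sym_group_one)
  have sgn: "sign (h i \<circ> k (\<sigma> i)) = sign (h i) * sign (k (\<sigma> i))"
    if "(h, \<sigma>) \<in> carrier ?W" "(k, \<tau>) \<in> carrier ?W" "i \<in> {1..d}" for h \<sigma> k \<tau> i
  proof -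
    have "\<sigma> i \<in> {1..d}" using permutes_in_image[OF K[OF that(1)]] that(3) by blast
    then show ?thesis using sign_comp_perms[OF _ perm[OF that(1,3)] perm[OF that(2)]] by simp
  qed
  show ?thesis
  proof (rule W.subgroupI)
    show "?R \<subseteq> carrier ?W" by (auto simp: R_tilde_def)
    have "\<one>\<^bsub>?W\<^esub> \<in> ?R" using W.one_closed unfolding one by (simp add: carrier_R_tilde)
    then show "?R \<noteq> {}" by blast
    fix w assume w: "w \<in> ?R"
    obtain h \<sigma> where wh: "w = (h, \<sigma>)" by fastforce
    have hW: "(h, \<sigma>) \<in> carrier ?W" and hs: "\<And>i j. i \<in> {1..d} \<Longrightarrow> j \<in> {1..d} \<Longrightarrow> sign (h i) = sign (h j)"
      using w unfolding wh carrier_R_tilde by blast+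
    show "inv\<^bsub>?W\<^esub> w \<in> ?R"
    proof -
      obtain k \<tau> where k: "inv\<^bsub>?W\<^esub> w = (k, \<tau>)" by fastforce
      have kW: "(k, \<tau>) \<in> carrier ?W" using W.inv_closed[of w] hW unfolding wh k[unfolded wh] by blast
      have "w \<otimes>\<^bsub>?W\<^esub> inv\<^bsub>?W\<^esub> w = \<one>\<^bsub>?W\<^esub>" using W.r_inv[of w] hW wh by simp
      then have e: "(\<lambda>i\<in>{1..d}. h i \<circ> k (\<sigma> i)) = (\<lambda>i\<in>{1..d}. id)"
        unfolding wh k[unfolded wh] mult one by (rule Pair_inject)
      have "sign (k (\<sigma> i)) = sign (h i)" if i: "i \<in> {1..d}" for i
      proof -
        have "h i \<circ> k (\<sigma> i) = id" using fun_cong[OF e, of i] i by simp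
        then have "sign (h i) * sign (k (\<sigma> i)) = 1" using sgn[OF hW kW i] by simp
        then show ?thesis by (cases "h i" rule: sign_cases) auto
      qed
      then have ks: "\<exists>i \<in> {1..d}. sign (k j) = sign (h i)" if "j \<in> {1..d}" for j
        using permutes_in_image[OF K[OF hW]] permutes_surj[OF K[OF hW]] that by (metis surjD)
      show ?thesis unfolding k carrier_R_tilde using kW ks hs by metis
    qed
    fix w' assume w': "w' \<in> ?R"
    obtain k \<tau> where wk: "w' = (k, \<tau>)" by fastforce
    have kW: "(k, \<tau>) \<in> carrier ?W" and ks: "\<And>i j. i \<in> {1..d} \<Longrightarrow> j \<in> {1..d} \<Longrightarrow> sign (k i) = sign (k j)"
      using w' unfolding wk carrier_R_tilde by blast+
    have eq: "sign (h i \<circ> k (\<sigma> i)) = sign (h j \<circ> k (\<sigma> j))" if "i \<in> {1..d}" "j \<in> {1..d}" for i j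
    proof -
      have "\<sigma> i \<in> {1..d}" "\<sigma> j \<in> {1..d}" using permutes_in_image[OF K[OF hW]] that by blast+
      then show ?thesis using sgn[OF hW kW that(1)] sgn[OF hW kW that(2)] hs[OF that] ks[of "\<sigma> i" "\<sigma> j"] by simp
    qed
    then show "w \<otimes>\<^bsub>?W\<^esub> w' \<in> ?R"
      unfolding wh wk mult carrier_R_tilde
    proof (intro conjI ballI)
      show "(\<lambda>i\<in>{1..d}. h i \<circ> k (\<sigma> i), \<tau> \<circ> \<sigma>) \<in> carrier ?W"
        using W.m_closed[OF hW kW] unfolding mult .
      fix i j assume i: "i \<in> {1..d}" and j: "j \<in> {1..d}"
      show "sign ((\<lambda>i\<in>{1..d}. h i \<circ> k (\<sigma> i)) i) = sign ((\<lambda>i\<in>{1..d}. h i \<circ> k (\<sigma> i)) j)"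
        unfolding restrict_apply'[OF i] restrict_apply'[OF j] by (rule eq[OF i j])
    qed
  qed
qed

section \<open>The four types of monodromy groups\<close>

context star_perms
begin

lemma block_card: "card block = (r - 1) * (s div d) + t div d"
proof -
  have "inj_on (\<lambda>(j, i). p j (d * i)) (SIGMA j:{..<r}. {..<L j})"
    using p_inj mult_less_len d_pos by (auto simp: inj_on_def)
  then have "card block = (\<Sum>j<r. L j)"
    unfolding block_def by (simp add: card_image)
  also have "{..<r} = insert 0 {1..<r}" using r by auto
  also have "(\<Sum>j\<in>\<dots>. L j) = t div d + (\<Sum>j\<in>{1..<r}. s div d)"
    by (subst sum.insert) (auto simp: arm_def intro!: sum.cong)
  finally show ?thesis by simp
qed

text \<open>The block numbered by \<open>{1..m}\<close>. There \<open>a\<^sup>d\<close> has one cycle of length \<open>L j\<close> for each arm, and \<open>b\<close> is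
  an \<open>r\<close>-cycle.\<close>

lemma block_coordinates:
  fixes m defines "m \<equiv> card block"
  obtains \<beta> \<alpha> \<gamma> where "bij_betw \<beta> {1..m} block" "\<alpha> permutes {1..m}" "\<gamma> permutes {1..m}"
    "\<forall>u \<in> {1..m}. (a ^^ d) (\<beta> u) = \<beta> (\<alpha> u)" "\<forall>u \<in> {1..m}. b (\<beta> u) = \<beta> (\<gamma> u)"
    "sign \<alpha> = (\<Prod>j<r. (- 1) ^ (L j - 1))" "sign \<gamma> = (- 1) ^ (r - 1)"
proof -
  have fin: "finite block" by (rule finite_subset[OF block_subset]) simp
  then obtain \<beta> where \<beta>: "bij_betw \<beta> {1..m} block"
    using finite_same_card_bij[of "{1..m}" block] m_def by auto
  \<comment> \<open>\<open>q j i\<close> is the number of the \<open>i\<close>-th point of the block on the arm \<open>j\<close>\<close>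
  define q where "q = (\<lambda>j i. the_inv_into {1..m} \<beta> (p j (d * i)))"
  have pb: "p j (d * i) \<in> block" if "j < r" "i < L j" for j i
    using that unfolding block_def by (intro image_eqI[of _ _ "(j, i)"]) auto
  have \<beta>q: "\<beta> (q j i) = p j (d * i)" "q j i \<in> {1..m}" if "j < r" "i < L j" for j i
    using f_the_inv_into_f_bij_betw[OF \<beta>] pb[OF that] bij_betwE[OF bij_betw_the_inv_into[OF \<beta>]]
    by (auto simp: q_def)
  have q_inj: "q j i = q j' i' \<longleftrightarrow> j = j' \<and> i = i'"
    if "j < r" "i < L j" "j' < r" "i' < L j'" for j i j' i'
    using \<beta>q[of j i] \<beta>q[of j' i'] p_inj[of j "d * i" j' "d * i'"] that mult_less_len d_pos
    by (metis mult_cancel1 neq0_conv)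
  have q_cases: "\<exists>j i. j < r \<and> i < L j \<and> u = q j i" if "u \<in> {1..m}" for u
  proof -
    have "\<beta> u \<in> block" using bij_betwE[OF \<beta>] that by blast
    then obtain j i where "j < r" "i < L j" "\<beta> u = p j (d * i)" by (rule block_cases)
    then show ?thesis using the_inv_into_f_f[OF bij_betw_imp_inj_on[OF \<beta>] that] by (auto simp: q_def)
  qed
  have induced: "\<exists>\<tau>. \<tau> permutes {1..m} \<and> (\<forall>u \<in> {1..m}. g (\<beta> u) = \<beta> (\<tau> u))"
    if g: "bij_betw g block block" for g
  proof -
    let ?\<tau> = "\<lambda>u. if u \<in> {1..m} then the_inv_into {1..m} \<beta> (g (\<beta> u)) else u"
    have "bij_betw (the_inv_into {1..m} \<beta> \<circ> g \<circ> \<beta>) {1..m} {1..m}"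
      by (intro bij_betw_trans[OF \<beta>] bij_betw_trans[OF g] bij_betw_the_inv_into[OF \<beta>]) 
    then have "bij_betw ?\<tau> {1..m} {1..m}"
      by (rule bij_betw_cong[THEN iffD1, rotated]) simp
    then have "?\<tau> permutes {1..m}" by (rule bij_imp_permutes) auto
    moreover have "g (\<beta> u) = \<beta> (?\<tau> u)" if "u \<in> {1..m}" for u
      using that f_the_inv_into_f_bij_betw[OF \<beta>] bij_betwE[OF g] bij_betwE[OF \<beta>] by auto
    ultimately show ?thesis by blast
  qed
  have ad: "(a ^^ d) (p j (d * i)) = p j (d * (Suc i mod L j))" if "j < r" "i < L j" for j i
    using funpow_a_p[OF that(1), of "d * i" d] that mult_less_len[of i j]
    by (simp add: len_eq mult_mod_right add.commute)
  have bb: "b (p j (d * i)) = (if i = 0 then p (Suc j mod r) 0 else p j (d * i))" if "j < r" "i < L j" for j i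
    using b_p0[OF that(1)] b_p[OF that(1), of "d * i"] that mult_less_len[of i j] d_pos by simp
  have maps: "bij_betw g block block" if g: "inj g" "\<And>x. x \<in> block \<Longrightarrow> g x \<in> block" for g
    using endo_inj_surj[OF fin, of g] g inj_on_subset[OF g(1)] by (auto simp: bij_betw_def)
  have "bij_betw (a ^^ d) block block"
  proof (rule maps[OF permutes_inj[OF a_pow_permutes]])
    fix x assume "x \<in> block"
    then show "(a ^^ d) x \<in> block" by (rule block_cases) (simp add: ad pb L_pos)
  qed
  then obtain \<alpha> where \<alpha>: "\<alpha> permutes {1..m}" "\<And>u. u \<in> {1..m} \<Longrightarrow> (a ^^ d) (\<beta> u) = \<beta> (\<alpha> u)"
    using induced by metis
  have "bij_betw b block block"
  proof (rule maps[OF permutes_inj[OF b_permutes]])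
    fix x assume "x \<in> block"
    then show "b x \<in> block"
      by (rule block_cases) (use bb pb pb[of _ 0] L_pos r in auto)
  qed
  then obtain \<gamma> where \<gamma>: "\<gamma> permutes {1..m}" "\<And>u. u \<in> {1..m} \<Longrightarrow> b (\<beta> u) = \<beta> (\<gamma> u)"
    using induced by metis
  have \<beta>_inj: "\<beta> u = \<beta> v \<longleftrightarrow> u = v" if "u \<in> {1..m}" "v \<in> {1..m}" for u v
    using inj_on_eq_iff[OF bij_betw_imp_inj_on[OF \<beta>]] that by blast
  have \<alpha>q: "\<alpha> (q j i) = q j (Suc i mod L j)" if "j < r" "i < L j" for j i
  proof -
    have "\<beta> (\<alpha> (q j i)) = \<beta> (q j (Suc i mod L j))"
      using \<alpha>(2)[OF \<beta>q(2)[OF that]] \<beta>q that ad L_pos[of j] by simp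
    then show ?thesis
      using \<beta>_inj \<beta>q(2) that permutes_in_image[OF \<alpha>(1)] L_pos[of j] by (metis mod_less_divisor)
  qed
  have \<gamma>q: "\<gamma> (q j i) = (if i = 0 then q (Suc j mod r) 0 else q j i)" if "j < r" "i < L j" for j i
  proof -
    have m: "(if i = 0 then q (Suc j mod r) 0 else q j i) \<in> {1..m}"
      using \<beta>q(2) that L_pos r by auto
    have "\<beta> (\<gamma> (q j i)) = \<beta> (if i = 0 then q (Suc j mod r) 0 else q j i)"
      using \<gamma>(2)[OF \<beta>q(2)[OF that], symmetric] \<beta>q(1)[OF that] bb[OF that] \<beta>q(1)[of "Suc j mod r" 0] L_pos r
      by simp
    then show ?thesis
      using \<beta>_inj[OF _ m] \<beta>q(2)[OF that] permutes_in_image[OF \<gamma>(1)] by metis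
  qed
  have "sign \<alpha> = (\<Prod>j<r. (- 1) ^ (L j - 1))"
  proof (rule sign_cycles[THEN conjunct2])
    show "inj_on (\<lambda>(j, i). q j i) (SIGMA j:{..<r}. {..<L j})"
      using q_inj by (auto simp: inj_on_def)
    show "\<alpha> x = x" if "\<And>j i. j < r \<Longrightarrow> i < L j \<Longrightarrow> x \<noteq> q j i" for x
      using q_cases permutes_not_in[OF \<alpha>(1)] that by blast
  qed (use L_pos \<alpha>q in auto)
  moreover have "sign \<gamma> = (\<Prod>j<Suc 0. (- 1) ^ (r - 1))"
  proof (rule sign_cycles[where q = "\<lambda>_ i. q i 0" and L = "\<lambda>_. r", THEN conjunct2])
    show "inj_on (\<lambda>(j, i). q i 0) (SIGMA j:{..<Suc 0}. {..<r})"
      using q_inj L_pos by (auto simp: inj_on_def)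
    show "\<gamma> x = x" if x: "\<And>j i. j < Suc 0 \<Longrightarrow> i < r \<Longrightarrow> x \<noteq> q i 0" for x
    proof (cases "x \<in> {1..m}")
      case True
      then obtain j i where ji: "j < r" "i < L j" "x = q j i" using q_cases by blast
      then show ?thesis using \<gamma>q[of j i] x[of 0 j] by (cases "i = 0") auto
    qed (rule permutes_not_in[OF \<gamma>(1)])
  qed (use r L_pos \<gamma>q in auto)
  ultimately show thesis using that \<beta> \<alpha> \<gamma> by simp
qed

lemma perm_star_action:
  fixes m defines "m \<equiv> card block"
  assumes C: "subgroup C (sym_group m)"
    and \<beta>: "bij_betw \<beta> {1..m} block" and in_C: "\<alpha> \<in> C" "\<gamma> \<in> C" "\<delta> \<in> C"
    and \<delta>: "\<delta> \<circ> \<delta> = id"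
    and eq: "\<forall>u \<in> {1..m}. (a ^^ d) (\<beta> u) = \<beta> (\<alpha> u)" "\<forall>u \<in> {1..m}. b (\<beta> u) = \<beta> (\<gamma> u)"
  shows "star_action r s t n p a b ((sym_group m)\<lparr>carrier := C\<rparr>) (\<lambda>\<tau> u. \<tau> u) {1..m} \<beta> \<alpha> \<gamma> \<delta>"
proof -
  have Cp: "\<tau> permutes {1..m}" if "\<tau> \<in> C" for \<tau>
    using subgroup.mem_carrier[OF C that] by (simp only: sym_group_carrier)
  interpret group "(sym_group m)\<lparr>carrier := C\<rparr>"
    using subgroup.subgroup_is_group[OF C sym_group_is_group] .
  have m0: "m \<noteq> 0" unfolding m_def block_card using t by (simp add: dvd_div_eq_0_iff)
  show ?thesis
  proof unfold_locales
    show "x u \<in> {1..m}" if "x \<in> carrier ((sym_group m)\<lparr>carrier := C\<rparr>)" "u \<in> {1..m}" for x u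
      using permutes_in_image[OF Cp] that by simp
    show "x = y" if "x \<in> carrier ((sym_group m)\<lparr>carrier := C\<rparr>)" "y \<in> carrier ((sym_group m)\<lparr>carrier := C\<rparr>)"
      "\<And>u. u \<in> {1..m} \<Longrightarrow> x u = y u" for x y
    proof
      fix u show "x u = y u"
        using that permutes_not_in[OF Cp, of x u] permutes_not_in[OF Cp, of y u]
        by (cases "u \<in> {1..m}") simp_all
    qed
    show "{1..m} \<noteq> {}" using m0 by simp
  qed (use \<beta> in_C eq \<delta> in \<open>simp_all add: sym_group_mult sym_group_one\<close>)
qed

text \<open>\<open>G\<close> contains the alternating group of every block: it contains the three-cycles of the blocks, and
  these generate.\<close>

lemma coord_even_mem:
  fixes m defines "m \<equiv> card block"
  assumes "s \<noteq> t" and C: "subgroup C (sym_group m)" and alt: "carrier (alt_group m) \<subseteq> C"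
    and act: "star_action r s t n p a b ((sym_group m)\<lparr>carrier := C\<rparr>) (\<lambda>\<tau> u. \<tau> u) {1..m} \<beta> \<alpha> \<gamma> \<delta>"
    and k: "k \<in> {1..d}" and x: "x \<in> carrier (alt_group m)"
  shows "wreath_perm (star_action.frame a (\<lambda>\<tau> u. \<tau> u) \<beta> \<delta>) {1..m} d (\<lambda>\<tau> u. \<tau> u)
      (wreath_action.coord ((sym_group m)\<lparr>carrier := C\<rparr>) d k x) \<in> G"
proof -
  let ?H = "(sym_group m)\<lparr>carrier := C\<rparr>"
  interpret A: star_action r s t n p a b ?H "\<lambda>\<tau> u. \<tau> u" "{1..m}" \<beta> \<alpha> \<gamma> \<delta> by (rule act)
  interpret S: group "sym_group m" by (rule sym_group_is_group)
  let ?V = "{x \<in> carrier ?H. A.\<Phi> (A.coord k x) \<in> G}"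
  have "subgroup ?V ?H" by (rule A.coord_subgroup[OF G_subgroup])
  then have V: "subgroup ?V (sym_group m)" by (rule S.incl_subgroup[OF C])
  have "three_cycles m \<subseteq> ?V"
  proof
    fix g assume g: "g \<in> three_cycles m"
    then obtain cs where cs: "g = cycle_of_list cs" "distinct cs" "length cs = 3" "set cs \<subseteq> {1..m}"
      by blast
    obtain u v w where uvw: "cs = [u, v, w]" using stupid_lemma[OF cs(3)] by blast
    have "A.\<Phi> (A.coord k g) \<in> G"
      by (rule A.coord_three_cycle[OF assms(2) k, of u v w]) (use cs uvw in simp_all)
    moreover have "g \<in> C" using three_cycles_incl[of m] g alt by blast
    ultimately show "g \<in> ?V" by simp
  qed
  then have "generate (sym_group m) (three_cycles m) \<subseteq> ?V"
    by (rule S.generate_subgroup_incl[OF _ V])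
  moreover have "x \<in> generate (alt_group m) (three_cycles m)"
    using x alt_group_carrier_as_three_cycles by metis
  moreover have "generate (alt_group m) (three_cycles m) = generate (sym_group m) (three_cycles m)"
    using S.generate_consistent[OF three_cycles_incl alt_group_is_subgroup]
    by (simp add: alt_group_def)
  ultimately show ?thesis by blast
qed

lemma sym_group_carrier_eq: "(sym_group m)\<lparr>carrier := carrier (sym_group m)\<rparr> = sym_group m"
  by (simp add: sym_group_def)

lemma alt_group_carrier_eq: "(sym_group m)\<lparr>carrier := carrier (alt_group m)\<rparr> = alt_group m"
  by (simp add: alt_group_def sym_group_def)

text \<open>The sign of \<open>a\<^sup>d\<close> on a block: for odd \<open>r\<close> the signs of the \<open>r - 1\<close> cycles of length \<open>s/d\<close> cancel.\<close>

lemma prod_cycle_signs: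
  assumes "odd r" shows "(\<Prod>j<r. (- 1) ^ (L j - 1)) = ((- 1) ^ (t div d - 1) :: int)"
proof -
  have "{..<r} = insert 0 {1..<r}" using r by auto
  then have "(\<Prod>j<r. (- 1) ^ (L j - 1)) = (- 1) ^ (t div d - 1) * (\<Prod>j\<in>{1..<r}. (- 1) ^ (s div d - 1) :: int)"
    by (auto simp: arm_def intro!: prod.cong)
  also have "(\<Prod>j\<in>{1..<r}. (- 1) ^ (s div d - 1) :: int) = ((- 1) ^ (r - 1)) ^ (s div d - 1)"
    by (simp add: power_mult[symmetric] mult.commute)
  also have "\<dots> = 1" using assms by simp
  finally show ?thesis by simp
qed

text \<open>For even \<open>r\<close> the permutation \<open>b\<close> is odd on the first block and trivial on the others, so together
  with the alternating groups its conjugates by powers of \<open>a\<close> generate the whole base group.\<close>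

theorem iso_sym_wreath:
  assumes ne: "s \<noteq> t" and ev: "even r"
  shows "(sym_group n)\<lparr>carrier := G\<rparr> \<cong> wreath (sym_group (card block)) d (cyclic_perms d)"
proof -
  define m where "m = card block"
  obtain \<beta> \<alpha> \<gamma> where \<beta>: "bij_betw \<beta> {1..m} block" and perm: "\<alpha> permutes {1..m}" "\<gamma> permutes {1..m}"
    and eq: "\<forall>u \<in> {1..m}. (a ^^ d) (\<beta> u) = \<beta> (\<alpha> u)" "\<forall>u \<in> {1..m}. b (\<beta> u) = \<beta> (\<gamma> u)"
    and sg: "sign \<alpha> = (\<Prod>j<r. (- 1) ^ (L j - 1))" "sign \<gamma> = (- 1) ^ (r - 1)"
    by (rule block_coordinates[folded m_def])
  interpret S: group "sym_group m" by (rule sym_group_is_group)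
  have C: "subgroup (carrier (sym_group m)) (sym_group m)" by (rule S.subgroup_self)
  have alt: "carrier (alt_group m) \<subseteq> carrier (sym_group m)"
    by (auto simp: alt_group_carrier sym_group_carrier)
  have act: "star_action r s t n p a b ((sym_group m)\<lparr>carrier := carrier (sym_group m)\<rparr>) (\<lambda>\<tau> u. \<tau> u) {1..m} \<beta> \<alpha> \<gamma> id"
    by (rule perm_star_action[folded m_def, OF C \<beta> _ _ _ _ eq])
      (simp_all only: sym_group_carrier permutes_id id_o perm)
  note even = coord_even_mem[OF ne, folded m_def, OF C alt act]
  note act = act[unfolded sym_group_carrier_eq] and even = even[unfolded sym_group_carrier_eq]
  interpret A: star_action r s t n p a b "sym_group m" "\<lambda>\<tau> u. \<tau> u" "{1..m}" \<beta> \<alpha> \<gamma> id by (rule act)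
  have odd\<gamma>: "\<not> evenperm \<gamma>" using sg(2) ev r by (simp add: sign_def split: if_splits)
  have coord: "A.\<Phi> (A.coord k x) \<in> G" if k: "k \<in> {1..d}" and x: "x \<in> carrier (sym_group m)" for k x
  proof (cases "evenperm x")
    case True
    then show ?thesis using even[OF k] x by (simp add: alt_group_carrier sym_group_carrier)
  next
    case False
    have g: "A.\<Phi> (A.coord k \<gamma>) \<in> G"
      by (rule A.coord_shift[OF _ A.\<gamma>_in _ k]) (simp_all only: sym_group_one A.\<Phi>_coord_\<gamma> b_mem)
    have xp: "x permutes {1..m}" using x by (simp only: sym_group_carrier)
    have p: "permutation x" "permutation (inv' \<gamma>)" "permutation \<gamma>"
      using x perm by (auto simp: sym_group_carrier permutation_permutes permutation_inverse intro: permutes_inv)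
    have "evenperm (x \<circ> inv' \<gamma>)"
      using evenperm_comp[OF p(1,2)] evenperm_inv[OF p(3)] False odd\<gamma> by simp
    then have e: "x \<circ> inv' \<gamma> \<in> carrier (alt_group m)"
      using permutes_compose[OF permutes_inv[OF perm(2)] xp] by (simp add: alt_group_carrier)
    have "x = (x \<circ> inv' \<gamma>) \<otimes>\<^bsub>sym_group m\<^esub> \<gamma>"
      using permutes_inv_o(2)[OF perm(2)] by (simp add: sym_group_mult comp_assoc)
    then show ?thesis
      using subgroup.m_closed[OF A.coord_subgroup[OF G_subgroup, of k], of "x \<circ> inv' \<gamma>" \<gamma>]
        even[OF k e] e alt g A.\<gamma>_in by auto
  qed
  have "(sym_group n)\<lparr>carrier := G\<rparr> \<cong> A.W\<lparr>carrier := carrier A.W\<rparr>"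
  proof (rule A.star_iso)
    show "subgroup (carrier A.W) A.W" by (rule group.subgroup_self[OF A.group_W])
    show "A.wreath_a \<in> carrier A.W" by (rule A.wreath_a_carrier)
    show "A.coord 1 \<gamma> \<in> carrier A.W" by (rule A.coord_carrier[OF A.\<gamma>_in])
    fix h assume "(h, id) \<in> carrier A.W"
    then have "h \<in> {1..d} \<rightarrow>\<^sub>E carrier (sym_group m)" using A.carrier_W by blast
    then show "A.\<Phi> (h, id) \<in> G"
      by (rule A.base_mem[OF G_subgroup]) (use coord PiE_mem[OF \<open>h \<in> _\<close>] in blast)
  qed
  then show ?thesis by (simp add: m_def)
qed

text \<open>Here \<open>a\<^sup>d\<close> and \<open>b\<close> are even on the block, so both generators have even coordinates.\<close>

theorem iso_alt_wreath:
  assumes ne: "s \<noteq> t" and od: "odd r" "odd (t div d)"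
  shows "(sym_group n)\<lparr>carrier := G\<rparr> \<cong> wreath (alt_group (card block)) d (cyclic_perms d)"
proof -
  define m where "m = card block"
  obtain \<beta> \<alpha> \<gamma> where \<beta>: "bij_betw \<beta> {1..m} block" and perm: "\<alpha> permutes {1..m}" "\<gamma> permutes {1..m}"
    and eq: "\<forall>u \<in> {1..m}. (a ^^ d) (\<beta> u) = \<beta> (\<alpha> u)" "\<forall>u \<in> {1..m}. b (\<beta> u) = \<beta> (\<gamma> u)"
    and sg: "sign \<alpha> = (\<Prod>j<r. (- 1) ^ (L j - 1))" "sign \<gamma> = (- 1) ^ (r - 1)"
    by (rule block_coordinates[folded m_def])
  have C: "subgroup (carrier (alt_group m)) (sym_group m)" by (rule alt_group_is_subgroup)
  have ev: "evenperm \<alpha>" "evenperm \<gamma>"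
    using sg od r unfolding prod_cycle_signs[OF od(1)] by (auto simp: sign_def split: if_splits)
  then have in_C: "\<alpha> \<in> carrier (alt_group m)" "\<gamma> \<in> carrier (alt_group m)" "id \<in> carrier (alt_group m)"
    using perm by (auto simp: alt_group_carrier permutes_id evenperm_id)
  have act: "star_action r s t n p a b ((sym_group m)\<lparr>carrier := carrier (alt_group m)\<rparr>) (\<lambda>\<tau> u. \<tau> u) {1..m} \<beta> \<alpha> \<gamma> id"
    by (rule perm_star_action[folded m_def, OF C \<beta> in_C id_o eq])
  note even = coord_even_mem[OF ne, folded m_def, OF C subset_refl act]
  note act = act[unfolded alt_group_carrier_eq] and even = even[unfolded alt_group_carrier_eq]
  interpret A: star_action r s t n p a b "alt_group m" "\<lambda>\<tau> u. \<tau> u" "{1..m}" \<beta> \<alpha> \<gamma> id by (rule act)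
  have "(sym_group n)\<lparr>carrier := G\<rparr> \<cong> A.W\<lparr>carrier := carrier A.W\<rparr>"
  proof (rule A.star_iso)
    show "subgroup (carrier A.W) A.W" by (rule group.subgroup_self[OF A.group_W])
    show "A.wreath_a \<in> carrier A.W" by (rule A.wreath_a_carrier)
    show "A.coord 1 \<gamma> \<in> carrier A.W" by (rule A.coord_carrier[OF A.\<gamma>_in])
    fix h assume "(h, id) \<in> carrier A.W"
    then have "h \<in> {1..d} \<rightarrow>\<^sub>E carrier (alt_group m)" using A.carrier_W by blast
    then show "A.\<Phi> (h, id) \<in> G"
      by (rule A.base_mem[OF G_subgroup]) (use even PiE_mem[OF \<open>h \<in> _\<close>] in blast)
  qed
  then show ?thesis by (simp add: m_def)
qed

text \<open>Here \<open>b\<close> is even and \<open>a\<^sup>d\<close> is odd on each block, and \<open>d\<close> is odd because the block size is even.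
  With the transposition \<open>(1 2)\<close> as twist, all coordinates of \<open>a\<close> are odd: for the first one,
  \<open>\<alpha> \<delta>\<^bsup>d-1\<^esup>\<close>, this holds as \<open>d - 1\<close> is even. So \<open>a\<^sup>d\<close> is an element of the base group with all
  coordinates odd, which together with the alternating groups gives all base elements with equal
  signs.\<close>

theorem iso_R_tilde:
  assumes ne: "s \<noteq> t" and cop: "gcd d (card block) = 1" and od: "odd r" and ev: "even (t div d)"
  shows "(sym_group n)\<lparr>carrier := G\<rparr> \<cong> R_tilde (card block) d"
proof -
  define m where "m = card block"
  have m_even: "even m" unfolding m_def block_card using od ev r by simp
  moreover have m_pos: "m \<noteq> 0" unfolding m_def block_card using t by (simp add: dvd_div_eq_0_iff)
  ultimately have m2: "2 \<le> m" by (cases m rule: nat.exhaust) (auto elim: oddE)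
  have d_odd: "odd d"
  proof
    assume "even d"
    then have "2 dvd gcd d m" using m_even by (rule gcd_greatest)
    then show False using cop m_def by simp
  qed
  obtain \<beta> \<alpha> \<gamma> where \<beta>: "bij_betw \<beta> {1..m} block" and perm: "\<alpha> permutes {1..m}" "\<gamma> permutes {1..m}"
    and eq: "\<forall>u \<in> {1..m}. (a ^^ d) (\<beta> u) = \<beta> (\<alpha> u)" "\<forall>u \<in> {1..m}. b (\<beta> u) = \<beta> (\<gamma> u)"
    and sg: "sign \<alpha> = (\<Prod>j<r. (- 1) ^ (L j - 1))" "sign \<gamma> = (- 1) ^ (r - 1)"
    by (rule block_coordinates[folded m_def])
  define \<delta> :: "nat \<Rightarrow> nat" where "\<delta> = transpose 1 2"
  have \<delta>p: "\<delta> permutes {1..m}" unfolding \<delta>_def by (rule permutes_swap_id) (use m2 in auto)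
  have \<delta>2: "\<delta> \<circ> \<delta> = id" by (simp add: \<delta>_def)
  have \<delta>s: "sign \<delta> = - 1" by (simp add: \<delta>_def sign_swap_id)
  have "odd (t div d - 1)" using ev t by (simp add: dvd_div_eq_0_iff)
  then have \<alpha>s: "sign \<alpha> = - 1" using sg(1) unfolding prod_cycle_signs[OF od] by simp
  have \<gamma>s: "sign \<gamma> = 1" using sg(2) od by simp
  interpret S: group "sym_group m" by (rule sym_group_is_group)
  have C: "subgroup (carrier (sym_group m)) (sym_group m)" by (rule S.subgroup_self)
  have alt: "carrier (alt_group m) \<subseteq> carrier (sym_group m)"
    by (auto simp: alt_group_carrier sym_group_carrier)
  have act: "star_action r s t n p a b ((sym_group m)\<lparr>carrier := carrier (sym_group m)\<rparr>) (\<lambda>\<tau> u. \<tau> u) {1..m} \<beta> \<alpha> \<gamma> \<delta>"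
    by (rule perm_star_action[folded m_def, OF C \<beta> _ _ _ \<delta>2 eq])
      (simp_all only: sym_group_carrier perm \<delta>p)
  note even = coord_even_mem[OF ne, folded m_def, OF C alt act]
  note act = act[unfolded sym_group_carrier_eq] and even = even[unfolded sym_group_carrier_eq]
  interpret A: star_action r s t n p a b "sym_group m" "\<lambda>\<tau> u. \<tau> u" "{1..m}" \<beta> \<alpha> \<gamma> \<delta> by (rule act)
  let ?c' = "inv' (cycle_of_list [1..<Suc d])"
  have sc: "sign (x \<circ> y) = sign x * sign y" if "x \<in> carrier (sym_group m)" "y \<in> carrier (sym_group m)" for x y
    using that sign_comp_perms[of "{1..m}" x y] by (simp only: sym_group_carrier finite_atLeastAtMost)
  have "sign (\<delta> [^]\<^bsub>sym_group m\<^esub> k) = (- 1) ^ k" for k :: nat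
  proof (induction k)
    case (Suc k)
    then show ?case using sc[OF S.nat_pow_closed[OF A.\<delta>_in] A.\<delta>_in] \<delta>s by (simp add: sym_group_mult o_def)
  qed (simp add: sym_group_one)
  then have \<alpha>\<delta>: "sign (\<alpha> \<otimes>\<^bsub>sym_group m\<^esub> \<delta> [^]\<^bsub>sym_group m\<^esub> (d - 1)) = - 1"
    using sc[OF A.\<alpha>_in S.nat_pow_closed[OF A.\<delta>_in]] \<alpha>s d_odd by (simp add: sym_group_mult)
  have wa_sign: "sign (fst A.wreath_a i) = - 1" if "i \<in> {1..d}" for i
    using that \<alpha>\<delta> \<delta>s by (simp add: A.wreath_a_def)
  have pow: "\<exists>h. (h, ?c' ^^ k) \<in> carrier A.W \<and> A.\<Phi> (h, ?c' ^^ k) = a ^^ k \<and>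
      (\<forall>i \<in> {1..d}. sign (h i) = (- 1) ^ k)" for k
  proof (induction k)
    case 0
    have "(\<lambda>i\<in>{1..d}. id, id) = \<one>\<^bsub>A.W\<^esub>" by (simp add: A.one_W sym_group_one)
    moreover have "\<one>\<^bsub>A.W\<^esub> \<in> carrier A.W"
      using group.is_monoid[OF A.group_W] by (rule monoid.one_closed)
    ultimately have "(\<lambda>i\<in>{1..d}. id, ?c' ^^ 0) \<in> carrier A.W \<and> A.\<Phi> (\<lambda>i\<in>{1..d}. id, ?c' ^^ 0) = a ^^ 0"
      using A.\<Phi>_one by (simp only: funpow_0 funpow.simps)
    moreover have "\<forall>i \<in> {1..d}. sign ((\<lambda>i\<in>{1..d}. id :: nat \<Rightarrow> nat) i) = (- 1) ^ 0" by simp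
    ultimately show ?case by blast
  next
    case (Suc k)
    then obtain h where h: "(h, ?c' ^^ k) \<in> carrier A.W" "A.\<Phi> (h, ?c' ^^ k) = a ^^ k"
      "\<And>i. i \<in> {1..d} \<Longrightarrow> sign (h i) = (- 1) ^ k" by blast
    obtain g where g: "A.wreath_a = (g, ?c')" by (simp add: A.wreath_a_def)
    define h' where "h' = (\<lambda>i\<in>{1..d}. h i \<otimes>\<^bsub>sym_group m\<^esub> g ((?c' ^^ k) i))"
    have e: "(h, ?c' ^^ k) \<otimes>\<^bsub>A.W\<^esub> A.wreath_a = (h', ?c' ^^ Suc k)"
      unfolding g A.mult_W h'_def by simp
    have "(h', ?c' ^^ Suc k) \<in> carrier A.W"
      using monoid.m_closed[OF group.is_monoid[OF A.group_W] h(1) A.wreath_a_carrier] unfolding e .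
    moreover have "A.\<Phi> (h', ?c' ^^ Suc k) = a ^^ Suc k"
      using A.\<Phi>_mult[OF h(1) A.wreath_a_carrier] unfolding e h(2) A.\<Phi>_wreath_a
      by (simp only: funpow_Suc_right)
    moreover have "sign (h' i) = (- 1) ^ Suc k" if i: "i \<in> {1..d}" for i
    proof -
      have ci: "(?c' ^^ k) i \<in> {1..d}" using A.K_in h(1) i A.carrier_W by blast
      have "h i \<in> carrier (sym_group m)" "g ((?c' ^^ k) i) \<in> carrier (sym_group m)"
        using h(1) i ci A.wreath_a_carrier unfolding g A.carrier_W by (auto simp del: atLeastAtMost_iff)
      then show ?thesis
        using sc h(3)[OF i] wa_sign[OF ci] g i by (simp add: h'_def sym_group_mult)
    qed
    ultimately show ?case by blast
  qed
  have "?c' ^^ d = id"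
  proof -
    have "cycle_of_list [1..<Suc d] ^^ length [1..<Suc d] = id"
      by (rule cycle_is_id_root) simp
    then show ?thesis
      using inv_fn[OF permutes_bij[OF cycle_perm_permutes[of d]], of d] by (simp del: upt_Suc)
  qed
  then obtain g where g: "(g, id) \<in> carrier A.W" "A.\<Phi> (g, id) = a ^^ d"
    "\<And>i. i \<in> {1..d} \<Longrightarrow> sign (g i) = - 1"
    using pow[of d] d_odd by auto
  \<comment> \<open>\<open>g\<close> consists of the coordinates of \<open>a\<^sup>d\<close>\<close>
  have evens: "A.\<Phi> (h, id) \<in> G" if h: "(h, id) \<in> carrier A.W" and hs: "\<And>i. i \<in> {1..d} \<Longrightarrow> sign (h i) = 1" for h
  proof -
    have hc: "h \<in> {1..d} \<rightarrow>\<^sub>E carrier (sym_group m)" using h A.carrier_W by blast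
    have ee: "evenperm (h k)" if "k \<in> {1..d}" for k
      using hs[OF that] by (simp add: sign_def split: if_splits)
    show ?thesis
    proof (rule A.base_mem[OF G_subgroup hc])
      fix k assume k: "k \<in> {1..d}"
      then have "h k \<in> carrier (alt_group m)"
        using hc ee[OF k] unfolding alt_group_carrier sym_group_carrier[symmetric] by blast
      then show "A.\<Phi> (A.coord k (h k)) \<in> G" by (rule even[OF k])
    qed
  qed
  have "(sym_group n)\<lparr>carrier := G\<rparr> \<cong> A.W\<lparr>carrier := carrier (R_tilde m d)\<rparr>"
  proof (rule A.star_iso)
    show "subgroup (carrier (R_tilde m d)) A.W" by (rule R_tilde_subgroup)
    show "A.wreath_a \<in> carrier (R_tilde m d)"
      using A.wreath_a_carrier wa_sign
      by (cases A.wreath_a) (simp add: carrier_R_tilde del: atLeastAtMost_iff)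
    have "sign (fst (A.coord 1 \<gamma>) i) = 1" if "i \<in> {1..d}" for i
      using that \<gamma>s by (simp add: A.coord_def sym_group_one)
    then show "A.coord 1 \<gamma> \<in> carrier (R_tilde m d)"
      using A.coord_carrier[OF A.\<gamma>_in, of 1]
      by (cases "A.coord 1 \<gamma>") (simp add: carrier_R_tilde del: atLeastAtMost_iff)
    fix h assume "(h, id) \<in> carrier (R_tilde m d)"
    then have h: "(h, id) \<in> carrier A.W"
      and hs: "\<And>i j. i \<in> {1..d} \<Longrightarrow> j \<in> {1..d} \<Longrightarrow> sign (h i) = sign (h j)"
      unfolding carrier_R_tilde by blast+
    have one: "1 \<in> {1..d}" using d_pos by (simp add: Suc_le_eq)
    show "A.\<Phi> (h, id) \<in> G"
    proof (cases "h 1" rule: sign_cases)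
      case even
      then show ?thesis using evens[OF h] hs[OF _ one] by simp
    next
      case odd
      define k where "k = (\<lambda>i\<in>{1..d}. h i \<otimes>\<^bsub>sym_group m\<^esub> inv\<^bsub>sym_group m\<^esub> g i)"
      have hc: "h i \<in> carrier (sym_group m)" "g i \<in> carrier (sym_group m)" if "i \<in> {1..d}" for i
        using h g(1) that unfolding A.carrier_W by (auto simp del: atLeastAtMost_iff)
      have kc: "(k, id) \<in> carrier A.W"
        unfolding A.carrier_W using hc A.id_K by (auto simp: k_def simp del: atLeastAtMost_iff sym_group_inv_equality)
      have kg: "(k, id) \<otimes>\<^bsub>A.W\<^esub> (g, id) = (h, id)"
      proof -
        have "(\<lambda>i\<in>{1..d}. k i \<otimes>\<^bsub>sym_group m\<^esub> g (id i)) = h"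
        proof
          fix i show "(\<lambda>i\<in>{1..d}. k i \<otimes>\<^bsub>sym_group m\<^esub> g (id i)) i = h i"
          proof (cases "i \<in> {1..d}")
            case True
            then show ?thesis using hc[OF True]
              by (simp add: k_def S.m_assoc del: sym_group_inv_equality atLeastAtMost_iff)
          next
            case False
            then show ?thesis using h unfolding A.carrier_W by (auto simp: PiE_def extensional_def)
          qed
        qed
        then show ?thesis unfolding A.mult_W by simp
      qed
      have "sign (k i) = 1" if i: "i \<in> {1..d}" for i
      proof -
        have ki: "k i \<in> carrier (sym_group m)" using kc i unfolding A.carrier_W by blast
        have "fst ((k, id) \<otimes>\<^bsub>A.W\<^esub> (g, id)) i = h i" unfolding kg by simp
        then have "k i \<circ> g i = h i" using i by (simp add: A.mult_W sym_group_mult)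
        then have "sign (k i) * sign (g i) = sign (h i)" using sc[OF ki hc(2)[OF i]] by simp
        then show ?thesis using g(3)[OF i] hs[OF i one] odd by simp
      qed
      then have "A.\<Phi> (k, id) \<in> G" by (rule evens[OF kc])
      then have "A.\<Phi> (k, id) \<circ> A.\<Phi> (g, id) \<in> G" using comp_mem funpow_mem[OF a_mem] g(2) by metis
      then show ?thesis using A.\<Phi>_mult[OF kc g(1)] unfolding kg by simp
    qed
  qed
  then show ?thesis by (simp add: m_def R_tilde_def)
qed

text \<open>For \<open>s = t\<close> the block consists of the \<open>r\<close> initial points of the arms; \<open>a\<^sup>d\<close> is the identity, and \<open>b\<close>
  rotates the block.\<close>

theorem iso_cyclic_wreath:
  assumes st: "s = t"
  shows "(sym_group n)\<lparr>carrier := G\<rparr> \<cong> wreath (integer_mod_group r) s (cyclic_perms s)"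
proof -
  let ?H = "integer_mod_group r" and ?act = "\<lambda>x u. (x + u) mod int r" and ?Y = "{0..<int r}"
  have d: "d = s" using st by simp
  have car: "carrier ?H = ?Y" using r by (simp add: carrier_integer_mod_group)
  have L1: "L j = 1" for j using s t st by (simp add: arm_def)
  have bij: "bij_betw (\<lambda>j. p (nat j) 0) ?Y block"
  proof (rule bij_betw_imageI)
    show "inj_on (\<lambda>j. p (nat j) 0) ?Y"
      using p_inj len_pos by (auto simp: inj_on_def)
    show "(\<lambda>j. p (nat j) 0) ` ?Y = block"
    proof
      show "(\<lambda>j. p (nat j) 0) ` ?Y \<subseteq> block"
        unfolding block_def by (auto simp: L1 intro!: image_eqI[of _ _ "(nat _, 0)"])
      show "block \<subseteq> (\<lambda>j. p (nat j) 0) ` ?Y"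
      proof
        fix x assume "x \<in> block"
        then obtain j i where "j < r" "i < L j" "x = p j (d * i)" by (rule block_cases)
        then show "x \<in> (\<lambda>j. p (nat j) 0) ` ?Y" by (intro image_eqI[of _ _ "int j"]) (auto simp: L1)
      qed
    qed
  qed
  interpret H: group ?H by simp
  interpret A: star_action r s t n p a b ?H ?act ?Y "\<lambda>j. p (nat j) 0" 0 1 0
  proof unfold_locales
    show "x = y" if "x \<in> carrier ?H" "y \<in> carrier ?H"
      "\<And>u. u \<in> ?Y \<Longrightarrow> (x + u) mod int r = (y + u) mod int r" for x y
      using that(1,2) that(3)[of 0] r unfolding car by simp
    show "?act (x \<otimes>\<^bsub>?H\<^esub> y) u = ?act x (?act y u)" for x y u
      by (simp add: mod_simps add.assoc)
    show "(a ^^ d) (p (nat u) 0) = p (nat ((0 + u) mod int r)) 0" if "u \<in> ?Y" for u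
      using funpow_a_p[of "nat u" 0 d] that t unfolding d by (simp add: arm_def st nat_less_iff)
    show "b (p (nat u) 0) = p (nat ((1 + u) mod int r)) 0" if "u \<in> ?Y" for u
    proof -
      have "nat ((1 + u) mod int r) = Suc (nat u) mod r"
        using that by (simp add: nat_mod_distrib Suc_nat_eq_nat_zadd1 add.commute)
      then show ?thesis using b_p0[of "nat u"] that by (simp add: nat_less_iff)
    qed
    show "?act x u \<in> ?Y" for x u using r by simp
    show "1 \<in> carrier ?H" using r by simp
  qed (use r bij in simp_all)
  have coord: "A.\<Phi> (A.coord k x) \<in> G" if k: "k \<in> {1..d}" and x: "x \<in> carrier ?H" for k x
  proof (rule A.coord_shift[OF _ x _ k])
    let ?V = "{x \<in> carrier ?H. A.\<Phi> (A.coord 1 x) \<in> G}"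
    have V: "subgroup ?V ?H" by (rule A.coord_subgroup[OF G_subgroup])
    have one: "1 \<in> ?V" using A.\<Phi>_coord_\<gamma> b_mem A.\<gamma>_in by simp
    have "int i < int r \<Longrightarrow> int i \<in> ?V" for i
    proof (induction i)
      case 0
      then show ?case using subgroup.one_closed[OF V] by simp
    next
      case (Suc i)
      then have "int i \<in> ?V" by simp
      then have "int i \<otimes>\<^bsub>?H\<^esub> 1 \<in> ?V" by (rule subgroup.m_closed[OF V _ one])
      moreover have "int i \<otimes>\<^bsub>?H\<^esub> 1 = int (Suc i)" using Suc.prems by simp
      ultimately show ?case by metis
    qed
    from this[of "nat x"] show "A.\<Phi> (A.coord 1 x) \<in> G" using x unfolding car by simp
  qed simp
  have "(sym_group n)\<lparr>carrier := G\<rparr> \<cong> A.W\<lparr>carrier := carrier A.W\<rparr>"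
  proof (rule A.star_iso)
    show "subgroup (carrier A.W) A.W" by (rule group.subgroup_self[OF A.group_W])
    show "A.wreath_a \<in> carrier A.W" by (rule A.wreath_a_carrier)
    show "A.coord 1 1 \<in> carrier A.W" by (rule A.coord_carrier[OF A.\<gamma>_in])
    fix h assume "(h, id) \<in> carrier A.W"
    then have "h \<in> {1..d} \<rightarrow>\<^sub>E carrier ?H" using A.carrier_W by blast
    then show "A.\<Phi> (h, id) \<in> G"
      by (rule A.base_mem[OF G_subgroup]) (use coord PiE_mem[OF \<open>h \<in> _\<close>] in blast)
  qed
  then show ?thesis unfolding d by simp
qed

end

section \<open>Cyclic orderings\<close>

lemma cyclic_ordering_funpow:
  assumes c: "cyclic_ordering \<pi> S" and fin: "finite S" and e: "e \<in> S"
  shows "bij_betw (\<lambda>i. (\<pi> ^^ i) e) {..<card S} S"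
    and "i < card S \<Longrightarrow> \<pi> ((\<pi> ^^ i) e) = (\<pi> ^^ (Suc i mod card S)) e"
proof -
  let ?k = "funpow_dist1 \<pi> e e"
  have S: "orbit \<pi> e = S" using c e by (simp add: cyclic_ordering_def)
  then have e': "e \<in> orbit \<pi> e" using e by simp
  have b: "bij_betw (\<lambda>i. (\<pi> ^^ i) e) {0..<?k} S"
    using inj_on_funpow_dist1[OF e'] orbit_conv_funpow_dist1[OF e'] unfolding S by (simp only: bij_betw_def)
  then have k: "?k = card S" using bij_betw_same_card[OF b] by simp
  show "bij_betw (\<lambda>i. (\<pi> ^^ i) e) {..<card S} S" using b unfolding k lessThan_atLeast0 .
  show "\<pi> ((\<pi> ^^ i) e) = (\<pi> ^^ (Suc i mod card S)) e" if "i < card S"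
  proof (cases "Suc i = card S")
    case True
    have "(\<pi> ^^ card S) e = e" using funpow_dist1_prop[OF e'] unfolding k .
    then show ?thesis using True by (metis funpow.simps(2) funpow_0 mod_self o_apply)
  qed (use that in simp)
qed

lemma cyclic_orderingI:
  assumes q: "bij_betw q {..<k} S" and \<pi>: "\<And>i. i < k \<Longrightarrow> \<pi> (q i) = q (Suc i mod k)"
    and off: "\<And>x. x \<notin> S \<Longrightarrow> \<pi> x = x"
  shows "cyclic_ordering \<pi> S"
proof -
  have fin: "finite S" using q bij_betw_finite by blast
  have cases: "\<exists>i < k. x = q i" if "x \<in> S" for x
    using that bij_betw_imp_surj_on[OF q] by auto
  have mem: "q i \<in> S" if "i < k" for i using that bij_betwE[OF q] by blast
  have pow: "(\<pi> ^^ m) (q i) = q ((i + m) mod k)" if "i < k" for i m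
    by (induction m) (use that \<pi> in \<open>simp_all add: mod_Suc_eq\<close>)
  have "\<pi> ` S = S"
  proof
    show "\<pi> ` S \<subseteq> S" using cases \<pi> mem by fastforce
    show "S \<subseteq> \<pi> ` S"
    proof
      fix x assume "x \<in> S"
      then obtain i where i: "i < k" "x = q i" using cases by blast
      have "(\<pi> ^^ k) (q i) = q i" using pow[OF i(1)] i(1) by simp
      moreover have "(\<pi> ^^ k) (q i) = \<pi> ((\<pi> ^^ (k - 1)) (q i))"
        using i(1) by (cases k) auto
      moreover have "(\<pi> ^^ (k - 1)) (q i) \<in> S" using pow[OF i(1)] mem i(1) by simp
      ultimately show "x \<in> \<pi> ` S" using i(2) by (metis imageI)
    qed
  qed
  then have "bij_betw \<pi> S S" using fin by (simp add: bij_betw_def eq_card_imp_inj_on)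
  then have perm: "\<pi> permutes S" using off by (rule bij_imp_permutes)
  have "orbit \<pi> x = S" if "x \<in> S" for x
  proof
    show "orbit \<pi> x \<subseteq> S" by (rule permutes_orbit_subset[OF perm that])
    show "S \<subseteq> orbit \<pi> x"
    proof
      fix y assume "y \<in> S"
      then obtain i j where ij: "i < k" "x = q i" "j < k" "y = q j" using cases[OF \<open>x \<in> S\<close>] cases[OF \<open>y \<in> S\<close>] by blast
      have "(\<pi> ^^ (k + j - i)) x = y" using pow[OF ij(1), of "k + j - i"] ij by simp
      moreover have "0 < k + j - i" using ij by simp
      ultimately show "y \<in> orbit \<pi> x" unfolding orbit_altdef by blast
    qed
  qed
  then show ?thesis using perm by (simp add: cyclic_ordering_def)
qed

section \<open>Isomorphism of dessins\<close>

text \<open>The products of the cycles around the black and around the white vertices, as functions on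
  edges.\<close>

abbreviation black_next :: "('v, 'e) dessin \<Rightarrow> 'e \<Rightarrow> 'e" where
  "black_next D e \<equiv> rotation D (black_end D e) e"

abbreviation white_next :: "('v, 'e) dessin \<Rightarrow> 'e \<Rightarrow> 'e" where
  "white_next D e \<equiv> rotation D (white_end D e) e"

locale dessin =
  fixes D :: "('v, 'e) dessin"
  assumes D: "is_dessin D"
begin

lemma finite_edges: "finite (edges D)" and finite_vertices: "finite (vertices D)"
  using D by (auto simp: is_dessin_def)

lemma ends: "e \<in> edges D \<Longrightarrow> black_end D e \<in> black_vertices D" "e \<in> edges D \<Longrightarrow> white_end D e \<in> white_vertices D"
  using D by (auto simp: is_dessin_def)

lemma disjoint: "v \<in> black_vertices D \<Longrightarrow> v \<in> white_vertices D \<Longrightarrow> False"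
  using D by (auto simp: is_dessin_def)

lemma incident_black: "v \<in> black_vertices D \<Longrightarrow> incident_edges D v = {e \<in> edges D. black_end D e = v}"
  using ends disjoint by (auto simp: incident_edges_def)

lemma incident_white: "v \<in> white_vertices D \<Longrightarrow> incident_edges D v = {e \<in> edges D. white_end D e = v}"
  using ends disjoint by (auto simp: incident_edges_def)

lemma finite_incident: "finite (incident_edges D v)"
  by (rule finite_subset[OF _ finite_edges]) (auto simp: incident_edges_def)

lemma cyclic: "v \<in> vertices D \<Longrightarrow> cyclic_ordering (rotation D v) (incident_edges D v)"
  using D by (auto simp: is_dessin_def)

lemma incident_ends: "e \<in> edges D \<Longrightarrow> e \<in> incident_edges D (black_end D e)"
  "e \<in> edges D \<Longrightarrow> e \<in> incident_edges D (white_end D e)"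
  by (auto simp: incident_edges_def)

lemma end_vertices: "e \<in> edges D \<Longrightarrow> black_end D e \<in> vertices D" "e \<in> edges D \<Longrightarrow> white_end D e \<in> vertices D"
  using ends by (auto simp: vertices_def)

lemma black_next_mem:
  assumes "e \<in> edges D" shows "black_next D e \<in> edges D \<and> black_end D (black_next D e) = black_end D e"
proof -
  have "rotation D (black_end D e) permutes incident_edges D (black_end D e)"
    using cyclic[OF end_vertices(1)[OF assms]] by (simp add: cyclic_ordering_def)
  then have "black_next D e \<in> incident_edges D (black_end D e)"
    using permutes_in_image incident_ends(1)[OF assms] by metis
  then show ?thesis using incident_black[OF ends(1)[OF assms]] by simp
qed

lemma white_next_mem:
  assumes "e \<in> edges D" shows "white_next D e \<in> edges D \<and> white_end D (white_next D e) = white_end D e"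
proof -
  have "rotation D (white_end D e) permutes incident_edges D (white_end D e)"
    using cyclic[OF end_vertices(2)[OF assms]] by (simp add: cyclic_ordering_def)
  then have "white_next D e \<in> incident_edges D (white_end D e)"
    using permutes_in_image incident_ends(2)[OF assms] by metis
  then show ?thesis using incident_white[OF ends(2)[OF assms]] by simp
qed

lemma same_black_end:
  assumes "e \<in> edges D" "f \<in> edges D" "black_end D e = black_end D f"
  shows "\<exists>k. f = (black_next D ^^ k) e"
proof -
  let ?v = "black_end D e"
  have "f \<in> incident_edges D ?v" using incident_ends(1)[OF assms(2)] assms(3) by simp
  moreover have "orbit (rotation D ?v) e = incident_edges D ?v"
    using cyclic[OF end_vertices(1)[OF assms(1)]] incident_ends(1)[OF assms(1)] by (simp add: cyclic_ordering_def)
  ultimately obtain k where k: "f = (rotation D ?v ^^ k) e" unfolding orbit_altdef by blast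
  have "(black_next D ^^ k) e = (rotation D ?v ^^ k) e \<and> (black_next D ^^ k) e \<in> edges D \<and>
      black_end D ((black_next D ^^ k) e) = ?v" for k
  proof (induction k)
    case (Suc k)
    let ?g = "(black_next D ^^ k) e"
    have g: "?g = (rotation D ?v ^^ k) e" "?g \<in> edges D" "black_end D ?g = ?v" using Suc by auto
    then show ?case
      using black_next_mem[OF g(2)] unfolding funpow.simps comp_apply g(1)[symmetric] g(3) by simp
  qed (use assms(1) in simp)
  then show ?thesis using k by metis
qed

lemma same_white_end:
  assumes "e \<in> edges D" "f \<in> edges D" "white_end D e = white_end D f"
  shows "\<exists>k. f = (white_next D ^^ k) e"
proof -
  let ?v = "white_end D e"
  have "f \<in> incident_edges D ?v" using incident_ends(2)[OF assms(2)] assms(3) by simp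
  moreover have "orbit (rotation D ?v) e = incident_edges D ?v"
    using cyclic[OF end_vertices(2)[OF assms(1)]] incident_ends(2)[OF assms(1)] by (simp add: cyclic_ordering_def)
  ultimately obtain k where k: "f = (rotation D ?v ^^ k) e" unfolding orbit_altdef by blast
  have "(white_next D ^^ k) e = (rotation D ?v ^^ k) e \<and> (white_next D ^^ k) e \<in> edges D \<and>
      white_end D ((white_next D ^^ k) e) = ?v" for k
  proof (induction k)
    case (Suc k)
    let ?g = "(white_next D ^^ k) e"
    have g: "?g = (rotation D ?v ^^ k) e" "?g \<in> edges D" "white_end D ?g = ?v" using Suc by auto
    then show ?case
      using white_next_mem[OF g(2)] unfolding funpow.simps comp_apply g(1)[symmetric] g(3) by simp
  qed (use assms(1) in simp)
  then show ?thesis using k by metis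
qed

lemma vertex_has_edge:
  assumes "v \<in> vertices D" "0 < degree D v"
  shows "v \<in> black_vertices D \<Longrightarrow> \<exists>e \<in> edges D. black_end D e = v"
    and "v \<in> white_vertices D \<Longrightarrow> \<exists>e \<in> edges D. white_end D e = v"
  using assms incident_black[of v] incident_white[of v] card_gt_0_iff[of "incident_edges D v"]
  unfolding degree_def by auto

end

text \<open>Two edges have the same black end iff they lie on one cycle of \<^const>\<open>rotation\<close> around it, so a map
  of edges that is compatible with the rotations preserves equality of ends.\<close>

lemma conjugate_ends:
  assumes D: "is_dessin D" and D': "is_dessin D'"
    and maps: "\<And>e. e \<in> edges D \<Longrightarrow> \<psi> e \<in> edges D'"
    and b: "\<And>e. e \<in> edges D \<Longrightarrow> \<psi> (black_next D e) = black_next D' (\<psi> e)"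
    and w: "\<And>e. e \<in> edges D \<Longrightarrow> \<psi> (white_next D e) = white_next D' (\<psi> e)"
    and e: "e \<in> edges D" and f: "f \<in> edges D"
  shows "black_end D e = black_end D f \<Longrightarrow> black_end D' (\<psi> e) = black_end D' (\<psi> f)"
    and "white_end D e = white_end D f \<Longrightarrow> white_end D' (\<psi> e) = white_end D' (\<psi> f)"
proof -
  interpret D: dessin D by (rule dessin.intro[OF D])
  interpret D': dessin D' by (rule dessin.intro[OF D'])
  show "black_end D' (\<psi> e) = black_end D' (\<psi> f)" if "black_end D e = black_end D f"
  proof -
    obtain k where k: "f = (black_next D ^^ k) e" using D.same_black_end[OF e f \<open>black_end D e = black_end D f\<close>] by blast
    have "(black_next D ^^ k) e \<in> edges D \<and> black_end D' (\<psi> ((black_next D ^^ k) e)) = black_end D' (\<psi> e)" for k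
    proof (induction k)
      case (Suc k)
      let ?g = "(black_next D ^^ k) e"
      have "?g \<in> edges D" using Suc by blast
      then show ?case
        using Suc D.black_next_mem[of ?g] b[of ?g] D'.black_next_mem[of "\<psi> ?g"] maps[of ?g] by simp
    qed (use e in simp)
    then show ?thesis using k by metis
  qed
  show "white_end D' (\<psi> e) = white_end D' (\<psi> f)" if "white_end D e = white_end D f"
  proof -
    obtain k where k: "f = (white_next D ^^ k) e" using D.same_white_end[OF e f \<open>white_end D e = white_end D f\<close>] by blast
    have "(white_next D ^^ k) e \<in> edges D \<and> white_end D' (\<psi> ((white_next D ^^ k) e)) = white_end D' (\<psi> e)" for k
    proof (induction k)
      case (Suc k)
      let ?g = "(white_next D ^^ k) e"
      have "?g \<in> edges D" using Suc by blast
      then show ?case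
        using Suc D.white_next_mem[of ?g] w[of ?g] D'.white_next_mem[of "\<psi> ?g"] maps[of ?g] by simp
    qed (use e in simp)
    then show ?thesis using k by metis
  qed
qed

text \<open>A dessin without isolated vertices is determined up to isomorphism by its pair of permutations of
  the edges.\<close>

lemma conjugate_imp_isomorphic:
  assumes D: "is_dessin D" and D': "is_dessin D'"
    and deg: "\<And>v. v \<in> vertices D \<Longrightarrow> 0 < degree D v" and deg': "\<And>v. v \<in> vertices D' \<Longrightarrow> 0 < degree D' v"
    and \<psi>: "bij_betw \<psi> (edges D) (edges D')"
    and b: "\<And>e. e \<in> edges D \<Longrightarrow> \<psi> (black_next D e) = black_next D' (\<psi> e)"
    and w: "\<And>e. e \<in> edges D \<Longrightarrow> \<psi> (white_next D e) = white_next D' (\<psi> e)"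
  shows "dessin_isomorphic D D'"
proof -
  interpret D: dessin D by (rule dessin.intro[OF D])
  interpret D': dessin D' by (rule dessin.intro[OF D'])
  let ?\<psi>' = "the_inv_into (edges D) \<psi>"
  have inj: "inj_on \<psi> (edges D)" using \<psi> by (rule bij_betw_imp_inj_on)
  have maps: "\<psi> e \<in> edges D'" if "e \<in> edges D" for e using bij_betwE[OF \<psi>] that by blast
  have maps': "?\<psi>' e \<in> edges D" if "e \<in> edges D'" for e
    using bij_betwE[OF bij_betw_the_inv_into[OF \<psi>]] that by blast
  have \<psi>\<psi>': "\<psi> (?\<psi>' e) = e" if "e \<in> edges D'" for e
    using f_the_inv_into_f_bij_betw[OF \<psi>] that by blast
  have \<psi>'\<psi>: "?\<psi>' (\<psi> e) = e" if "e \<in> edges D" for e using the_inv_into_f_f[OF inj that] .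
  have b': "?\<psi>' (black_next D' e) = black_next D (?\<psi>' e)" if "e \<in> edges D'" for e
    using b[OF maps'[OF that]] \<psi>\<psi>'[OF that] \<psi>'\<psi>[of "black_next D (?\<psi>' e)"] D.black_next_mem[OF maps'[OF that]] by simp
  have w': "?\<psi>' (white_next D' e) = white_next D (?\<psi>' e)" if "e \<in> edges D'" for e
    using w[OF maps'[OF that]] \<psi>\<psi>'[OF that] \<psi>'\<psi>[of "white_next D (?\<psi>' e)"] D.white_next_mem[OF maps'[OF that]] by simp
  have beq: "black_end D' (\<psi> e) = black_end D' (\<psi> f) \<longleftrightarrow> black_end D e = black_end D f"
    if "e \<in> edges D" "f \<in> edges D" for e f
    using conjugate_ends(1)[where \<psi> = \<psi>, OF D D' maps b w that] conjugate_ends(1)[where \<psi> = ?\<psi>', OF D' D maps' b' w' maps[OF that(1)] maps[OF that(2)]]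
      \<psi>'\<psi> that by auto
  have weq: "white_end D' (\<psi> e) = white_end D' (\<psi> f) \<longleftrightarrow> white_end D e = white_end D f"
    if "e \<in> edges D" "f \<in> edges D" for e f
    using conjugate_ends(2)[where \<psi> = \<psi>, OF D D' maps b w that] conjugate_ends(2)[where \<psi> = ?\<psi>', OF D' D maps' b' w' maps[OF that(1)] maps[OF that(2)]]
      \<psi>'\<psi> that by auto
  define \<phi> where "\<phi> v = (if v \<in> black_vertices D
      then black_end D' (\<psi> (SOME e. e \<in> edges D \<and> black_end D e = v))
      else white_end D' (\<psi> (SOME e. e \<in> edges D \<and> white_end D e = v)))" for v
  have \<phi>b: "\<phi> (black_end D e) = black_end D' (\<psi> e)" if e: "e \<in> edges D" for e
  proof -
    let ?f = "SOME f. f \<in> edges D \<and> black_end D f = black_end D e"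
    have "?f \<in> edges D \<and> black_end D ?f = black_end D e"
      by (rule someI[of _ e]) (use e in simp)
    then have "black_end D' (\<psi> ?f) = black_end D' (\<psi> e)" using beq e by blast
    then show ?thesis using D.ends(1)[OF e] by (simp add: \<phi>_def)
  qed
  have \<phi>w: "\<phi> (white_end D e) = white_end D' (\<psi> e)" if e: "e \<in> edges D" for e
  proof -
    let ?f = "SOME f. f \<in> edges D \<and> white_end D f = white_end D e"
    have "?f \<in> edges D \<and> white_end D ?f = white_end D e"
      by (rule someI[of _ e]) (use e in simp)
    then have "white_end D' (\<psi> ?f) = white_end D' (\<psi> e)" using weq e by blast
    then show ?thesis using D.ends(2)[OF e] D.disjoint by (auto simp: \<phi>_def)
  qed
  have bv: "black_vertices D = black_end D ` edges D" "white_vertices D = white_end D ` edges D"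
    using D.vertex_has_edge deg D.ends by (auto simp: vertices_def)
  have bv': "black_vertices D' = black_end D' ` edges D'" "white_vertices D' = white_end D' ` edges D'"
    using D'.vertex_has_edge deg' D'.ends by (auto simp: vertices_def)
  have surj: "edges D' = \<psi> ` edges D" using bij_betw_imp_surj_on[OF \<psi>] by simp
  have imb: "\<phi> ` black_vertices D = black_vertices D'"
    unfolding bv(1) bv'(1) surj image_image using \<phi>b by (rule image_cong[OF refl])
  have imw: "\<phi> ` white_vertices D = white_vertices D'"
    unfolding bv(2) bv'(2) surj image_image using \<phi>w by (rule image_cong[OF refl])
  have injb: "inj_on \<phi> (black_vertices D)"
    unfolding bv(1) by (rule inj_onI) (use \<phi>b beq in auto)
  have injw: "inj_on \<phi> (white_vertices D)"
    unfolding bv(2) by (rule inj_onI) (use \<phi>w weq in auto)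
  have "inj_on \<phi> (vertices D)"
    unfolding vertices_def using injb injw imb imw D'.disjoint by (auto simp: inj_on_Un)
  then have bij: "bij_betw \<phi> (vertices D) (vertices D')"
    unfolding bij_betw_def using imb imw by (simp add: vertices_def image_Un)
  have rot: "\<psi> (rotation D v e) = rotation D' (\<phi> v) (\<psi> e)" if "e \<in> incident_edges D v" for v e
  proof -
    have e: "e \<in> edges D" and "v = black_end D e \<or> v = white_end D e"
      using that by (auto simp: incident_edges_def)
    then show ?thesis using b[OF e] w[OF e] \<phi>b[OF e] \<phi>w[OF e] by auto
  qed
  show ?thesis
    unfolding dessin_isomorphic_def
    by (intro exI[of _ \<phi>] exI[of _ \<psi>] conjI ballI bij imb imw \<psi>) (simp_all add: \<phi>b \<phi>w rot)
qed

section \<open>Coordinates on a tree with the given passport\<close>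

lemma image_mset_eq_single_exception:
  assumes fin: "finite A" and eq: "image_mset f (mset_set A) = replicate_mset k x + {#y#}"
  shows "card A = Suc k \<and> (\<exists>v \<in> A. f v = y \<and> (\<forall>u \<in> A - {v}. f u = x))"
proof
  show "card A = Suc k" using arg_cong[OF eq, of size] by simp
  have "y \<in># image_mset f (mset_set A)" unfolding eq by simp
  then obtain v where v: "v \<in> A" "f v = y" using fin by auto
  have "mset_set A = add_mset v (mset_set (A - {v}))"
    using fin v(1) by (simp add: mset_set.remove)
  then have e: "image_mset f (mset_set (A - {v})) = replicate_mset k x" using eq v(2) by simp
  have "f u = x" if "u \<in> A - {v}" for u
  proof -
    have "f u \<in># image_mset f (mset_set (A - {v}))" using that fin by auto
    then show ?thesis unfolding e by (auto split: if_splits)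
  qed
  then show "\<exists>v \<in> A. f v = y \<and> (\<forall>u \<in> A - {v}. f u = x)" using v by blast
qed

text \<open>The passport \<open>[s\<^bsup>r-1\<^esup>, t; r, 1\<^bsup>(r-1)(s-1)+(t-1)\<^esup>]\<close>.\<close>

abbreviation (input) star_passport :: "nat \<Rightarrow> nat \<Rightarrow> nat \<Rightarrow> nat multiset \<times> nat multiset" where
  "star_passport r s t \<equiv>
     (replicate_mset (r - 1) s + {#t#}, {#r#} + replicate_mset ((r - 1) * (s - 1) + (t - 1)) 1)"

text \<open>A numbering of the edges in which \<open>q j i\<close> is the \<open>i\<close>-th edge around the \<open>j\<close>-th black vertex, counted
  from the edge that leads to the white vertex of degree \<open>r\<close>.\<close>

definition star_coordinates :: "nat \<Rightarrow> nat \<Rightarrow> nat \<Rightarrow> ('v, 'e) dessin \<Rightarrow> (nat \<Rightarrow> nat \<Rightarrow> 'e) \<Rightarrow> bool" where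
  "star_coordinates r s t D q \<longleftrightarrow>
     bij_betw (\<lambda>(j, i). q j i) (SIGMA j:{..<r}. {..<arm s t j}) (edges D) \<and>
     (\<forall>j<r. \<forall>i<arm s t j. black_next D (q j i) = q j (Suc i mod arm s t j)) \<and>
     (\<forall>j<r. \<forall>i<arm s t j. white_next D (q j i) = (if i = 0 then q (Suc j mod r) 0 else q j i))"

text \<open>Acyclicity enters only through the absence of parallel edges: the \<open>r\<close> edges at the white vertex
  \<open>w0\<close> of degree \<open>r\<close> have different black ends, and there are only \<open>r\<close> black vertices.\<close>

lemma tree_star_coordinates:
  fixes D :: "('v, 'e) dessin"
  assumes tree: "is_tree D" and P: "passport D = star_passport r s t" and r: "1 < r" and s: "1 \<le> s" and t: "1 \<le> t"
  shows "(\<exists>q. star_coordinates r s t D q) \<and> (\<forall>v \<in> vertices D. 0 < degree D v)"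
proof -
  interpret dessin D using tree by (intro dessin.intro) (simp add: is_tree_def)
  have fin: "finite (black_vertices D)" "finite (white_vertices D)"
    using finite_vertices by (auto simp: vertices_def)
  have "image_mset (degree D) (mset_set (black_vertices D)) = replicate_mset (r - 1) s + {#t#}"
    using P by (simp add: passport_def)
  from image_mset_eq_single_exception[OF fin(1) this] r
  obtain v0 where cardB: "card (black_vertices D) = r" and v0: "v0 \<in> black_vertices D" "degree D v0 = t"
    and vs: "\<And>v. v \<in> black_vertices D \<Longrightarrow> v \<noteq> v0 \<Longrightarrow> degree D v = s" by auto
  have "image_mset (degree D) (mset_set (white_vertices D))
      = replicate_mset ((r - 1) * (s - 1) + (t - 1)) 1 + {#r#}"
    using P by (simp add: passport_def)
  from image_mset_eq_single_exception[OF fin(2) this]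
  obtain w0 where w0: "w0 \<in> white_vertices D" "degree D w0 = r"
    and ws: "\<And>w. w \<in> white_vertices D \<Longrightarrow> w \<noteq> w0 \<Longrightarrow> degree D w = 1" by auto
  have pos: "\<forall>v \<in> vertices D. 0 < degree D v"
  proof
    fix v assume "v \<in> vertices D"
    then show "0 < degree D v"
      using v0 vs[of v] w0 ws[of v] r s t unfolding vertices_def
      by (cases "v \<in> black_vertices D"; cases "v = v0"; cases "v = w0") auto
  qed
  let ?I = "incident_edges D w0"
  have I: "e \<in> ?I \<longleftrightarrow> e \<in> edges D \<and> white_end D e = w0" for e using incident_white[OF w0(1)] by simp
  have cardI: "card ?I = r" using w0(2) by (simp add: degree_def)
  have inj: "inj_on (black_end D) ?I"
  proof (rule inj_onI, rule ccontr)
    fix e f assume ef: "e \<in> ?I" "f \<in> ?I" "black_end D e = black_end D f" "e \<noteq> f"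
    have "black_end D e \<noteq> w0" using ends(1) disjoint w0(1) ef(1) I by blast
    then have "graph_cycle D [black_end D e, w0] [e, f]"
      using ef I by (auto simp: graph_cycle_def joins_def less_Suc_eq nth_Cons split: nat.splits)
    then show False using tree by (auto simp: is_tree_def)
  qed
  have bI: "bij_betw (black_end D) ?I (black_vertices D)"
    unfolding bij_betw_def using inj card_image[OF inj] cardI cardB
    by (intro conjI card_subset_eq fin) (auto simp: I ends)
  then obtain e0 where e0: "e0 \<in> ?I" "black_end D e0 = v0" using v0(1) by (metis bij_betw_imp_surj_on imageE)
  have w0v: "w0 \<in> vertices D" using w0(1) by (simp add: vertices_def)
  define h where "h j = (rotation D w0 ^^ j) e0" for j
  have h: "bij_betw h {..<r} ?I" "\<And>j. j < r \<Longrightarrow> rotation D w0 (h j) = h (Suc j mod r)"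
    using cyclic_ordering_funpow[OF cyclic[OF w0v] finite_incident e0(1)] cardI unfolding h_def by auto
  have h0: "h 0 = e0" by (simp add: h_def)
  \<comment> \<open>\<open>V j\<close> is the \<open>j\<close>-th black vertex in the order around \<open>w0\<close>, starting with the vertex \<open>v0\<close> of
    degree \<open>t\<close>\<close>
  define V where "V j = black_end D (h j)" for j
  have V: "bij_betw V {..<r} (black_vertices D)"
    using bij_betw_trans[OF h(1) bI] by (simp add: V_def[abs_def] comp_def)
  have VB: "V j \<in> black_vertices D" if "j < r" for j using bij_betwE[OF V] that by blast
  have V0: "V 0 = v0" by (simp add: V_def h0 e0)
  have V_inj: "V j = V k \<longleftrightarrow> j = k" if "j < r" "k < r" for j k
    using inj_on_eq_iff[OF bij_betw_imp_inj_on[OF V]] that by simp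
  have degV: "card (incident_edges D (V j)) = arm s t j" if "j < r" for j
    using vs[OF VB[OF that]] v0 V0 V_inj[OF that, of 0] r unfolding degree_def arm_def by auto
  have hI: "h j \<in> ?I" if "j < r" for j using bij_betwE[OF h(1)] that by blast
  have hV: "h j \<in> incident_edges D (V j)" if "j < r" for j
    using hI[OF that] I by (simp add: V_def incident_edges_def)
  have Vv: "V j \<in> vertices D" if "j < r" for j using VB[OF that] by (simp add: vertices_def)
  define q where "q j i = (rotation D (V j) ^^ i) (h j)" for j i
  have q: "bij_betw (q j) {..<arm s t j} (incident_edges D (V j))"
    "\<And>i. i < arm s t j \<Longrightarrow> rotation D (V j) (q j i) = q j (Suc i mod arm s t j)" if "j < r" for j
    using cyclic_ordering_funpow[OF cyclic[OF Vv[OF that]] finite_incident hV[OF that]] degV[OF that]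
    unfolding q_def by auto
  have q0: "q j 0 = h j" for j by (simp add: q_def)
  have qE: "q j i \<in> edges D" "black_end D (q j i) = V j" if "j < r" "i < arm s t j" for j i
    using bij_betwE[OF q(1)[OF that(1)]] that incident_black[OF VB[OF that(1)]] by auto
  have arm_pos: "0 < arm s t j" for j using s t by (simp add: arm_def)
  have q_inj: "q j i = q k l \<longleftrightarrow> j = k \<and> i = l" if "j < r" "i < arm s t j" "k < r" "l < arm s t k" for j i k l
  proof
    assume eq: "q j i = q k l"
    then have "j = k" using qE(2)[OF that(1,2)] qE(2)[OF that(3,4)] V_inj[OF that(1,3)] by simp
    then show "j = k \<and> i = l"
      using eq inj_on_eq_iff[OF bij_betw_imp_inj_on[OF q(1)[OF that(1)]], of i l] that by simp
  qed simp
  have "bij_betw (\<lambda>(j, i). q j i) (SIGMA j:{..<r}. {..<arm s t j}) (edges D)"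
  proof (rule bij_betw_imageI)
    show "inj_on (\<lambda>(j, i). q j i) (SIGMA j:{..<r}. {..<arm s t j})"
      using q_inj by (auto simp: inj_on_def)
    show "(\<lambda>(j, i). q j i) ` (SIGMA j:{..<r}. {..<arm s t j}) = edges D"
    proof
      show "(\<lambda>(j, i). q j i) ` (SIGMA j:{..<r}. {..<arm s t j}) \<subseteq> edges D" using qE by auto
      show "edges D \<subseteq> (\<lambda>(j, i). q j i) ` (SIGMA j:{..<r}. {..<arm s t j})"
      proof
        fix e assume e: "e \<in> edges D"
        then obtain j where j: "j < r" "black_end D e = V j"
          using ends(1) bij_betw_imp_surj_on[OF V] by blast
        then have "e \<in> incident_edges D (V j)" using incident_ends(1)[OF e] by simp
        then obtain i where "i < arm s t j" "e = q j i"
          using bij_betw_imp_surj_on[OF q(1)[OF j(1)]] by auto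
        then show "e \<in> (\<lambda>(j, i). q j i) ` (SIGMA j:{..<r}. {..<arm s t j})"
          using j by (intro image_eqI[of _ _ "(j, i)"]) auto
      qed
    qed
  qed
  moreover have "black_next D (q j i) = q j (Suc i mod arm s t j)" if "j < r" "i < arm s t j" for j i
    using q(2) qE(2) that by simp
  moreover have "white_next D (q j i) = (if i = 0 then q (Suc j mod r) 0 else q j i)"
    if ji: "j < r" "i < arm s t j" for j i
  proof (cases "i = 0")
    case True
    then show ?thesis using h(2)[OF ji(1)] hI[OF ji(1)] I q0 by simp
  next
    case False
    let ?w = "white_end D (q j i)"
    have "?w \<noteq> w0"
    proof
      assume "?w = w0"
      then have "q j i \<in> ?I" using I qE(1)[OF ji] by simp
      moreover have "black_end D (q j i) = black_end D (h j)" using qE(2)[OF ji] by (simp add: V_def)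
      ultimately have "q j i = q j 0" using inj hI[OF ji(1)] q0 by (metis inj_onD)
      then show False using q_inj[OF ji ji(1) arm_pos] False by simp
    qed
    then have "card (incident_edges D ?w) = 1" using ws ends(2)[OF qE(1)[OF ji]] by (simp add: degree_def)
    then have one: "incident_edges D ?w = {q j i}"
      using incident_ends(2)[OF qE(1)[OF ji]] by (metis card_1_singletonE singletonD)
    have "rotation D ?w permutes incident_edges D ?w"
      using cyclic[OF end_vertices(2)[OF qE(1)[OF ji]]] by (simp add: cyclic_ordering_def)
    then have "rotation D ?w (q j i) = q j i" unfolding one by (metis permutes_in_image singletonD singletonI)
    then show ?thesis using False by simp
  qed
  ultimately show ?thesis using pos unfolding star_coordinates_def by blast
qed

lemma star_coordinates_isomorphic:
  fixes D :: "('v, 'e) dessin" and D' :: "('w, 'f) dessin"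
  assumes D: "is_dessin D" "\<forall>v \<in> vertices D. 0 < degree D v" "star_coordinates r s t D q"
    and D': "is_dessin D'" "\<forall>v \<in> vertices D'. 0 < degree D' v" "star_coordinates r s t D' q'"
    and r: "1 < r" and s: "1 \<le> s" and t: "1 \<le> t"
  shows "dessin_isomorphic D D'"
proof -
  let ?S = "SIGMA j:{..<r}. {..<arm s t j}" and ?q = "\<lambda>(j, i). q j i" and ?q' = "\<lambda>(j, i). q' j i"
  have bij: "bij_betw ?q ?S (edges D)" "bij_betw ?q' ?S (edges D')"
    using D(3) D'(3) by (auto simp: star_coordinates_def)
  define \<psi> where "\<psi> = ?q' \<circ> the_inv_into ?S ?q"
  have \<psi>: "bij_betw \<psi> (edges D) (edges D')"
    unfolding \<psi>_def by (rule bij_betw_trans[OF bij_betw_the_inv_into[OF bij(1)] bij(2)])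
  have \<psi>q: "\<psi> (q j i) = q' j i" if "j < r" "i < arm s t j" for j i
    using the_inv_into_f_f[OF bij_betw_imp_inj_on[OF bij(1)], of "(j, i)"] that by (simp add: \<psi>_def)
  have cases: "\<exists>j i. j < r \<and> i < arm s t j \<and> e = q j i" if "e \<in> edges D" for e
  proof -
    have "e \<in> ?q ` ?S" unfolding bij_betw_imp_surj_on[OF bij(1)] by (rule that)
    then obtain x where "e = ?q x" "x \<in> ?S" by (rule imageE)
    then show ?thesis by (cases x) auto
  qed
  have arm_pos: "0 < arm s t j" for j using s t by (simp add: arm_def)
  have "\<psi> (black_next D e) = black_next D' (\<psi> e) \<and> \<psi> (white_next D e) = white_next D' (\<psi> e)"
    if e: "e \<in> edges D" for e
  proof -
    obtain j i where ji: "j < r" "i < arm s t j" "e = q j i" using cases[OF e] by blast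
    have n: "black_next D (q j i) = q j (Suc i mod arm s t j)" "black_next D' (q' j i) = q' j (Suc i mod arm s t j)"
      "white_next D (q j i) = (if i = 0 then q (Suc j mod r) 0 else q j i)"
      "white_next D' (q' j i) = (if i = 0 then q' (Suc j mod r) 0 else q' j i)"
      using D(3) D'(3) ji unfolding star_coordinates_def by blast+
    show ?thesis unfolding ji(3) \<psi>q[OF ji(1,2)] n using \<psi>q ji arm_pos r by simp
  qed
  then show ?thesis
    using conjugate_imp_isomorphic[where \<psi> = \<psi>, OF D(1) D'(1) _ _ \<psi>] D(2) D'(2) by blast
qed

section \<open>A tree with the given passport\<close>

text \<open>The edge \<open>(j, i)\<close> is encoded as a natural number by \<^const>\<open>prod_encode\<close>.\<close>

definition star_edges :: "nat \<Rightarrow> nat \<Rightarrow> nat \<Rightarrow> nat set" where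
  "star_edges r s t = prod_encode ` (SIGMA j:{..<r}. {..<arm s t j})"

text \<open>The black vertices are \<open>0, \<dots>, r - 1\<close>, the white vertex of degree \<open>r\<close> is \<open>r\<close>, and the leaf on the
  edge \<open>e\<close> is \<open>r + 1 + e\<close>. The edge \<open>(j, i)\<close> leads from the black vertex \<open>j\<close> to the vertex \<open>r\<close> if
  \<open>i = 0\<close>, and to a leaf otherwise.\<close>

definition star_tree :: "nat \<Rightarrow> nat \<Rightarrow> nat \<Rightarrow> (nat, nat) dessin" where
  "star_tree r s t = \<lparr>
     black_vertices = {..<r},
     white_vertices = insert r ((\<lambda>e. Suc r + e) ` {e \<in> star_edges r s t. snd (prod_decode e) \<noteq> 0}),
     edges = star_edges r s t,
     black_end = (\<lambda>e. fst (prod_decode e)),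
     white_end = (\<lambda>e. if snd (prod_decode e) = 0 then r else Suc r + e),
     rotation = (\<lambda>v e. let (j, i) = prod_decode e in
       if e \<notin> star_edges r s t then e
       else if v = j then prod_encode (j, Suc i mod arm s t j)
       else if v = r \<and> i = 0 then prod_encode (Suc j mod r, 0)
       else e) \<rparr>"

locale star_parameters =
  fixes r s t :: nat
  assumes r: "1 < r" and s: "1 \<le> s" and t: "1 \<le> t"
begin

abbreviation T :: "(nat, nat) dessin" where "T \<equiv> star_tree r s t"
abbreviation q :: "nat \<Rightarrow> nat \<Rightarrow> nat" where "q j i \<equiv> prod_encode (j, i)"

lemma arm_pos: "0 < arm s t j" using s t by (simp add: arm_def)

lemma T_simps:
  "black_vertices T = {..<r}"
  "white_vertices T = insert r ((\<lambda>e. Suc r + e) ` {e \<in> star_edges r s t. snd (prod_decode e) \<noteq> 0})"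
  "edges T = star_edges r s t"
  "black_end T e = fst (prod_decode e)"
  "white_end T e = (if snd (prod_decode e) = 0 then r else Suc r + e)"
  by (simp_all add: star_tree_def)

lemma q_mem: "q j i \<in> star_edges r s t \<longleftrightarrow> j < r \<and> i < arm s t j"
  unfolding star_edges_def by (auto simp: inj_image_mem_iff[OF inj_prod_encode])

lemma edge_cases:
  assumes "e \<in> star_edges r s t" obtains j i where "j < r" "i < arm s t j" "e = q j i"
  using assms unfolding star_edges_def by auto

lemma rotation_T:
  assumes "j < r" "i < arm s t j"
  shows "rotation T v (q j i) = (if v = j then q j (Suc i mod arm s t j)
      else if v = r \<and> i = 0 then q (Suc j mod r) 0 else q j i)"
  using assms q_mem by (simp add: star_tree_def)

lemma rotation_off: "e \<notin> star_edges r s t \<Longrightarrow> rotation T v e = e"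
  by (cases "prod_decode e") (simp add: star_tree_def)

lemma incident_black: "j < r \<Longrightarrow> incident_edges T j = q j ` {..<arm s t j}"
  by (auto simp: incident_edges_def T_simps q_mem elim!: edge_cases split: if_splits)

lemma incident_hub: "incident_edges T r = (\<lambda>j. q j 0) ` {..<r}"
proof (intro Set.set_eqI iffI)
  fix e assume e: "e \<in> incident_edges T r"
  then have "e \<in> star_edges r s t" by (simp add: incident_edges_def T_simps)
  then obtain j i where ji: "j < r" "i < arm s t j" "e = q j i" by (rule edge_cases)
  have "i = 0" using e ji by (auto simp: incident_edges_def T_simps split: if_splits)
  then show "e \<in> (\<lambda>j. q j 0) ` {..<r}" using ji by auto
qed (use arm_pos in \<open>auto simp: incident_edges_def T_simps q_mem\<close>)

lemma incident_leaf:
  assumes "j < r" "0 < i" "i < arm s t j"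
  shows "incident_edges T (Suc r + q j i) = {q j i}"
  using assms by (auto simp: incident_edges_def T_simps q_mem elim!: edge_cases split: if_splits)

lemma vertex_cases:
  assumes "v \<in> vertices T"
  obtains "v < r" | "v = r" | j i where "j < r" "0 < i" "i < arm s t j" "v = Suc r + q j i"
  using assms unfolding vertices_def T_simps by (auto elim!: edge_cases)

lemma degree_black: "j < r \<Longrightarrow> degree T j = arm s t j"
  unfolding degree_def incident_black by (subst card_image) (auto simp: inj_on_def)

lemma degree_hub: "degree T r = r"
  unfolding degree_def incident_hub by (subst card_image) (auto simp: inj_on_def)

lemma degree_leaf: "j < r \<Longrightarrow> 0 < i \<Longrightarrow> i < arm s t j \<Longrightarrow> degree T (Suc r + q j i) = 1"
  unfolding degree_def by (simp only: incident_leaf) simp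

lemma finite_star_edges: "finite (star_edges r s t)"
  by (simp add: star_edges_def)

lemma cyclic_T:
  assumes "v \<in> vertices T" shows "cyclic_ordering (rotation T v) (incident_edges T v)"
  using assms
proof (cases rule: vertex_cases)
  case 1
  show ?thesis
  proof (rule cyclic_orderingI)
    show "bij_betw (q v) {..<arm s t v} (incident_edges T v)"
      unfolding incident_black[OF 1] by (rule bij_betw_imageI) (auto simp: inj_on_def)
    show "rotation T v (q v i) = q v (Suc i mod arm s t v)" if "i < arm s t v" for i
      using rotation_T[OF 1 that] by simp
    show "rotation T v e = e" if "e \<notin> incident_edges T v" for e
    proof (cases "e \<in> star_edges r s t")
      case True
      then obtain j i where ji: "j < r" "i < arm s t j" "e = q j i" by (rule edge_cases)
      then have "v \<noteq> j" using that incident_black[OF 1] by auto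
      then show ?thesis using rotation_T[OF ji(1,2)] ji 1 by simp
    qed (rule rotation_off)
  qed
next
  case 2
  show ?thesis unfolding 2
  proof (rule cyclic_orderingI)
    show "bij_betw (\<lambda>j. q j 0) {..<r} (incident_edges T r)"
      unfolding incident_hub by (rule bij_betw_imageI) (auto simp: inj_on_def)
    show "rotation T r (q j 0) = q (Suc j mod r) 0" if "j < r" for j
      using rotation_T[OF that arm_pos] that by simp
    show "rotation T r e = e" if "e \<notin> incident_edges T r" for e
    proof (cases "e \<in> star_edges r s t")
      case True
      then obtain j i where ji: "j < r" "i < arm s t j" "e = q j i" by (rule edge_cases)
      then have "i \<noteq> 0" using that incident_hub by auto
      then show ?thesis using rotation_T[OF ji(1,2)] ji by simp
    qed (rule rotation_off)
  qed
next
  case (3 j i)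
  show ?thesis
  proof (rule cyclic_orderingI)
    show "bij_betw (\<lambda>_. q j i) {..<1::nat} (incident_edges T v)"
      unfolding 3(4) incident_leaf[OF 3(1,2,3)] by (rule bij_betw_imageI) (auto simp: inj_on_def)
    have id: "rotation T v e = e" for e
    proof (cases "e \<in> star_edges r s t")
      case True
      then obtain j' i' where ji: "j' < r" "i' < arm s t j'" "e = q j' i'" by (rule edge_cases)
      then show ?thesis using rotation_T[OF ji(1,2)] 3 by simp
    qed (rule rotation_off)
    then show "rotation T v e = e" "rotation T v (q j i) = q j i" for e by auto
  qed
qed

lemma connected_T: "connected_graph T"
proof -
  let ?R = "{(x, y). \<exists>e. joins T e x y}"
  have sym: "(y, x) \<in> ?R\<^sup>*" if "(x, y) \<in> ?R\<^sup>*" for x y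
  proof -
    have "sym ?R" by (auto simp: sym_def joins_def insert_commute)
    then show ?thesis using that sym_rtrancl by (metis symD)
  qed
  have hub: "(j, r) \<in> ?R" if "j < r" for j
    using that arm_pos by (auto simp: joins_def T_simps q_mem intro!: exI[of _ "q j 0"])
  have "(v, r) \<in> ?R\<^sup>*" if "v \<in> vertices T" for v
    using that
  proof (cases rule: vertex_cases)
    case 1
    then show ?thesis using hub by blast
  next
    case (3 j i)
    have "(v, j) \<in> ?R" using 3 by (auto simp: joins_def T_simps q_mem insert_commute intro!: exI[of _ "q j i"])
    then show ?thesis using hub[OF 3(1)] by (meson converse_rtrancl_into_rtrancl r_into_rtrancl)
  qed simp
  then show ?thesis
    unfolding connected_graph_def using sym by (auto simp: vertices_def T_simps intro: rtrancl_trans)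
qed

lemma dessin_T: "is_dessin T"
  unfolding is_dessin_def
proof (intro conjI ballI)
  show "finite (vertices T)" "finite (edges T)"
    using finite_star_edges by (auto simp: vertices_def T_simps)
  show "black_vertices T \<inter> white_vertices T = {}" by (auto simp: T_simps)
  show "black_end T e \<in> black_vertices T" "white_end T e \<in> white_vertices T" if "e \<in> edges T" for e
    using that by (auto simp: T_simps elim!: edge_cases)
qed (rule connected_T, rule cyclic_T)

text \<open>In a cycle every end of an edge lies on a second edge. So the white ends are not leaves, all edges
  of the cycle lead to the vertex \<open>r\<close>, and two of them share their black end, which is impossible.\<close>

lemma no_cycle: "\<not> graph_cycle T vs es"
proof
  assume c: "graph_cycle T vs es"
  let ?n = "length es"
  have n: "length vs = ?n" "2 \<le> ?n" and dist: "distinct es"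
    and j: "\<And>i. i < ?n \<Longrightarrow> joins T (es ! i) (vs ! i) (vs ! (Suc i mod ?n))"
    using c by (auto simp: graph_cycle_def)
  have mem: "es ! i \<in> star_edges r s t" if "i < ?n" for i
    using j[OF that] by (simp add: joins_def T_simps)
  have two: "\<exists>l < ?n. l \<noteq> i \<and> v \<in> {black_end T (es ! l), white_end T (es ! l)}"
    if i: "i < ?n" and v: "v \<in> {black_end T (es ! i), white_end T (es ! i)}" for i v
  proof -
    have "v \<in> {vs ! i, vs ! (Suc i mod ?n)}" using j[OF i] v by (simp add: joins_def)
    then consider "v = vs ! i" | "v = vs ! (Suc i mod ?n)" by blast
    then show ?thesis
    proof cases
      case 1
      define k where "k = (i + (?n - 1)) mod ?n"
      have k: "k < ?n" unfolding k_def using n(2) by (intro mod_less_divisor) linarith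
      have "Suc k mod ?n = Suc (i + (?n - 1)) mod ?n" unfolding k_def by (rule mod_Suc_eq)
      also have "Suc (i + (?n - 1)) = i + ?n" using n by simp
      finally have sk: "Suc k mod ?n = i" using i by simp
      have "k \<noteq> i"
      proof
        assume "k = i"
        then have "Suc i mod ?n = i" using sk by simp
        then show False using i n by (cases "Suc i = ?n") auto
      qed
      moreover have "v \<in> {black_end T (es ! k), white_end T (es ! k)}"
        using j[OF k] 1 unfolding sk joins_def by simp
      ultimately show ?thesis using k by blast
    next
      case 2
      define k where "k = Suc i mod ?n"
      have k: "k < ?n" unfolding k_def using n(2) by (intro mod_less_divisor) linarith
      have "k \<noteq> i" unfolding k_def using i n by (cases "Suc i = ?n") auto
      moreover have "v \<in> {black_end T (es ! k), white_end T (es ! k)}"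
        using j[OF k] 2 unfolding k_def[symmetric] joins_def by simp
      ultimately show ?thesis using k by blast
    qed
  qed
  have ends: "black_end T e < r" "r \<le> white_end T e" if "e \<in> star_edges r s t" for e
    using that by (auto simp: T_simps elim!: edge_cases)
  have hub: "snd (prod_decode (es ! i)) = 0" if i: "i < ?n" for i
  proof (rule ccontr)
    assume ne: "snd (prod_decode (es ! i)) \<noteq> 0"
    then have w: "white_end T (es ! i) = Suc r + es ! i" by (simp add: T_simps)
    from two[OF i, of "white_end T (es ! i)"]
    obtain l where l: "l < ?n" "l \<noteq> i"
      and "white_end T (es ! i) \<in> {black_end T (es ! l), white_end T (es ! l)}" by blast
    then have "white_end T (es ! l) = Suc r + es ! i"
      using ends[OF mem[OF l(1)]] ends[OF mem[OF i]] w by auto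
    then have "es ! l = es ! i" by (simp add: T_simps split: if_splits)
    then show False using l i dist by (simp add: nth_eq_iff_index_eq)
  qed
  have z: "0 < ?n" using n(2) by linarith
  from two[OF z, of "black_end T (es ! 0)"]
  obtain l where l: "l < ?n" "l \<noteq> 0"
    and "black_end T (es ! 0) \<in> {black_end T (es ! l), white_end T (es ! l)}" by blast
  then have "black_end T (es ! l) = black_end T (es ! 0)"
    using ends[OF mem[OF l(1)]] ends[OF mem[OF z]] by auto
  then have "prod_decode (es ! l) = prod_decode (es ! 0)"
    using hub[OF l(1)] hub[OF z] by (simp add: T_simps prod_eq_iff)
  then have "es ! l = es ! 0" by (metis prod_decode_inverse)
  then show False using l z dist by (simp add: nth_eq_iff_index_eq)
qed

lemma tree_T: "is_tree T"
  using dessin_T no_cycle by (auto simp: is_tree_def)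

lemma passport_T: "passport T = star_passport r s t"
proof -
  have "{..<r} = insert 0 {1..<r}" using r by auto
  then have "image_mset (degree T) (mset_set (black_vertices T))
      = add_mset (degree T 0) (image_mset (degree T) (mset_set {1..<r}))"
    by (simp add: T_simps)
  also have "image_mset (degree T) (mset_set {1..<r}) = image_mset (\<lambda>_. s) (mset_set {1..<r})"
    by (rule image_mset_cong) (simp add: degree_black arm_def)
  finally have black: "image_mset (degree T) (mset_set (black_vertices T)) = replicate_mset (r - 1) s + {#t#}"
    using degree_black[of 0] r by (simp add: image_mset_const_eq arm_def)
  let ?E = "{e \<in> star_edges r s t. snd (prod_decode e) \<noteq> 0}"
  let ?L = "(\<lambda>e. Suc r + e) ` ?E"
  have E: "?E = prod_encode ` (SIGMA j:{..<r}. {1..<arm s t j})"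
    unfolding star_edges_def by auto
  have "card ?E = (\<Sum>j<r. arm s t j - 1)"
    unfolding E by (subst card_image) (auto intro: inj_on_subset[OF inj_prod_encode])
  also have "{..<r} = insert 0 {1..<r}" using r by auto
  also have "(\<Sum>j\<in>\<dots>. arm s t j - 1) = (t - 1) + (\<Sum>j\<in>{1..<r}. s - 1)"
    by (subst sum.insert) (auto simp: arm_def intro!: sum.cong)
  finally have cardE: "card ?E = (r - 1) * (s - 1) + (t - 1)" by simp
  have "card ?L = card ?E" by (rule card_image) (simp add: inj_on_def)
  then have cardL: "card ?L = (r - 1) * (s - 1) + (t - 1)" using cardE by simp
  have finL: "finite ?L" using finite_star_edges by simp
  have rL: "r \<notin> ?L" by auto
  have "image_mset (degree T) (mset_set (white_vertices T))
      = add_mset (degree T r) (image_mset (degree T) (mset_set ?L))"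
    unfolding T_simps(2) mset_set.insert[OF finL rL] by simp
  also have "image_mset (degree T) (mset_set ?L) = image_mset (\<lambda>_. 1) (mset_set ?L)"
  proof (rule image_mset_cong)
    fix v assume "v \<in># mset_set ?L"
    then obtain j i where "j < r" "0 < i" "i < arm s t j" "v = Suc r + q j i"
      using finL by (auto elim!: edge_cases)
    then show "degree T v = 1" using degree_leaf by simp
  qed
  finally have "image_mset (degree T) (mset_set (white_vertices T))
      = {#r#} + replicate_mset ((r - 1) * (s - 1) + (t - 1)) 1"
    using degree_hub cardL by (simp add: image_mset_const_eq)
  then show ?thesis using black by (simp add: passport_def)
qed

end

section \<open>The monodromy group\<close>

lemma star_coordinates_perms:
  fixes D :: "('v, 'e) dessin"
  assumes D: "is_dessin D" and q: "star_coordinates r s t D q" and l: "labeling D l"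
    and r: "1 < r" and s: "1 \<le> s" and t: "1 \<le> t"
  shows "star_perms r s t (card (edges D)) (\<lambda>j i. l (q j i)) (sigma0 D l) (sigma1 D l)"
proof
  let ?S = "SIGMA j:{..<r}. {..<arm s t j}"
  have bij: "bij_betw (\<lambda>(j, i). q j i) ?S (edges D)"
    using q by (simp add: star_coordinates_def)
  have lab: "bij_betw l (edges D) {1..card (edges D)}" using l by (simp add: labeling_def)
  have "l \<circ> (\<lambda>(j, i). q j i) = (\<lambda>(j, i). l (q j i))" by auto
  then show "bij_betw (\<lambda>(j, i). l (q j i)) ?S {1..card (edges D)}"
    using bij_betw_trans[OF bij lab] by simp
  show "sigma0 D l permutes {1..card (edges D)}" "sigma1 D l permutes {1..card (edges D)}"
    using sigma_in_sym_group[OF D l] by (simp_all only: sym_group_carrier)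
  have qE: "q j i \<in> edges D" if "j < r" "i < arm s t j" for j i
    using bij_betwE[OF bij] that by force
  have on: "on_labels D l p (l (q j i)) = l (p (q j i))" if "j < r" "i < arm s t j" for p j i
    using bij_betwE[OF lab] the_inv_into_f_f[OF bij_betw_imp_inj_on[OF lab]] qE[OF that]
    unfolding on_labels_def by auto
  have arm_pos: "0 < arm s t j" for j using s t by (simp add: arm_def)
  show "sigma0 D l (l (q j i)) = l (q j (Suc i mod arm s t j))" if "j < r" "i < arm s t j" for j i
    using on[OF that] q that by (simp add: sigma0_def star_coordinates_def)
  show "sigma1 D l (l (q j 0)) = l (q (Suc j mod r) 0)" if "j < r" for j
    using on[OF that arm_pos] q that arm_pos by (simp add: sigma1_def star_coordinates_def)
  show "sigma1 D l (l (q j i)) = l (q j i)" if "j < r" "0 < i" "i < arm s t j" for j i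
    using on[OF that(1,3)] q that by (simp add: sigma1_def star_coordinates_def)
qed (use r s t in auto)

lemma monodromy_group_eq:
  assumes "is_dessin D" "labeling D l"
  shows "monodromy_group D l = (sym_group (card (edges D)))
    \<lparr>carrier := generate (sym_group (card (edges D))) {sigma0 D l, sigma1 D l}\<rparr>"
  unfolding monodromy_group_def subgroup_generated_def
  using sigma_in_sym_group[OF assms] by (simp add: Int_absorb1)

theorem proposition7:
  fixes r s t n d :: nat and P :: "nat multiset \<times> nat multiset"
  assumes "r > 1" and "s \<ge> 1" and "t \<ge> 1"
    and "n = (r - 1) * s + t" and "d = gcd s t"
    and "P = (replicate_mset (r - 1) s + {#t#},
              {#r#} + replicate_mset ((r - 1) * (s - 1) + (t - 1)) 1)"
  shows "(\<exists>T :: (nat, nat) dessin. is_tree T \<and> passport T = P) \<and>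
    (\<forall>(T :: ('v, 'e) dessin) (T' :: ('w, 'f) dessin).
       is_tree T \<and> passport T = P \<and> is_tree T' \<and> passport T' = P \<longrightarrow> dessin_isomorphic T T') \<and>
    (\<forall>T :: ('v, 'e) dessin. is_tree T \<and> passport T = P \<longrightarrow>
       card (edges T) = n \<and>
       (\<forall>l. labeling T l \<longrightarrow>
         (s = t \<longrightarrow>
            monodromy_group T l \<cong> wreath (integer_mod_group r) s (cyclic_perms s)) \<and>
         (s \<noteq> t \<and> gcd d (n div d) = 1 \<and> even r \<longrightarrow>
            monodromy_group T l \<cong> wreath (sym_group (n div d)) d (cyclic_perms d)) \<and>
         (s \<noteq> t \<and> gcd d (n div d) = 1 \<and> odd r \<and> even (t div d) \<longrightarrow>
            monodromy_group T l \<cong> R_tilde (n div d) d) \<and>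
         (s \<noteq> t \<and> gcd d (n div d) = 1 \<and> odd r \<and> odd (t div d) \<longrightarrow>
            monodromy_group T l \<cong> wreath (alt_group (n div d)) d (cyclic_perms d))))"
proof (intro conjI allI impI)
  interpret S: star_parameters r s t using assms by unfold_locales
  show "\<exists>T :: (nat, nat) dessin. is_tree T \<and> passport T = P"
    using S.tree_T S.passport_T unfolding assms(6) by blast
  note coords = tree_star_coordinates[OF _ _ assms(1,2,3), folded assms(6)]
  show "dessin_isomorphic T T'"
    if "is_tree T \<and> passport T = P \<and> is_tree T' \<and> passport T' = P"
    for T :: "('v, 'e) dessin" and T' :: "('w, 'f) dessin"
    using coords[of T] coords[of T'] that star_coordinates_isomorphic[OF _ _ _ _ _ _ assms(1,2,3)]
    unfolding is_tree_def by metis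
  fix T :: "('v, 'e) dessin" assume T: "is_tree T \<and> passport T = P"
  then have D: "is_dessin T" by (simp add: is_tree_def)
  obtain q where q: "star_coordinates r s t T q" using coords[of T] T by blast
  have "card (edges T) = card (SIGMA j:{..<r}. {..<arm s t j})"
    using q bij_betw_same_card unfolding star_coordinates_def by metis
  also have "\<dots> = (\<Sum>j<r. arm s t j)" by simp
  also have "{..<r} = insert 0 {1..<r}" using assms(1) by auto
  also have "(\<Sum>j\<in>\<dots>. arm s t j) = t + (\<Sum>j\<in>{1..<r}. s)"
    by (subst sum.insert) (auto simp: arm_def intro!: sum.cong)
  finally show card: "card (edges T) = n" by (simp add: assms(4))
  fix l assume l: "labeling T l"
  interpret star_perms r s t "card (edges T)" "\<lambda>j i. l (q j i)" "sigma0 T l" "sigma1 T l"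
    by (rule star_coordinates_perms[OF D q l assms(1,2,3)])
  have mono: "monodromy_group T l = (sym_group (card (edges T)))\<lparr>carrier := G\<rparr>"
    unfolding G_def by (rule monodromy_group_eq[OF D l])
  have "n = gcd s t * ((r - 1) * (s div gcd s t) + t div gcd s t)"
    unfolding assms(4) by (simp add: distrib_left mult.left_commute)
  then have block: "card block = n div d" unfolding block_card assms(5) using d_pos by simp
  show "monodromy_group T l \<cong> wreath (integer_mod_group r) s (cyclic_perms s)" if "s = t"
    unfolding mono by (rule iso_cyclic_wreath[OF that])
  show "monodromy_group T l \<cong> wreath (sym_group (n div d)) d (cyclic_perms d)"
    if "s \<noteq> t \<and> gcd d (n div d) = 1 \<and> even r"
    using iso_sym_wreath that unfolding mono block assms(5)[symmetric] by blast
  show "monodromy_group T l \<cong> R_tilde (n div d) d"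
    if "s \<noteq> t \<and> gcd d (n div d) = 1 \<and> odd r \<and> even (t div d)"
    using iso_R_tilde that unfolding mono block assms(5)[symmetric] by blast
  show "monodromy_group T l \<cong> wreath (alt_group (n div d)) d (cyclic_perms d)"
    if "s \<noteq> t \<and> gcd d (n div d) = 1 \<and> odd r \<and> odd (t div d)"
    using iso_alt_wreath that unfolding mono block assms(5)[symmetric] by blast
qed

end
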